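(* Let $f$ be a circle homeomorphism in the class $\mathcal{F}$ described in the context, and let $\mu$ be its unique invariant probability measure. Then $\mu$ is totally singular with respect to the Lebesgue measure (i.e. $\mu$ and Lebesgue measure are mutually singular).
   Context: Class $\mathcal{F}$: orientation-preserving $C^3$ homeomorphisms $f$ of the circle $\mathbb{R}/\mathbb{Z}$, with irrational rotation number $\rho$ of constant type (the coefficients of the continued fraction expansion of $\rho$ are bounded), having exactly one critical point, placed at $0$, such that after a $C^2$ change of coordinate $f$ has near $0$ the form $x\mapsto x^3+\varepsilon$ for a constant $\varepsilon$. *)

theory Defs
  imports "HOL-Probability.Probability"
begin

text \<open>
  The circle \<open>\<real>/\<int>\<close> is identified with its fundamental domain \<open>[0,1)\<close>; the quotient map
  \<open>\<real> \<rightarrow> \<real>/\<int>\<close> becomes \<^const>\<open>frac\<close>, and the Borel sets of the circle correspond to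
  the Borel subsets of \<open>[0,1)\<close>.  An orientation-preserving circle homeomorphism is given by a
  lift to \<open>\<real>\<close>; the circle map itself is then \<open>circle_map F\<close>.
\<close>

definition circle_homeo_lift :: "(real \<Rightarrow> real) \<Rightarrow> bool" where
  "circle_homeo_lift F \<longleftrightarrow>
     continuous_on UNIV F \<and> strict_mono F \<and> (\<forall>x. F (x + 1) = F x + 1)"

definition circle_map :: "(real \<Rightarrow> real) \<Rightarrow> real \<Rightarrow> real" where
  "circle_map F x = frac (F x)"

definition C_class :: "nat \<Rightarrow> (real \<Rightarrow> real) \<Rightarrow> bool" where
  "C_class k f \<longleftrightarrow>
     (\<forall>i<k. \<forall>x. (deriv ^^ i) f field_differentiable at x) \<and>
     continuous_on UNIV ((deriv ^^ k) f)"

text \<open>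
  For a lift \<open>F\<close> the limit exists, is the same for every starting point, and changes by an
  integer when another lift is chosen, so its fractional part depends on the circle map only.
\<close>

definition rotation_number :: "(real \<Rightarrow> real) \<Rightarrow> real" where
  "rotation_number F = frac (lim (\<lambda>n. (F ^^ n) 0 / real n))"

text \<open>
  For irrational \<open>x\<close> all complete quotients are irrational, so no division by zero occurs
  and the expansion \<open>x = a\<^sub>0 + 1/(a\<^sub>1 + 1/(a\<^sub>2 + \<dots>))\<close> is infinite.
\<close>

primrec complete_quotient :: "real \<Rightarrow> nat \<Rightarrow> real" where
  "complete_quotient x 0 = x"
| "complete_quotient x (Suc n) = 1 / frac (complete_quotient x n)"

definition cf_coeff :: "real \<Rightarrow> nat \<Rightarrow> int" where
  "cf_coeff x n = \<lfloor>complete_quotient x n\<rfloor>"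

definition constant_type :: "real \<Rightarrow> bool" where
  "constant_type x \<longleftrightarrow> x \<notin> \<rat> \<and> (\<exists>B. \<forall>n. cf_coeff x n \<le> B)"

text \<open>
  A \<open>C\<^sup>2\<close> change of coordinate is a \<open>C\<^sup>2\<close> diffeomorphism of the circle, represented by a lift
  \<open>H\<close>; in the new coordinate the map \<open>F\<close> reads \<open>H \<circ> F \<circ> H\<^sup>-\<^sup>1\<close>.
\<close>

definition C2_circle_coordinate :: "(real \<Rightarrow> real) \<Rightarrow> bool" where
  "C2_circle_coordinate H \<longleftrightarrow>
     circle_homeo_lift H \<and> C_class 2 H \<and> C_class 2 (inv H)"

definition cubic_near_zero :: "(real \<Rightarrow> real) \<Rightarrow> bool" where
  "cubic_near_zero F \<longleftrightarrow>
     (\<exists>H \<epsilon>. C2_circle_coordinate H \<and> H 0 = 0 \<and>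
        (\<forall>\<^sub>F x in nhds 0. H (F (inv H x)) = x ^ 3 + \<epsilon>))"

text \<open>
  The critical points of a lift are the integer translates of those in \<open>[0,1)\<close>, so a single
  critical point at \<open>0\<close> on the circle means that \<open>\<int>\<close> is the critical set of the lift.
\<close>

definition class_F :: "(real \<Rightarrow> real) \<Rightarrow> bool" where
  "class_F F \<longleftrightarrow>
     circle_homeo_lift F \<and> C_class 3 F \<and>
     constant_type (rotation_number F) \<and>
     (\<forall>x. deriv F x = 0 \<longleftrightarrow> x \<in> \<int>) \<and>
     cubic_near_zero F"

definition circle_lebesgue :: "real measure" where
  "circle_lebesgue = restrict_space lborel {0..<1}"

definition circle_prob_measure :: "real measure \<Rightarrow> bool" where
  "circle_prob_measure M \<longleftrightarrow>
     prob_space M \<and> sets M = sets (restrict_space borel {0..<1::real})"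

definition invariant_measure :: "('a \<Rightarrow> 'a) \<Rightarrow> 'a measure \<Rightarrow> bool" where
  "invariant_measure T M \<longleftrightarrow> T \<in> measurable M M \<and> distr M M T = M"

definition mutually_singular :: "'a measure \<Rightarrow> 'a measure \<Rightarrow> bool" where
  "mutually_singular M N \<longleftrightarrow>
     sets M = sets N \<and>
     (\<exists>A\<in>sets M. emeasure M A = 0 \<and> emeasure N (space N - A) = 0)"

end

(*
  Suppose mu is not singular. Removing a Lebesgue null set of maximal mu-measure leaves an
  absolutely continuous invariant measure, whose distribution function h semiconjugates F to
  a rotation and has a positive one-sided derivative at some point x0: small configurations near
  x0 have almost the same cross-ratios in the circle as in the h-coordinate.

  In a C^2 coordinate in which F is exactly cubic near its critical point, F multiplies the cross-ratio
  of a quadruple spanning a small interval T free of critical points by at least 1 - o(1) |T|.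
  Along disjoint intervals that become uniformly small, cross-ratios are therefore almost
  nondecreasing. Since the rotation number is of constant type, there are orbit segments of disjoint
  small intervals which start and end near x0 and meet the critical point exactly once; the cubic
  critical point increases a suitable cross-ratio by a definite factor, while at both ends
  the cross-ratio is determined by the h-coordinate. That the intervals become
  uniformly small is the absence of plateaus of h, proved by the same distortion estimates.
*)
theory Submission
  imports Defs "HOL-Analysis.Kronecker_Approximation_Theorem"
begin

text \<open>Constant type is used in two opposite ways at one scale. An interval of
  \<open>h\<close>-length below c/n has disjoint first n images on the circle, so their lengths sum
  to at most 1 and the total cross-ratio loss stays small; and any n consecutive orbit points come
  within (1 + 1/c)/n of every point in the \<open>h\<close>-coordinate, which supplies the passage
  at the critical point and the return within time 2n. Quadruples of \<open>h\<close>-length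
  comparable to 1/N therefore survive 2N steps and come back at a bounded number of their own
  lengths from x0, close enough for the derivative at x0 to fix their cross-ratios up to one
  percent.

  The obstacle is that estimates with small total loss need all images to be short, which is known
  only once \<open>h\<close> is a homeomorphism. The absence of plateaus therefore rests on a cruder
  estimate, which loses a bounded factor at each of boundedly many bad times. In the final argument
  a gain of 21/20 beats two losses of 1/100 and an error of 1/100 at either end.\<close>

section \<open>Badly approximable rotation numbers\<close>

text \<open>
  The form \<open>(q x - p) (q y + p) / (x + y)\<close> only changes its sign under a step of the continued fraction
  algorithm, \<open>x = a + 1/x'\<close>, \<open>y' = 1/(y + a)\<close>, \<open>(q', p') = (p - a q, q)\<close>.
\<close>

lemma indefinite_form_lower_bound:
  fixes x y B :: real and p q :: int
  assumes "\<And>n. complete_quotient x n \<notin> \<rat>"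
    and "\<And>n. 1 \<le> cf_coeff x n" and "\<And>n. real_of_int (cf_coeff x n) \<le> B"
    and "0 \<le> y" "y \<le> 1" and "0 \<le> p" "0 \<le> q" and "p + q > 0"
    and "p > 0 \<or> y \<ge> 1 / (B + 1)"
  shows "1 / ((B + 1) * (B + 2)) \<le> \<bar>(q * x - p) * (q * y + p)\<bar> / (x + y)"
  using assms
proof (induction "nat (p + q)" arbitrary: x y p q rule: less_induct)
  case less
  define a where "a = \<lfloor>x\<rfloor>"
  have B: "1 \<le> B" using less.prems(2,3)[of 0] by linarith
  have a: "1 \<le> a" "a \<le> B" using less.prems(2,3)[of 0] by (auto simp: a_def cf_coeff_def)
  have ax: "a \<le> x" "x < a + 1" unfolding a_def by linarith+
  have xy: "1 \<le> x + y" "x + y \<le> B + 2" using a ax less.prems(4,5) by linarith+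
  \<comment> \<open>Since \<open>x + y <= B + 2\<close>, a numerator of at least 1/(B + 1) suffices;
    this fixes the shape of the constant.\<close>
  have reduce: "1 / ((B + 1) * (B + 2)) \<le> w / (x + y)" if "1 / (B + 1) \<le> w" for w
  proof -
    have "1 / ((B + 1) * (B + 2)) = (1 / (B + 1)) / (B + 2)" by simp
    also have "\<dots> \<le> w / (x + y)"
    proof (rule frac_le)
      have "0 \<le> 1 / (B + 1)" using B by simp
      then show "0 \<le> w" using that by linarith
    qed (use that xy in auto)
    finally show ?thesis .
  qed
  have B1: "1 / (B + 1) \<le> 1" using B by simp
  \<comment> \<open>The continued fraction step applies while \<open>a * q <= p\<close>. Otherwise
    p/q lies below the integer part of x by at least 1/q, and both factors are bounded
    directly.\<close>
  consider (q0) "q = 0" | (step) "q \<ge> 1" "a * q \<le> p" | (base) "q \<ge> 1" "p < a * q"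
    using less.prems(7) by linarith
  then show ?case
  proof cases
    case q0
    then have "p \<ge> 1" using less.prems(8) by simp
    then have "1 * 1 \<le> real_of_int p * real_of_int p" by (intro mult_mono) auto
    then show ?thesis
      using q0 B1 by (intro reduce) (simp add: abs_mult)
  next
    case base
    have "p \<le> a * q - 1" using base by simp
    then have "real_of_int p \<le> real_of_int (a * q - 1)" by (simp only: of_int_le_iff)
    then have "real_of_int p \<le> real_of_int a * real_of_int q - 1" by simp
    moreover have "real_of_int a * q \<le> q * x" using ax base by (simp add: mult.commute)
    ultimately have 1: "1 \<le> q * x - p" by linarith
    have 2: "1 / (B + 1) \<le> q * y + p"
    proof (cases "p > 0")
      case True
      then have "1 \<le> real_of_int p" "0 \<le> q * y" using base less.prems(4) by auto
      then show ?thesis using B1 by linarith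
    next
      case False
      then have "1 / (B + 1) \<le> 1 * y" using less.prems(9) by simp
      also have "\<dots> \<le> q * y" using base less.prems(4) by (intro mult_right_mono) auto
      finally show ?thesis using less.prems(6) by simp
    qed
    have "1 / (B + 1) \<le> 1 * (q * y + p)" using 2 by simp
    also have "\<dots> \<le> (q * x - p) * (q * y + p)"
    proof (rule mult_right_mono[OF 1])
      have "0 \<le> 1 / (B + 1)" using B by simp
      then show "0 \<le> q * y + p" using 2 by linarith
    qed
    finally show ?thesis by (intro reduce) linarith
  next
    case step
    define x' where "x' = 1 / (x - a)"
    define y' where "y' = 1 / (y + a)"
    define p' where "p' = p - a * q"
    have irr: "x \<notin> \<rat>" using less.prems(1)[of 0] by simp
    have "x \<noteq> a" using irr by auto
    then have xa: "0 < x - a" "x - a < 1" using ax by auto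
    have cq: "complete_quotient x' n = complete_quotient x (Suc n)" for n
      by (induction n) (auto simp: x'_def a_def frac_def)
    have ya: "1 \<le> y + a" "y + a \<le> B + 1" using a less.prems(4,5) by linarith+
    have IH: "1 / ((B + 1) * (B + 2)) \<le> \<bar>(p' * x' - q) * (p' * y' + q)\<bar> / (x' + y')"
    proof (rule less.hyps)
      have *: "0 < a * q" using a step by simp
      show "nat (q + p') < nat (p + q)"
        using * less.prems(6,7) step by (auto simp: p'_def)
      show "complete_quotient x' n \<notin> \<rat>" for n unfolding cq by (rule less.prems(1))
      show "1 \<le> cf_coeff x' n" "cf_coeff x' n \<le> B" for n
        using less.prems(2,3)[of "Suc n"] unfolding cf_coeff_def cq by auto
      show "0 \<le> y'" "y' \<le> 1" using ya by (auto simp: y'_def)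
      show "0 \<le> p'" using step by (simp add: p'_def)
      then show "0 < q + p'" using step by simp
      show "0 < q \<or> 1 / (B + 1) \<le> y'" using step by simp
      show "0 \<le> q" using step by simp
    qed
    have "(q * x - p) * (q * y + p) / (x + y) = - ((p' * x' - q) * (p' * y' + q) / (x' + y'))"
    proof -
      have nz: "x - a \<noteq> 0" "y + a \<noteq> 0" "x + y \<noteq> 0" using xa ya xy by auto
      have s: "x' + y' = (x + y) / ((x - a) * (y + a))"
        using nz unfolding x'_def y'_def by (simp add: field_simps)
      have e1: "p' * x' - q = - (q * x - p) / (x - a)"
        using nz unfolding x'_def p'_def by (simp add: field_simps)
      have e2: "p' * y' + q = (q * y + p) / (y + a)"
        using nz unfolding y'_def p'_def by (simp add: field_simps)
      have "P * Q / S = - ((- P / X) * (Q / Y) / (S / (X * Y)))"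
        if "X \<noteq> 0" "Y \<noteq> 0" "S \<noteq> 0" for P Q S X Y :: real
        using that by (simp add: field_simps)
      then show ?thesis unfolding s e1 e2 using nz by blast
    qed
    then have "\<bar>(q * x - p) * (q * y + p) / (x + y)\<bar> = \<bar>(p' * x' - q) * (p' * y' + q) / (x' + y')\<bar>"
      by simp
    moreover have "0 \<le> x' + y'" using xa ya by (simp add: x'_def y'_def)
    ultimately show ?thesis using IH xy by (simp add: abs_divide)
  qed
qed

lemma complete_quotient_irrational:
  assumes "x \<notin> \<rat>"
  shows "complete_quotient x n \<notin> \<rat>"
proof (induction n)
  case (Suc n)
  then show ?case
    by (simp add: frac_def divide_inverse)
       (metis Rats_add Rats_inverse Rats_of_int diff_add_cancel inverse_inverse_eq)
qed (use assms in simp)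

text \<open>Constant type in the form in which it is used; unlike the coefficients it does not
  depend on the integer part of \<alpha>. The bound \<open>c <= 1\<close> makes c/n at most 1, so
  that distinct integer translates also count as separated.\<close>

definition badly_approximable :: "real \<Rightarrow> real \<Rightarrow> bool" where
  "badly_approximable c \<alpha> \<longleftrightarrow>
     0 < c \<and> c \<le> 1 \<and> (\<forall>(m::int) (p::int). 1 \<le> m \<longrightarrow> c / m \<le> \<bar>m * \<alpha> - p\<bar>)"

text \<open>At z = 1/x with \<open>y = 0\<close>, and with the roles of p and m exchanged, the
  indefinite form becomes m |m x - p|. Passing to the reciprocal discards the leading coefficient 0
  of x, so that all coefficients are at least 1.\<close>

lemma constant_type_badly_approximable:
  assumes "constant_type x" "0 \<le> x" "x < 1"
  obtains c where "badly_approximable c x"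
proof -
  from assms obtain B0 where irr: "x \<notin> \<rat>" and B0: "\<And>n. cf_coeff x n \<le> B0"
    by (auto simp: constant_type_def)
  define B where "B = real_of_int B0"
  define z where "z = 1 / x"
  have x0: "0 < x" using irr assms(2) by (cases "x = 0") auto
  have z1: "1 < z" using x0 assms(3) by (simp add: z_def)
  have fx: "frac x = x" using assms by (simp add: frac_eq)
  have cq: "complete_quotient z n = complete_quotient x (Suc n)" for n
    by (induction n) (auto simp: z_def fx)
  have cz: "1 \<le> cf_coeff z n" "cf_coeff z n \<le> B" for n
  proof -
    have ir: "complete_quotient x n \<notin> \<rat>" by (rule complete_quotient_irrational[OF irr])
    have "0 < frac (complete_quotient x n)"
      using ir by (metis frac_gt_0_iff Ints_subset_Rats subsetD)
    then have "1 \<le> complete_quotient x (Suc n)"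
      using frac_lt_1[of "complete_quotient x n"] by (simp add: field_simps)
    then show "1 \<le> cf_coeff z n" unfolding cf_coeff_def cq by linarith
    show "cf_coeff z n \<le> B" using B0[of "Suc n"] by (simp add: B_def cf_coeff_def cq)
  qed
  have B: "1 \<le> B" using cz[of 0] by linarith
  define c where "c = 1 / ((B + 1) * (B + 2))"
  have BB: "1 \<le> (B + 1) * (B + 2)" using B by (smt (verit) mult_le_cancel_left1)
  have c: "0 < c" "c \<le> 1" using BB by (auto simp: c_def)
  have approx: "c / m \<le> \<bar>m * x - p\<bar>" if m: "1 \<le> m" for m p :: int
    proof (cases "0 \<le> p")
      case True
      have "c \<le> \<bar>(of_int p * z - of_int m) * (of_int p * 0 + of_int m)\<bar> / (z + 0)"
        unfolding c_def
        by (rule indefinite_form_lower_bound)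
           (use cz complete_quotient_irrational[OF irr, of "Suc _"] m True in \<open>auto simp: cq\<close>)
      also have "\<dots> = \<bar>(p * z - m) / z\<bar> * m" using m z1 by (simp add: abs_mult)
      also have "(p * z - m) / z = p - m * x" using x0 by (simp add: z_def field_simps)
      finally show ?thesis using m by (simp add: field_simps abs_minus_commute)
    next
      case False
      then have "p \<le> -1" by simp
      then have "real_of_int p \<le> -1" by linarith
      then have "1 \<le> \<bar>m * x - p\<bar>" using x0 m by (smt (verit) mult_nonneg_nonneg of_int_0_le_iff)
      moreover have "c / m \<le> 1" using \<open>c \<le> 1\<close> m by (simp add: field_simps)
      ultimately show ?thesis by linarith
    qed
  show thesis
    by (rule that[of c]) (use c approx in \<open>simp add: badly_approximable_def\<close>)
qed

text \<open>Dirichlet gives p/q with q at most N and error below 1/N, and bad approximability forces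
  q to be at least c N. The multiples of p/q modulo 1 form a grid of mesh 1/q, at most 1/(c N), and
  the multiples of \<alpha> follow them up to 1/N.\<close>

lemma badly_approximable_covering:
  assumes "badly_approximable c \<alpha>" "0 < N"
  shows "\<exists>k n. k < N \<and> \<bar>real k * \<alpha> + of_int n - \<theta>\<bar> \<le> (1 + 1 / c) / N"
proof -
  have c: "0 < c" and bad: "\<And>(m::int) (p::int). 1 \<le> m \<Longrightarrow> c / m \<le> \<bar>m * \<alpha> - p\<bar>"
    using assms(1) unfolding badly_approximable_def by blast+
  obtain p q where pq: "coprime p q" "0 < q" "q \<le> int N" "\<bar>of_int q * \<alpha> - of_int p\<bar> < 1 / N"
    by (rule Dirichlet_approx_coprime[OF assms(2)])
  have "c / q \<le> 1 / N" using bad[of q p] pq by linarith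
  then have qN: "1 / q \<le> (1 / c) / N" using c pq assms(2) by (simp add: field_simps)
  \<comment> \<open>The grid point z/q is the one just below \<theta>. The Bezout coefficient u
    inverts p modulo q, so k = u z mod q solves p k = z modulo q.\<close>
  define z where "z = \<lfloor>\<theta> * q\<rfloor>"
  obtain u v where uv: "u * p + v * q = 1"
    using bezout_int[of p q] pq(1) by auto
  define k where "k = (u * z) mod q"
  define n where "n = p * ((u * z) div q) + v * z"
  have k: "0 \<le> k" "k < q" using pq by (auto simp: k_def)
  have uz: "u * z = q * ((u * z) div q) + k" unfolding k_def by simp
  have n: "z = p * k + q * n"
  proof -
    have "z = (u * p + v * q) * z" using uv by simp
    also have "\<dots> = p * (u * z) + q * (v * z)" by (simp add: algebra_simps)
    also have "\<dots> = p * (q * ((u * z) div q) + k) + q * (v * z)" using uz by simp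
    also have "\<dots> = p * k + q * n" by (simp add: n_def algebra_simps)
    finally show ?thesis .
  qed
  have "\<bar>k * \<alpha> + n - \<theta>\<bar> \<le> \<bar>k * \<alpha> - k * (p / q)\<bar> + \<bar>k * (p / q) + n - \<theta>\<bar>" by linarith
  moreover have "\<bar>k * \<alpha> - k * (p / q)\<bar> \<le> 1 / N"
  proof -
    have "k * \<alpha> - k * (p / q) = (k / q) * (q * \<alpha> - p)" using pq(2) by (simp add: field_simps)
    then have "\<bar>k * \<alpha> - k * (p / q)\<bar> = (k / q) * \<bar>q * \<alpha> - p\<bar>" using k by (simp add: abs_mult)
    also have "\<dots> \<le> 1 * (1 / N)" using k pq by (intro mult_mono) auto
    finally show ?thesis by simp
  qed
  moreover have "\<bar>k * (p / q) + n - \<theta>\<bar> \<le> 1 / q"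
  proof -
    have "k * (p / q) + n = (p * k + q * n) / q" using pq(2) by (simp add: field_simps)
    also have "real_of_int (p * k + q * n) = z" using n by simp
    finally have "k * (p / q) + n - \<theta> = (z - \<theta> * q) / q" using pq(2) by (simp add: field_simps)
    moreover have "\<bar>z - \<theta> * q\<bar> \<le> 1" unfolding z_def by linarith
    ultimately show ?thesis using pq(2) by (simp add: divide_right_mono)
  qed
  ultimately have "\<bar>k * \<alpha> + n - \<theta>\<bar> \<le> (1 + 1 / c) / N" using qN by (simp add: add_divide_distrib)
  then have "nat k < N \<and> \<bar>real (nat k) * \<alpha> + of_int n - \<theta>\<bar> \<le> (1 + 1 / c) / N"
    using k pq by auto
  then show ?thesis by blast
qed

section \<open>Cross-ratio distortion of maps with a cubic critical point\<close>

lemma periodic_int_shift: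
  fixes f :: "real \<Rightarrow> real"
  assumes "\<And>x. f (x + 1) = f x + p"
  shows "f (x + of_int n) = f x + of_int n * p"
proof (induction n rule: int_induct[where k = 0])
  case (step1 i)
  then show ?case using assms[of "x + of_int i"] by (simp add: algebra_simps)
next
  case (step2 i)
  then show ?case using assms[of "x + of_int i - 1"] by (simp add: algebra_simps)
qed simp

lemma degree_one_surj:
  fixes f :: "real \<Rightarrow> real"
  assumes "continuous_on UNIV f" "\<And>x. f (x + 1) = f x + 1"
  obtains x where "f x = y"
proof -
  have shift: "f (x + of_int n) = f x + of_int n" for x n
    using periodic_int_shift[of f 1] assms(2) by simp
  define n where "n = \<lfloor>y - f 0\<rfloor>"
  have "f (of_int n) \<le> y" "y \<le> f (of_int n + 1)"
    using shift[of 0 n] assms(2)[of "of_int n"] by (simp_all add: n_def) linarith+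
  from IVT'[of f "of_int n" y "of_int n + 1", OF this]
  show thesis using that continuous_on_subset[OF assms(1)] by (metis le_add_same_cancel1 subset_UNIV zero_le_one)
qed

lemma periodic_positive_lower_bound:
  fixes f :: "real \<Rightarrow> real"
  assumes "continuous_on UNIV f" "\<And>x. f (x + 1) = f x" "\<And>x. 0 < f x"
  obtains m where "0 < m" "\<And>x. m \<le> f x"
proof -
  have "compact {0..1::real}" "{0..1::real} \<noteq> {}" by auto
  from continuous_attains_inf[OF this, of f] assms(1)
  obtain z where z: "\<And>y. y \<in> {0..1} \<Longrightarrow> f z \<le> f y"
    using continuous_on_subset by (metis subset_UNIV)
  have "f z \<le> f x" for x
  proof -
    have "f x = f (frac x)"
      using periodic_int_shift[of f 0 "frac x" "\<lfloor>x\<rfloor>"] assms(2) by (simp add: frac_def)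
    moreover have "frac x \<in> {0..1}" using frac_lt_1[of x] by (simp add: less_imp_le)
    ultimately show ?thesis using z by simp
  qed
  then show thesis using that assms(3) by blast
qed

lemma periodic_upper_bound:
  fixes f :: "real \<Rightarrow> real"
  assumes "continuous_on UNIV f" "\<And>x. f (x + 1) = f x"
  obtains M where "0 < M" "\<And>x. \<bar>f x\<bar> \<le> M"
proof -
  have "continuous_on UNIV (\<lambda>x. 1 / (1 + \<bar>f x\<bar>))"
    by (intro continuous_intros assms) (auto simp: add_nonneg_eq_0_iff)
  moreover have "0 < 1 / (1 + \<bar>f x\<bar>)" for x by (simp add: add_pos_nonneg)
  ultimately obtain m where m: "0 < m" "\<And>x. m \<le> 1 / (1 + \<bar>f x\<bar>)"
    using periodic_positive_lower_bound[of "\<lambda>x. 1 / (1 + \<bar>f x\<bar>)"] assms(2) by metis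
  have "\<bar>f x\<bar> \<le> 1 / m" for x
    using m(2)[of x] m(1) by (simp add: field_simps)
  then show thesis using that[of "1 / m"] m(1) by simp
qed

section \<open>Cross-ratios of four points on the line and their change under the cube map\<close>

text \<open>With left, middle and right lengths L, J, R this is (1 + J/L)(1 + J/R) - 1: it is large
  when the middle is long compared with a neighbour, and equals 3 for equidistant points.\<close>

definition cross_ratio :: "real \<Rightarrow> real \<Rightarrow> real \<Rightarrow> real \<Rightarrow> real" where
  "cross_ratio a b c d = ((d - a) * (c - b)) / ((b - a) * (d - c))"

lemma cross_ratio_pos: "a < b \<Longrightarrow> b < c \<Longrightarrow> c < d \<Longrightarrow> 0 < cross_ratio a b c d"
  by (simp add: cross_ratio_def)

lemma cross_ratio_translate:
  "cross_ratio (a - t) (b - t) (c - t) (d - t) = cross_ratio a b c d"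
  by (simp add: cross_ratio_def)

lemma cross_ratio_le_3:
  assumes "a < b" "b < c" "c < d" "c - b \<le> b - a" "c - b \<le> d - c"
  shows "cross_ratio a b c d \<le> 3"
proof -
  define L J R where "L = b - a" and "J = c - b" and "R = d - c"
  have pos: "0 < L" "0 < J" "0 < R" "J \<le> L" "J \<le> R"
    using assms by (auto simp: L_def J_def R_def)
  have "L * J \<le> L * R" "J * J \<le> L * R" "J * R \<le> L * R"
    using pos by (auto intro: mult_mono)
  then have "(L + J + R) * J \<le> 3 * (L * R)" by (simp add: algebra_simps)
  moreover have "cross_ratio a b c d = ((L + J + R) * J) / (L * R)"
    by (simp add: cross_ratio_def L_def J_def R_def)
  ultimately show ?thesis using pos by (simp add: pos_divide_le_eq)
qed

lemma cross_ratio_ge_left: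
  assumes "a < b" "b < c" "c < d"
  shows "(c - b) / (b - a) \<le> cross_ratio a b c d"
proof -
  have "(c - b) / (b - a) = 1 * ((c - b) / (b - a))" by simp
  also have "\<dots> \<le> ((d - a) / (d - c)) * ((c - b) / (b - a))"
    using assms by (intro mult_right_mono) (auto simp: field_simps)
  finally show ?thesis by (simp add: cross_ratio_def mult.commute)
qed

lemma cross_ratio_ge_right:
  assumes "a < b" "b < c" "c < d"
  shows "(c - b) / (d - c) \<le> cross_ratio a b c d"
proof -
  have "(c - b) / (d - c) = 1 * ((c - b) / (d - c))" by simp
  also have "\<dots> \<le> ((d - a) / (b - a)) * ((c - b) / (d - c))"
    using assms by (intro mult_right_mono) (auto simp: field_simps)
  finally show ?thesis by (simp add: cross_ratio_def)
qed

text \<open>The tolerance g/500 on a length allows an error of g/1000 at each of its endpoints,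
  which is what \<open>near_affine\<close> is made to deliver.\<close>

lemma cross_ratio_equidistant:
  assumes "0 < g" "\<bar>b - a - g\<bar> \<le> g / 500" "\<bar>c - b - g\<bar> \<le> g / 500" "\<bar>d - c - g\<bar> \<le> g / 500"
  shows "297 / 100 \<le> cross_ratio a b c d" "cross_ratio a b c d \<le> 303 / 100"
proof -
  define L J R where "L = b - a" and "J = c - b" and "R = d - c"
  have bounds: "499 / 500 * g \<le> L" "L \<le> 501 / 500 * g" "499 / 500 * g \<le> J" "J \<le> 501 / 500 * g"
    "499 / 500 * g \<le> R" "R \<le> 501 / 500 * g"
    using assms(2-4) unfolding L_def J_def R_def by linarith+
  have T: "1497 / 500 * g \<le> L + J + R" "L + J + R \<le> 1503 / 500 * g"
    using bounds by simp_all
  have g: "0 \<le> g" using assms(1) by simp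
  have "0 < 499 / 500 * g" using assms(1) by simp
  then have pos: "0 < L" "0 < J" "0 < R" using bounds by linarith+
  have eq: "cross_ratio a b c d = ((L + J + R) * J) / (L * R)"
    by (simp add: cross_ratio_def L_def J_def R_def)
  have LR: "(499 / 500 * g) * (499 / 500 * g) \<le> L * R" "L * R \<le> (501 / 500 * g) * (501 / 500 * g)"
    by (intro mult_mono bounds; use bounds pos g in simp)+
  have TJ: "(1497 / 500 * g) * (499 / 500 * g) \<le> (L + J + R) * J" "(L + J + R) * J \<le> (1503 / 500 * g) * (501 / 500 * g)"
    by (intro mult_mono bounds T; use bounds T pos g in simp)+
  have gg: "0 \<le> g * g" by simp
  have "297 / 100 * (L * R) \<le> (L + J + R) * J"
    using LR TJ gg by simp
  then show "297 / 100 \<le> cross_ratio a b c d" unfolding eq using pos by (simp add: pos_le_divide_eq)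
  have "(L + J + R) * J \<le> 303 / 100 * (L * R)"
    using LR TJ gg by simp
  then show "cross_ratio a b c d \<le> 303 / 100" unfolding eq using pos by (simp add: pos_divide_le_eq)
qed

definition cubic_quotient :: "real \<Rightarrow> real \<Rightarrow> real" where
  "cubic_quotient x y = x\<^sup>2 + x * y + y\<^sup>2"

lemma cube_diff: "y ^ 3 - x ^ 3 = (y - x) * cubic_quotient x y" for x y :: real
  by (simp add: cubic_quotient_def power3_eq_cube power2_eq_square algebra_simps)

lemma cubic_quotient_pos: "x \<noteq> y \<Longrightarrow> 0 < cubic_quotient x y"
proof -
  assume "x \<noteq> y"
  then have "0 < x\<^sup>2 + y\<^sup>2 + (x + y)\<^sup>2" by (smt (verit) zero_le_power2 power2_eq_iff_nonneg zero_eq_power2)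
  then show ?thesis unfolding cubic_quotient_def by (simp add: power2_eq_square algebra_simps)
qed

text \<open>The last factor is the second elementary symmetric polynomial of the four points, which
  is nonnegative when they all have the same sign.\<close>

lemma cubic_quotient_cross:
  "cubic_quotient a d * cubic_quotient b c - cubic_quotient a b * cubic_quotient c d
   = (c - a) * (d - b) * (a * b + a * c + a * d + b * c + b * d + c * d)"
  by (simp add: cubic_quotient_def power2_eq_square algebra_simps)

text \<open>The cube map multiplies the cross-ratio by a quotient of products of
  \<open>cubic_quotient\<close>; by \<open>cubic_quotient_cross\<close> this is at least 1 as long
  as the interval does not have the critical point in its interior.\<close>

lemma cross_ratio_cube_le:
  assumes "a < b" "b < c" "c < d" "0 \<le> a \<or> d \<le> 0"
  shows "cross_ratio a b c d \<le> cross_ratio (a ^ 3) (b ^ 3) (c ^ 3) (d ^ 3)"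
proof -
  have nn: "0 \<le> a * b" "0 \<le> a * c" "0 \<le> a * d" "0 \<le> b * c" "0 \<le> b * d" "0 \<le> c * d"
    using assms by (auto intro: mult_nonneg_nonneg mult_nonpos_nonpos)
  have "0 \<le> (c - a) * (d - b) * (a * b + a * c + a * d + b * c + b * d + c * d)"
    using assms nn by (intro mult_nonneg_nonneg) auto
  then have le: "cubic_quotient a b * cubic_quotient c d \<le> cubic_quotient a d * cubic_quotient b c"
    using cubic_quotient_cross[of a d b c] by linarith
  have pos: "0 < cubic_quotient a b" "0 < cubic_quotient c d" using assms by (auto intro: cubic_quotient_pos)
  have "cross_ratio (a ^ 3) (b ^ 3) (c ^ 3) (d ^ 3) = cross_ratio a b c d *
      ((cubic_quotient a d * cubic_quotient b c) / (cubic_quotient a b * cubic_quotient c d))"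
    unfolding cross_ratio_def cube_diff by (simp add: mult_ac)
  moreover have "1 \<le> (cubic_quotient a d * cubic_quotient b c) / (cubic_quotient a b * cubic_quotient c d)"
    using le pos by simp
  ultimately show ?thesis
    using cross_ratio_pos[OF assms(1-3)] by (metis mult_le_cancel_left1 less_le_not_le)
qed

text \<open>With the left point at the critical point the factor is d^2 q(b,c) / (b^2 q(c,d)), where
  q is \<open>cubic_quotient\<close>. Here q(c,d) is at most 3 d^2, while the separation of b and c
  makes q(b,c) at least 3 * 21/20 * b^2. Without separation the factor could be arbitrarily close to
  1.\<close>

lemma cross_ratio_cube_gain:
  assumes "0 < b" "21 / 20 * b \<le> c" "c < d"
  shows "21 / 20 * cross_ratio 0 b c d \<le> cross_ratio 0 (b ^ 3) (c ^ 3) (d ^ 3)"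
proof -
  have ord: "0 < b" "b < c" "c < d" using assms by simp_all
  have "b * b \<le> b * (20 / 21 * c)" using assms by (intro mult_left_mono) auto
  then have 1: "21 / 20 * b\<^sup>2 \<le> b * c" by (simp add: power2_eq_square)
  have "21 / 20 * (b * c) \<le> c * c" using assms mult_right_mono[of "21 / 20 * b" c c] ord by simp
  then have 2: "21 / 20 * (b * c) \<le> c\<^sup>2" by (simp add: power2_eq_square)
  have bq: "63 / 20 * b\<^sup>2 \<le> cubic_quotient b c" unfolding cubic_quotient_def using 1 2 zero_le_power2[of b] by linarith
  have "c * c \<le> d * d" "c * d \<le> d * d" using ord by (auto intro: mult_mono)
  then have cq: "cubic_quotient c d \<le> 3 * d\<^sup>2" unfolding cubic_quotient_def by (simp add: power2_eq_square)
  have pos: "0 < cubic_quotient c d" using ord by (intro cubic_quotient_pos) auto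
  have "21 / 20 * (b\<^sup>2 * cubic_quotient c d) \<le> 21 / 20 * (b\<^sup>2 * (3 * d\<^sup>2))"
    using cq by (intro mult_left_mono) auto
  also have "\<dots> = d\<^sup>2 * (63 / 20 * b\<^sup>2)" by simp
  also have "\<dots> \<le> d\<^sup>2 * cubic_quotient b c" using bq by (intro mult_left_mono) auto
  finally have "21 / 20 \<le> (d\<^sup>2 * cubic_quotient b c) / (b\<^sup>2 * cubic_quotient c d)"
    using pos ord by (simp add: pos_le_divide_eq)
  then have "21 / 20 * cross_ratio 0 b c d \<le> (d\<^sup>2 * cubic_quotient b c) / (b\<^sup>2 * cubic_quotient c d) * cross_ratio 0 b c d"
    using cross_ratio_pos[OF ord] by (intro mult_right_mono) auto
  also have "\<dots> = cross_ratio 0 (b ^ 3) (c ^ 3) (d ^ 3)"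
  proof -
    have "c ^ 3 - b ^ 3 = (c - b) * cubic_quotient b c" "d ^ 3 - c ^ 3 = (d - c) * cubic_quotient c d"
      by (rule cube_diff)+
    then show ?thesis unfolding cross_ratio_def using ord pos
      by (simp add: power2_eq_square power3_eq_cube mult_ac)
  qed
  finally show ?thesis .
qed

text \<open>Meant for difference quotients, which are nearly affine functions of the midpoint. The
  midpoints of the pairs ad, bc and of the pairs ab, cd have the same sum, so the affine
  approximations have equal sums and their products differ only by a quadratic term.\<close>

lemma product_near_linear:
  fixes w :: real
  assumes "\<bar>D1 - l1\<bar> \<le> w" "\<bar>D2 - l2\<bar> \<le> w" "\<bar>D3 - l3\<bar> \<le> w" "\<bar>D4 - l4\<bar> \<le> w"
    and "l1 + l2 = l3 + l4" "\<bar>l1 - l2\<bar> \<le> k"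
    and "\<bar>D1\<bar> \<le> M" "\<bar>D2\<bar> \<le> M" "\<bar>D3\<bar> \<le> M" "\<bar>D4\<bar> \<le> M"
  shows "D3 * D4 - D1 * D2 \<le> k\<^sup>2 / 4 + 4 * w * M + 2 * w\<^sup>2"
proof -
  have w: "0 \<le> w" using assms(1) by linarith
  have M: "0 \<le> M" using assms(7) by linarith
  have 1: "\<bar>D1 * D2 - l1 * l2\<bar> \<le> 2 * w * M + w\<^sup>2"
    if "\<bar>D1 - l1\<bar> \<le> w" "\<bar>D2 - l2\<bar> \<le> w" "\<bar>D1\<bar> \<le> M" "\<bar>D2\<bar> \<le> M" for D1 D2 l1 l2
  proof -
    have "D1 * D2 - l1 * l2 = D1 * (D2 - l2) + D2 * (D1 - l1) - (D1 - l1) * (D2 - l2)"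
      by (simp add: algebra_simps)
    also have "\<bar>\<dots>\<bar> \<le> \<bar>D1 * (D2 - l2)\<bar> + \<bar>D2 * (D1 - l1)\<bar> + \<bar>(D1 - l1) * (D2 - l2)\<bar>" by linarith
    also have "\<dots> \<le> M * w + M * w + w * w"
      unfolding abs_mult using that w M by (intro add_mono mult_mono) auto
    finally show ?thesis by (simp add: power2_eq_square algebra_simps)
  qed
  have "l3 * l4 - l1 * l2 = ((l1 - l2)\<^sup>2 - (l3 - l4)\<^sup>2) / 4"
  proof -
    have "(l1 + l2)\<^sup>2 = (l3 + l4)\<^sup>2" using assms(5) by simp
    then show ?thesis by (simp add: power2_eq_square algebra_simps)
  qed
  also have "\<dots> \<le> (l1 - l2)\<^sup>2 / 4" by simp
  also have "\<dots> \<le> k\<^sup>2 / 4" using assms(6) by (simp add: abs_le_square_iff[symmetric])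
  finally show ?thesis
    using 1[OF assms(1,2,7,8)] 1[OF assms(3,4,9,10)] by linarith
qed

section \<open>Circle maps that are exactly cubic near the critical point: fine distortion
  estimates\<close>

text \<open>\<open>G\<close> is the lift in the coordinate adapted to its critical point, with first
  two derivatives \<open>G1\<close> and \<open>G2\<close>. The bound \<open>r < 1 / 2\<close> keeps
  the neighbourhoods of different integers disjoint.\<close>

locale cubic_map =
  fixes G G1 G2 :: "real \<Rightarrow> real" and r e :: real
  assumes G_deriv: "(G has_real_derivative G1 x) (at x)"
    and G1_deriv: "(G1 has_real_derivative G2 x) (at x)"
    and G2_cont: "continuous_on UNIV G2"
    and G_shift1: "G (x + 1) = G x + 1"
    and G_strict_mono: "strict_mono G"
    and G1_pos: "x \<notin> \<int> \<Longrightarrow> 0 < G1 x"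
    and r: "0 < r" "r < 1 / 2"
    and G_cubic0: "\<bar>x\<bar> < r \<Longrightarrow> G x = x ^ 3 + e"
begin

lemma G_shift: "G (x + of_int n) = G x + of_int n"
  using periodic_int_shift[of G 1, OF G_shift1] by simp

lemma G1_shift1: "G1 (x + 1) = G1 x"
proof -
  have "((\<lambda>x. G (x + 1)) has_real_derivative G1 (x + 1) * 1) (at x)"
    by (rule DERIV_chain2[OF G_deriv]) (auto intro!: derivative_eq_intros)
  moreover have "((\<lambda>x. G x + 1) has_real_derivative G1 x) (at x)"
    by (auto intro!: derivative_eq_intros G_deriv)
  ultimately show ?thesis by (simp add: G_shift1 DERIV_unique)
qed

lemma G2_shift1: "G2 (x + 1) = G2 x"
proof -
  have "((\<lambda>x. G1 (x + 1)) has_real_derivative G2 (x + 1) * 1) (at x)"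
    by (rule DERIV_chain2[OF G1_deriv]) (auto intro!: derivative_eq_intros)
  then show ?thesis using G1_deriv[of x] by (simp add: G1_shift1 DERIV_unique)
qed

lemma G1_shift: "G1 (x + of_int n) = G1 x"
  using periodic_int_shift[of G1 0] G1_shift1 by simp

lemma G2_shift: "G2 (x + of_int n) = G2 x"
  using periodic_int_shift[of G2 0] G2_shift1 by simp

lemma G_cont: "continuous_on S G"
  by (intro continuous_at_imp_continuous_on ballI DERIV_isCont) (rule G_deriv)

lemma G1_cont: "continuous_on S G1"
  by (intro continuous_at_imp_continuous_on ballI DERIV_isCont) (rule G1_deriv)

lemma G_less: "x < y \<Longrightarrow> G x < G y"
  using G_strict_mono by (simp add: strict_monoD)

lemma G_cubic: "\<bar>x - of_int n\<bar> < r \<Longrightarrow> G x = (x - of_int n) ^ 3 + e + of_int n"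
  using G_cubic0[of "x - of_int n"] G_shift[of "x - of_int n" n] by simp

lemma G1_cubic: "\<bar>x - of_int n\<bar> < r \<Longrightarrow> G1 x = 3 * (x - of_int n)\<^sup>2"
proof -
  assume *: "\<bar>x - of_int n\<bar> < r"
  have "((\<lambda>x. (x - of_int n) ^ 3 + e + of_int n) has_real_derivative 3 * (x - of_int n)\<^sup>2) (at x)"
    by (auto intro!: derivative_eq_intros)
  then have "(G has_real_derivative 3 * (x - of_int n)\<^sup>2) (at x)"
  proof (rule has_field_derivative_transform_within_open)
    show "open (ball (of_int n) r)" "x \<in> ball (of_int n) r"
      using * by (auto simp: dist_real_def)
  qed (simp add: dist_real_def G_cubic abs_minus_commute)
  then show ?thesis using G_deriv DERIV_unique by blast
qed

lemma G1_bound: obtains M where "0 < M" "\<And>x. G1 x \<le> M" "\<And>x. \<bar>G2 x\<bar> \<le> M"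
proof -
  obtain M1 where M1: "0 < M1" "\<And>x. \<bar>G1 x\<bar> \<le> M1"
    using periodic_upper_bound[OF G1_cont G1_shift1] by blast
  obtain M2 where M2: "0 < M2" "\<And>x. \<bar>G2 x\<bar> \<le> M2"
    using periodic_upper_bound[OF G2_cont G2_shift1] by blast
  show thesis
    by (rule that[of "max M1 M2"]) (use M1 M2 in \<open>auto simp: le_max_iff_disj abs_le_iff\<close>)
qed

lemma G2_uniform:
  assumes "0 < w"
  obtains \<delta> where "0 < \<delta>" "\<And>x y. \<bar>x - y\<bar> \<le> \<delta> \<Longrightarrow> \<bar>G2 x - G2 y\<bar> \<le> w"
proof -
  have "uniformly_continuous_on {-1..2} G2"
    by (intro compact_uniformly_continuous) (auto intro: continuous_on_subset[OF G2_cont])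
  then obtain d where d: "0 < d"
    "\<And>x y. x \<in> {-1..2} \<Longrightarrow> y \<in> {-1..2} \<Longrightarrow> \<bar>x - y\<bar> < d \<Longrightarrow> \<bar>G2 x - G2 y\<bar> < w"
    unfolding uniformly_continuous_on_def dist_real_def by (metis assms)
  show thesis
  proof (rule that[of "min (d / 2) 1"])
    fix x y :: real assume xy: "\<bar>x - y\<bar> \<le> min (d / 2) 1"
    define n where "n = \<lfloor>x\<rfloor>"
    have "0 \<le> x - n" "x - n \<le> 1" unfolding n_def by linarith+
    then have "x - n \<in> {-1..2}" "y - n \<in> {-1..2}" "\<bar>(x - n) - (y - n)\<bar> < d" using xy d(1) by auto
    from d(2)[OF this] show "\<bar>G2 x - G2 y\<bar> \<le> w"
      using G2_shift[of "x - n" n] G2_shift[of "y - n" n] by simp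
  qed (use d in auto)
qed

lemma G1_far_from_critical:
  obtains m where "0 < m" "\<And>x. (\<And>n::int. r / 2 \<le> \<bar>x - n\<bar>) \<Longrightarrow> m \<le> G1 x"
proof -
  have ne: "{r / 2..1 - r / 2} \<noteq> {}" using r by auto
  obtain z where z: "z \<in> {r / 2..1 - r / 2}" "\<And>y. y \<in> {r / 2..1 - r / 2} \<Longrightarrow> G1 z \<le> G1 y"
    using continuous_attains_inf[OF compact_Icc ne G1_cont] by blast
  have "z \<notin> \<int>"
  proof
    assume "z \<in> \<int>"
    then obtain n where "z = of_int n" by (auto elim: Ints_cases)
    moreover have "0 < z" "z < 1" using z(1) r by auto
    ultimately show False by simp
  qed
  then have "0 < G1 z" by (rule G1_pos)
  moreover have "G1 z \<le> G1 x" if "\<And>n::int. r / 2 \<le> \<bar>x - n\<bar>" for x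
  proof -
    have "x - \<lfloor>x\<rfloor> \<in> {r / 2..1 - r / 2}"
      using that[of "\<lfloor>x\<rfloor>"] that[of "\<lfloor>x\<rfloor> + 1"] by simp
    then show ?thesis using z(2) G1_shift[of "x - \<lfloor>x\<rfloor>" "\<lfloor>x\<rfloor>"] by fastforce
  qed
  ultimately show thesis using that by blast
qed

definition quotient :: "real \<Rightarrow> real \<Rightarrow> real" where
  "quotient x y = (G y - G x) / (y - x)"

lemma quotient_pos: "x < y \<Longrightarrow> 0 < quotient x y"
  using G_less by (simp add: quotient_def)

lemma quotient_mvt:
  assumes "x < y" obtains z where "x < z" "z < y" "quotient x y = G1 z"
proof -
  obtain z where "x < z" "z < y" "G y - G x = (y - x) * G1 z"
    using MVT2[OF assms, of G G1] G_deriv by blast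
  then show thesis using that[of z] assms by (simp add: quotient_def)
qed

lemma quotient_cubic:
  assumes "\<bar>x - of_int n\<bar> < r" "\<bar>y - of_int n\<bar> < r" "x < y"
  shows "quotient x y = cubic_quotient (x - of_int n) (y - of_int n)"
  using assms cube_diff[of "y - of_int n" "x - of_int n"] by (simp add: quotient_def G_cubic)

lemma cross_ratio_image:
  assumes "a < b" "b < c" "c < d"
  shows "cross_ratio (G a) (G b) (G c) (G d) =
    cross_ratio a b c d * ((quotient a d * quotient b c) / (quotient a b * quotient c d))"
proof -
  have "G a < G b" "G b < G c" "G c < G d" using assms G_less by auto
  moreover have "X * Y / (Z * W) = x * y / (z * w) * ((X / x * (Y / y)) / (Z / z * (W / w)))"
    if "x \<noteq> 0" "y \<noteq> 0" "z \<noteq> 0" "w \<noteq> 0" for X Y Z W x y z w :: real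
    using that by (simp add: field_simps)
  ultimately show ?thesis using assms unfolding cross_ratio_def quotient_def by simp
qed

text \<open>For a quadratic polynomial the difference quotient is exactly the derivative at the
  midpoint. Subtracting the Taylor polynomial of degree 2 at a leaves a function whose derivative is
  at most w (d - a) on the interval, by the mean value theorem for \<open>G1\<close>.\<close>

lemma quotient_near_linear:
  assumes "a \<le> x" "x < y" "y \<le> d" "\<And>z. a \<le> z \<Longrightarrow> z \<le> d \<Longrightarrow> \<bar>G2 z - G2 a\<bar> \<le> w"
  shows "\<bar>quotient x y - (G1 a + G2 a * ((x + y) / 2 - a))\<bar> \<le> w * (d - a)"
proof -
  define \<psi> where "\<psi> z = G z - G1 a * z - G2 a * ((z - a)\<^sup>2 / 2)" for z
  define \<psi>1 where "\<psi>1 z = G1 z - G1 a - G2 a * (z - a)" for z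
  have d1: "(\<psi> has_real_derivative \<psi>1 z) (at z)" for z
    unfolding \<psi>_def[abs_def] \<psi>1_def by (auto intro!: derivative_eq_intros G_deriv)
  have d2: "(\<psi>1 has_real_derivative G2 z - G2 a) (at z)" for z
    unfolding \<psi>1_def[abs_def] by (auto intro!: derivative_eq_intros G1_deriv)
  have w: "0 \<le> w" using assms(4)[of a] assms(1-3) by linarith
  have b1: "\<bar>\<psi>1 z\<bar> \<le> w * (d - a)" if "a \<le> z" "z \<le> d" for z
  proof (cases "z = a")
    case True
    then show ?thesis using w assms by (simp add: \<psi>1_def)
  next
    case False
    then have "a < z" using that by simp
    from MVT2[OF this, of \<psi>1 "\<lambda>z. G2 z - G2 a"] d2
    obtain t where t: "a < t" "t < z" "\<psi>1 z - \<psi>1 a = (z - a) * (G2 t - G2 a)" by blast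
    then have "\<bar>\<psi>1 z\<bar> = (z - a) * \<bar>G2 t - G2 a\<bar>"
      using \<open>a < z\<close> by (simp add: \<psi>1_def abs_mult)
    also have "\<dots> \<le> (d - a) * w"
      using assms(4)[of t] t that by (intro mult_mono) auto
    finally show ?thesis by (simp add: mult.commute)
  qed
  from MVT2[OF assms(2), of \<psi> \<psi>1] d1
  obtain t where t: "x < t" "t < y" "\<psi> y - \<psi> x = (y - x) * \<psi>1 t" by blast
  have "\<psi> y - \<psi> x = (y - x) * (quotient x y - (G1 a + G2 a * ((x + y) / 2 - a)))"
  proof -
    have "(y - a)\<^sup>2 - (x - a)\<^sup>2 = (y - x) * (2 * ((x + y) / 2 - a))"
      by (simp add: power2_eq_square field_simps)
    moreover have "\<psi> y - \<psi> x = (G y - G x) - G1 a * (y - x) - G2 a * (((y - a)\<^sup>2 - (x - a)\<^sup>2) / 2)"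
      unfolding \<psi>_def diff_divide_distrib right_diff_distrib by linarith
    moreover have "G y - G x = (y - x) * quotient x y" using assms(2) by (simp add: quotient_def)
    ultimately have "\<psi> y - \<psi> x = (y - x) * quotient x y - G1 a * (y - x) - G2 a * ((y - x) * (2 * ((x + y) / 2 - a)) / 2)"
      by (simp only:)
    also have "\<dots> = (y - x) * (quotient x y - (G1 a + G2 a * ((x + y) / 2 - a)))"
    proof -
      have "(y - x) * q - A * (y - x) - B * ((y - x) * (2 * m) / 2) = (y - x) * (q - (A + B * m))"
        for A B q m :: real by (simp add: field_simps)
      then show ?thesis .
    qed
    finally show ?thesis .
  qed
  then have "quotient x y - (G1 a + G2 a * ((x + y) / 2 - a)) = \<psi>1 t"
    using t(3) assms(2) by simp
  then show ?thesis using b1[of t] t assms by simp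
qed

text \<open>Near the critical point \<open>G\<close> is exactly cubic and nothing is lost. Elsewhere
  \<open>G1\<close> is bounded below, and by \<open>product_near_linear\<close> the loss is
  quadratic in d - a, except for a term linear in d - a with the oscillation w of \<open>G2\<close>
  as coefficient. Since \<open>G2\<close> is merely continuous, this gives a small multiple of d - a
  rather than a quadratic bound.\<close>

lemma cross_ratio_almost_increasing:
  assumes "0 < \<eta>"
  obtains \<delta> where "0 < \<delta>" "\<And>a b c d. a < b \<Longrightarrow> b < c \<Longrightarrow> c < d \<Longrightarrow> d - a \<le> \<delta> \<Longrightarrow>
    (\<And>n. \<not> (a < of_int n \<and> of_int n < d)) \<Longrightarrow>
    (1 - \<eta> * (d - a)) * cross_ratio a b c d \<le> cross_ratio (G a) (G b) (G c) (G d)"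
proof -
  obtain M where M: "0 < M" "\<And>x. G1 x \<le> M" "\<And>x. \<bar>G2 x\<bar> \<le> M" using G1_bound by blast
  obtain m where m: "0 < m" "\<And>x. (\<And>n::int. r / 2 \<le> \<bar>x - n\<bar>) \<Longrightarrow> m \<le> G1 x"
    using G1_far_from_critical by blast
  \<comment> \<open>The three error terms below are each made at most a quarter of \<eta> m^2: this
    w settles the middle one, and the last two entries of \<delta> the others.\<close>
  define w where "w = \<eta> * m\<^sup>2 / (16 * M)"
  have w: "0 < w" using assms m M by (simp add: w_def)
  obtain \<delta>0 where \<delta>0: "0 < \<delta>0" "\<And>x y. \<bar>x - y\<bar> \<le> \<delta>0 \<Longrightarrow> \<bar>G2 x - G2 y\<bar> \<le> w"
    using G2_uniform[OF w] by blast
  \<comment> \<open>The entry r/4 puts an interval that meets the r/2-neighbourhood of an integer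
    inside the r-neighbourhood, where \<open>G\<close> is cubic.\<close>
  define \<delta> where "\<delta> = Min {r / 4, \<delta>0, \<eta> * m\<^sup>2 / M\<^sup>2, \<eta> * m\<^sup>2 / (8 * w\<^sup>2)}"
  have \<delta>: "0 < \<delta>" "\<delta> \<le> r / 4" "\<delta> \<le> \<delta>0" "\<delta> \<le> \<eta> * m\<^sup>2 / M\<^sup>2" "\<delta> \<le> \<eta> * m\<^sup>2 / (8 * w\<^sup>2)"
    unfolding \<delta>_def using assms r(1) \<delta>0(1) m(1) M(1) w
    by (simp_all add: min.coboundedI1 min.coboundedI2 del: min_le_iff_disj le_divide_eq_numeral1 divide_le_eq_numeral1)
  show thesis
  proof (rule that[OF \<delta>(1)])
    fix a b c d :: real
    assume abcd: "a < b" "b < c" "c < d" and T: "d - a \<le> \<delta>"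
      and crit: "\<And>n. \<not> (a < of_int n \<and> of_int n < d)"
    have ad: "0 < d - a" using abcd by linarith
    have pos: "0 < cross_ratio a b c d" using abcd by (rule cross_ratio_pos)
    show "(1 - \<eta> * (d - a)) * cross_ratio a b c d \<le> cross_ratio (G a) (G b) (G c) (G d)"
    proof (cases "\<exists>x n. a \<le> x \<and> x \<le> d \<and> \<bar>x - of_int n\<bar> < r / 2")
      case True
      then obtain x n where x: "a \<le> x" "x \<le> d" "\<bar>x - of_int n\<bar> < r / 2" by blast
      have near: "\<bar>z - of_int n\<bar> < r" if "a \<le> z" "z \<le> d" for z
        using x that T \<delta>(2) r(1) by linarith
      have "(1 - \<eta> * (d - a)) * cross_ratio a b c d \<le> 1 * cross_ratio a b c d"
        using pos assms ad by (intro mult_right_mono) auto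
      also have "\<dots> = cross_ratio (a - n) (b - n) (c - n) (d - n)" by (simp add: cross_ratio_translate)
      also have "\<dots> \<le> cross_ratio ((a - n) ^ 3) ((b - n) ^ 3) ((c - n) ^ 3) ((d - n) ^ 3)"
        using abcd crit[of n] by (intro cross_ratio_cube_le) linarith+
      also have "\<dots> = cross_ratio (G a - (e + n)) (G b - (e + n)) (G c - (e + n)) (G d - (e + n))"
        using near[of a] near[of b] near[of c] near[of d] abcd
        by (simp add: G_cubic)
      finally show ?thesis by (simp only: cross_ratio_translate)
    next
      case False
      then have far: "m \<le> G1 z" if "a \<le> z" "z \<le> d" for z
        using m(2)[of z] that by (meson not_le)
      have G2: "\<bar>G2 z - G2 a\<bar> \<le> w" if "a \<le> z" "z \<le> d" for z
        using \<delta>0(2)[of z a] that T \<delta>(3) by linarith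
      define l where "l x y = G1 a + G2 a * ((x + y) / 2 - a)" for x y
      have q: "\<bar>quotient x y - l x y\<bar> \<le> w * (d - a)" "m \<le> quotient x y" "quotient x y \<le> M" "\<bar>quotient x y\<bar> \<le> M"
        if xy: "a \<le> x" "x < y" "y \<le> d" for x y
      proof -
        show "\<bar>quotient x y - l x y\<bar> \<le> w * (d - a)"
          unfolding l_def using xy G2 by (rule quotient_near_linear)
        obtain z where "x < z" "z < y" "quotient x y = G1 z" using quotient_mvt[OF xy(2)] .
        then show *: "m \<le> quotient x y" "quotient x y \<le> M" using far[of z] M(2)[of z] xy by auto
        then show "\<bar>quotient x y\<bar> \<le> M" using m(1) by linarith
      qed
      have "quotient a b * quotient c d - quotient a d * quotient b c
          \<le> (M * (d - a))\<^sup>2 / 4 + 4 * (w * (d - a)) * M + 2 * (w * (d - a))\<^sup>2"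
      proof (rule product_near_linear)
        show "l a d + l b c = l a b + l c d" by (simp add: l_def field_simps)
        have "l a d - l b c = G2 a * (((a + d) - (b + c)) / 2)" by (simp add: l_def field_simps)
        moreover have "\<bar>((a + d) - (b + c)) / 2\<bar> \<le> d - a"
        proof -
          have "(a + d) - (b + c) \<le> 2 * (d - a)" "(b + c) - (a + d) \<le> 2 * (d - a)"
            using abcd by simp_all
          then show ?thesis by (simp add: abs_le_iff)
        qed
        ultimately show "\<bar>l a d - l b c\<bar> \<le> M * (d - a)"
          using M ad by (simp only: abs_mult) (intro mult_mono, auto)
      qed (use abcd q in auto)
      also have "\<dots> = (d - a) * (M\<^sup>2 * (d - a) / 4 + 4 * w * M + 2 * w\<^sup>2 * (d - a))"
        by (simp add: power2_eq_square algebra_simps)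
      also have "\<dots> \<le> (d - a) * (\<eta> * m\<^sup>2)"
      proof (rule mult_left_mono)
        have "M\<^sup>2 * (d - a) \<le> M\<^sup>2 * (\<eta> * m\<^sup>2 / M\<^sup>2)"
          using T \<delta>(4) by (intro mult_left_mono) auto
        then have 1: "M\<^sup>2 * (d - a) \<le> \<eta> * m\<^sup>2" using M(1) by simp
        have 2: "4 * w * M = \<eta> * m\<^sup>2 / 4" using M(1) by (simp add: w_def)
        have "w\<^sup>2 * (d - a) \<le> w\<^sup>2 * (\<eta> * m\<^sup>2 / (8 * w\<^sup>2))"
          using T \<delta>(5) by (intro mult_left_mono) auto
        then have 3: "w\<^sup>2 * (d - a) \<le> \<eta> * m\<^sup>2 / 8" using w by simp
        show "M\<^sup>2 * (d - a) / 4 + 4 * w * M + 2 * w\<^sup>2 * (d - a) \<le> \<eta> * m\<^sup>2"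
        proof -
          have E: "0 < \<eta> * m\<^sup>2" using assms m(1) by simp
          have "A / 4 + B + 2 * C \<le> E" if "A \<le> E" "B = E / 4" "C \<le> E / 8" "0 < E" for A B C E :: real
            using that by simp
          from this[OF 1 2 3 E] show ?thesis by (simp add: mult.assoc)
        qed
      qed (use ad in simp)
      also have "\<dots> = \<eta> * (d - a) * m\<^sup>2" by simp
      also have "\<dots> \<le> \<eta> * (d - a) * (quotient a b * quotient c d)"
        using q(2)[of a b] q(2)[of c d] abcd m(1) assms ad unfolding power2_eq_square
        by (intro mult_left_mono mult_mono) auto
      finally have "(1 - \<eta> * (d - a)) * (quotient a b * quotient c d) \<le> quotient a d * quotient b c"
        by (simp add: algebra_simps)
      moreover have "0 < quotient a b * quotient c d" using abcd by (simp add: quotient_pos)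
      ultimately have "1 - \<eta> * (d - a) \<le> (quotient a d * quotient b c) / (quotient a b * quotient c d)"
        by (simp add: pos_le_divide_eq)
      then have "(1 - \<eta> * (d - a)) * cross_ratio a b c d
         \<le> (quotient a d * quotient b c) / (quotient a b * quotient c d) * cross_ratio a b c d"
        using pos by (intro mult_right_mono) auto
      then show ?thesis using cross_ratio_image[OF abcd] by (simp add: mult.commute)
    qed
  qed
qed

section \<open>Coarse estimates that remain valid across the critical point\<close>

text \<open>The derivative at a point can exceed the mean derivative over an interval by at most a
  constant factor when the distance between them is at most the length of the interval: near a cubic
  critical point both are governed by squared distances to it, which are then comparable.\<close>

lemma derivative_le_quotient:
  obtains c where "0 < c" "c \<le> 1" "\<And>x y z. y < z \<Longrightarrow> z - y \<le> 1 \<Longrightarrow> y - (z - y) \<le> x \<Longrightarrow>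
    x \<le> z + (z - y) \<Longrightarrow> c * G1 x \<le> quotient y z"
proof -
  obtain M where M: "0 < M" "\<And>x. G1 x \<le> M" using G1_bound by blast
  obtain m where m: "0 < m" "\<And>x. (\<And>n::int. r / 2 \<le> \<bar>x - n\<bar>) \<Longrightarrow> m \<le> G1 x"
    using G1_far_from_critical by blast
  have "continuous_on UNIV (\<lambda>x. G (x + r / 4) - G x)"
    by (intro continuous_intros continuous_on_compose2[OF G_cont[of UNIV]]) auto
  moreover have "G (x + 1 + r / 4) - G (x + 1) = G (x + r / 4) - G x" for x
    using G_shift1[of x] G_shift1[of "x + r / 4"] by (simp add: add_ac)
  moreover have "0 < G (x + r / 4) - G x" for x using G_less[of x "x + r / 4"] r by simp
  ultimately obtain k where k: "0 < k" "\<And>x. k \<le> G (x + r / 4) - G x"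
    using periodic_positive_lower_bound[of "\<lambda>x. G (x + r / 4) - G x"] by blast
  \<comment> \<open>In the cubic case X^2 is at most 9 max(Y^2, Z^2) and
    \<open>cubic_quotient Y Z\<close> at least 3/4 of that maximum, whence 3 X^2 is at most 36 times
    it. The other entries serve long intervals and intervals far from the critical point.\<close>
  define c where "c = Min {1 / 36, k / M, m / M}"
  have c: "0 < c" using k(1) m(1) M(1) by (simp add: c_def)
  have c36: "c \<le> 1 / 36" and "c \<le> k / M" "c \<le> m / M" unfolding c_def by (rule Min_le; simp)+
  then have ck: "c * M \<le> k" and cm: "c * M \<le> m" using M(1) by (simp_all add: field_simps)
  show thesis
  proof (rule that[OF c])
    show "c \<le> 1" using c36 by simp
    fix x y z :: real assume yz: "y < z" "z - y \<le> 1" and x: "y - (z - y) \<le> x" "x \<le> z + (z - y)"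
    have le_M: "c * G1 x \<le> c * M" using c M(2)[of x] by simp
    consider (big) "r / 4 \<le> z - y" | (near) t n where "z - y < r / 4" "y \<le> t" "t \<le> z" "\<bar>t - of_int n\<bar> < r / 2"
      | (far) "\<And>t n. y \<le> t \<Longrightarrow> t \<le> z \<Longrightarrow> r / 2 \<le> \<bar>t - of_int n\<bar>"
      by (meson not_le)
    then show "c * G1 x \<le> quotient y z"
    proof cases
      case big
      have "k \<le> G (y + r / 4) - G y" by (rule k(2))
      also have "G (y + r / 4) \<le> G z" using big G_strict_mono by (simp add: strict_mono_less_eq)
      finally have "k * (z - y) \<le> (G z - G y) * 1" using yz k(1) by (intro mult_mono) auto
      then have "k \<le> quotient y z" using yz by (simp add: quotient_def field_simps)
      then show ?thesis using le_M ck by linarith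
    next
      case near
      define X Y Z where "X = x - n" and "Y = y - n" and "Z = z - n"
      have small: "\<bar>X\<bar> < r" "\<bar>Y\<bar> < r" "\<bar>Z\<bar> < r"
        using near x yz unfolding X_def Y_def Z_def by linarith+
      have sq: "3 / 4 * Y\<^sup>2 \<le> cubic_quotient Y Z" "3 / 4 * Z\<^sup>2 \<le> cubic_quotient Y Z"
      proof -
        have "cubic_quotient Y Z = 3 / 4 * Y\<^sup>2 + (Y / 2 + Z)\<^sup>2" "cubic_quotient Y Z = 3 / 4 * Z\<^sup>2 + (Z / 2 + Y)\<^sup>2"
          by (simp_all add: cubic_quotient_def power2_eq_square field_simps)
        moreover have "0 \<le> (Y / 2 + Z)\<^sup>2" "0 \<le> (Z / 2 + Y)\<^sup>2" by simp_all
        ultimately show "3 / 4 * Y\<^sup>2 \<le> cubic_quotient Y Z" "3 / 4 * Z\<^sup>2 \<le> cubic_quotient Y Z"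
          by linarith+
      qed
      have "\<bar>X\<bar> \<le> 3 * \<bar>Y\<bar> \<or> \<bar>X\<bar> \<le> 3 * \<bar>Z\<bar>" 
      proof -
        have XYZ: "X \<le> 2 * Z - Y" "2 * Y - Z \<le> X" using x unfolding X_def Y_def Z_def by simp_all
        show ?thesis
        proof (cases "\<bar>Y\<bar> \<le> \<bar>Z\<bar>")
          case True
          then have "\<bar>X\<bar> \<le> 3 * \<bar>Z\<bar>" using XYZ by (smt (verit))
          then show ?thesis ..
        next
          case False
          then have "\<bar>X\<bar> \<le> 3 * \<bar>Y\<bar>" using XYZ by (smt (verit))
          then show ?thesis ..
        qed
      qed
      then have "X\<^sup>2 \<le> 9 * Y\<^sup>2 \<or> X\<^sup>2 \<le> 9 * Z\<^sup>2"
        using power_mono[of "\<bar>X\<bar>" "3 * \<bar>Y\<bar>" 2] power_mono[of "\<bar>X\<bar>" "3 * \<bar>Z\<bar>" 2]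
        by (auto simp: power_mult_distrib)
      then have "1 / 36 * (3 * X\<^sup>2) \<le> cubic_quotient Y Z" using sq by linarith
      moreover have "c * (3 * X\<^sup>2) \<le> 1 / 36 * (3 * X\<^sup>2)" using c36 by (intro mult_right_mono) auto
      moreover have "G1 x = 3 * X\<^sup>2" using G1_cubic[of x n] small by (simp add: X_def)
      moreover have "quotient y z = cubic_quotient Y Z"
        using quotient_cubic[of y n z] small yz by (simp add: Y_def Z_def)
      ultimately show ?thesis by simp
    next
      case far
      obtain t where t: "y < t" "t < z" "quotient y z = G1 t" using quotient_mvt[OF yz(1)] .
      then have "m \<le> quotient y z" using far m(2)[of t] by simp
      then show ?thesis using le_M cm by linarith
    qed
  qed
qed

text \<open>A cross-ratio above 3 forces the middle interval to be longer than one of its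
  neighbours. A neighbour no longer than the middle lies within its reach in the sense of
  \<open>derivative_le_quotient\<close>, so the corresponding ratio drops by at most the factor k;
  and the cross-ratio is, up to the factor 3, the product of the ratios for such neighbours.\<close>

lemma cross_ratio_image_lower_bound:
  obtains c where "0 < c" "c \<le> 1" "\<And>a b c' d. a < b \<Longrightarrow> b < c' \<Longrightarrow> c' < d \<Longrightarrow> d - a \<le> 1 \<Longrightarrow>
    3 < cross_ratio a b c' d \<Longrightarrow> c * cross_ratio a b c' d \<le> cross_ratio (G a) (G b) (G c') (G d)"
proof -
  obtain k where k: "0 < k" "k \<le> 1" "\<And>x y z. y < z \<Longrightarrow> z - y \<le> 1 \<Longrightarrow> y - (z - y) \<le> x \<Longrightarrow>
    x \<le> z + (z - y) \<Longrightarrow> k * G1 x \<le> quotient y z"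
    using derivative_le_quotient by blast
  show thesis
  proof (rule that[of "k\<^sup>2 / 3"])
    show "0 < k\<^sup>2 / 3" using k by simp
    have "k\<^sup>2 \<le> 1\<^sup>2" using k by (intro power_mono) auto
    then show "k\<^sup>2 / 3 \<le> 1" by simp
    fix a b c d :: real
    assume abcd: "a < b" "b < c" "c < d" "d - a \<le> 1" and cr: "3 < cross_ratio a b c d"
    define L J R where "L = b - a" and "J = c - b" and "R = d - c"
    define L' J' R' where "L' = G b - G a" and "J' = G c - G b" and "R' = G d - G c"
    have pos: "0 < L" "0 < J" "0 < R" "0 < L'" "0 < J'" "0 < R'"
      using abcd G_less by (auto simp: L_def J_def R_def L'_def J'_def R'_def)
    have eq: "cross_ratio a b c d = ((L + J + R) * J) / (L * R)"
      "cross_ratio (G a) (G b) (G c) (G d) = ((L' + J' + R') * J') / (L' * R')"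
      by (simp_all add: cross_ratio_def L_def J_def R_def L'_def J'_def R'_def)
    have kL: "k * (J / L) \<le> J' / L'" if "L \<le> J"
    proof -
      obtain t where t: "a < t" "t < b" "quotient a b = G1 t" using quotient_mvt[OF abcd(1)] .
      have "k * quotient a b \<le> quotient b c"
        unfolding t(3) using that t abcd by (intro k(3)) (auto simp: L_def J_def)
      then show ?thesis using pos unfolding quotient_def L_def[symmetric] J_def[symmetric]
          L'_def[symmetric] J'_def[symmetric] by (simp add: field_simps)
    qed
    have kR: "k * (J / R) \<le> J' / R'" if "R \<le> J"
    proof -
      obtain t where t: "c < t" "t < d" "quotient c d = G1 t" using quotient_mvt[OF abcd(3)] .
      have "k * quotient c d \<le> quotient b c"
        unfolding t(3) using that t abcd by (intro k(3)) (auto simp: R_def J_def)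
      then show ?thesis using pos unfolding quotient_def R_def[symmetric] J_def[symmetric]
          R'_def[symmetric] J'_def[symmetric] by (simp add: field_simps)
    qed
    have kk: "k\<^sup>2 \<le> k" using k by (simp add: power2_eq_square mult_left_le)
    have one: "k\<^sup>2 / 3 * ((L + J + R) * J / (L * R)) \<le> (L' + J' + R') * J' / (L' * R')"
      if "J / L \<le> J' / L' / k" "L \<le> J" "J \<le> R" "0 < L" "0 < J" "0 < R" "0 < L'" "0 < J'" "0 < R'"
      for L J R L' J' R' :: real
    proof -
      have "(L + J + R) * J / (L * R) = ((L + J + R) / R) * (J / L)" by simp
      also have "\<dots> \<le> 3 * (J / L)" using that by (intro mult_right_mono) (auto simp: field_simps)
      finally have "k\<^sup>2 / 3 * ((L + J + R) * J / (L * R)) \<le> k\<^sup>2 / 3 * (3 * (J / L))"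
        by (intro mult_left_mono) auto
      also have "\<dots> = k\<^sup>2 * (J / L)" by simp
      also have "\<dots> \<le> k * (J / L)" using kk that by (intro mult_right_mono) auto
      also have "\<dots> \<le> k * (J' / L' / k)" using that(1) k(1) by (intro mult_left_mono) auto
      also have "\<dots> = J' / L'" using k(1) by simp
      also have "\<dots> = 1 * (J' / L')" by simp
      also have "\<dots> \<le> ((L' + J' + R') / R') * (J' / L')"
        using that by (intro mult_right_mono) (auto simp: field_simps)
      finally show ?thesis by (simp add: mult.commute)
    qed
    consider "L \<le> J" "R \<le> J" | "L \<le> J" "J \<le> R" | "R \<le> J" "J \<le> L" | "J \<le> L" "J \<le> R" by linarith
    then show "k\<^sup>2 / 3 * cross_ratio a b c d \<le> cross_ratio (G a) (G b) (G c) (G d)"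
    proof cases
      case 1
      have "(L + J + R) * J / (L * R) \<le> 3 * J * J / (L * R)"
        using 1 pos by (intro divide_right_mono mult_right_mono) auto
      then have "k\<^sup>2 / 3 * ((L + J + R) * J / (L * R)) \<le> k\<^sup>2 / 3 * (3 * J * J / (L * R))"
        by (intro mult_left_mono) auto
      also have "\<dots> = (k * (J / L)) * (k * (J / R))" by (simp add: power2_eq_square)
      also have "\<dots> \<le> (J' / L') * (J' / R')"
        using kL kR 1 pos k by (intro mult_mono) auto
      also have "\<dots> = J' * J' / (L' * R')" by simp
      also have "\<dots> \<le> (L' + J' + R') * J' / (L' * R')"
        using pos by (intro divide_right_mono mult_right_mono) auto
      finally show ?thesis unfolding eq .
    next
      case 2
      show ?thesis unfolding eq
      proof (rule one)
        show "J / L \<le> J' / L' / k" using kL 2 k(1) by (metis mult.commute pos_le_divide_eq)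
      qed (use 2 pos in auto)
    next
      case 3
      have "k\<^sup>2 / 3 * ((R + J + L) * J / (R * L)) \<le> (R' + J' + L') * J' / (R' * L')"
      proof (rule one)
        show "J / R \<le> J' / R' / k" using kR 3 k(1) by (metis mult.commute pos_le_divide_eq)
      qed (use 3 pos in auto)
      moreover have "L + J + R = R + J + L" "L' + J' + R' = R' + J' + L'" by simp_all
      ultimately show ?thesis
        unfolding eq by (subst mult.commute[of L R], subst mult.commute[of L' R']) (simp only:)
    next
      case 4
      then have "cross_ratio a b c d \<le> 3"
        using abcd by (intro cross_ratio_le_3) (auto simp: L_def J_def R_def)
      then show ?thesis using cr by simp
    qed
  qed
qed

end

section \<open>Semiconjugacies to a rotation\<close>

lemma record_minima:
  fixes w :: "nat \<Rightarrow> real"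
  assumes "w \<longlonglongrightarrow> 0" "\<And>k. 0 < w k"
  obtains k where "N \<le> k" "\<And>m. m < k \<Longrightarrow> w k \<le> w m"
proof -
  define \<epsilon> where "\<epsilon> = Min (w ` {..N})"
  have "0 < \<epsilon>" using assms(2) by (auto simp: \<epsilon>_def)
  then have "\<forall>\<^sub>F k in sequentially. w k < \<epsilon>" by (rule order_tendstoD(2)[OF assms(1)])
  then have ex: "\<exists>k. w k < \<epsilon>" by (auto simp: eventually_sequentially)
  \<comment> \<open>The first time at which w falls below its first N + 1 values is later than N,
    and all earlier values are at least \<epsilon>.\<close>
  define k where "k = (LEAST k. w k < \<epsilon>)"
  have k: "w k < \<epsilon>" unfolding k_def using ex by (rule LeastI_ex)
  have le: "\<epsilon> \<le> w m" if "m < k" for m using not_less_Least[of m "\<lambda>k. w k < \<epsilon>"] that by (simp add: k_def)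
  have "\<epsilon> \<le> w m" if "m \<le> N" for m using that by (auto simp: \<epsilon>_def)
  then have "\<not> k \<le> N" using k by (meson not_le)
  then show thesis using that[of k] le k by (metis less_imp_le nle_le order_trans)
qed

lemma chain_product_bound:
  fixes B \<rho> :: "nat \<Rightarrow> real"
  assumes "\<And>m. m < k \<Longrightarrow> 0 \<le> \<rho> m" "\<And>m. m < k \<Longrightarrow> B m \<le> \<rho> m * B (Suc m)"
  shows "B 0 \<le> (\<Prod>m<k. \<rho> m) * B k"
  using assms
proof (induction k)
  case (Suc k)
  have "B 0 \<le> (\<Prod>m<k. \<rho> m) * B k" using Suc by simp
  also have "\<dots> \<le> (\<Prod>m<k. \<rho> m) * (\<rho> k * B (Suc k))"
    using Suc.prems by (intro mult_left_mono prod_nonneg) auto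
  finally show ?case by (simp add: mult.assoc)
qed simp

section \<open>Images of intervals along orbits, measured in the invariant coordinate\<close>

text \<open>\<open>h\<close> measures intervals by a length that \<open>G\<close> preserves. It is
  assumed only weakly increasing, as a distribution function is.\<close>

locale cubic_semiconjugacy = cubic_map +
  fixes h :: "real \<Rightarrow> real" and \<alpha> c :: real
  assumes h_cont: "continuous_on UNIV h"
    and h_mono: "mono h"
    and h_shift1: "h (x + 1) = h x + 1"
    and h_conj: "h (G x) = h x + \<alpha>"
    and bad: "badly_approximable c \<alpha>"
begin

lemma c_bounds: "0 < c" "c \<le> 1"
  using bad by (auto simp: badly_approximable_def)

lemma h_shift: "h (x + of_int n) = h x + of_int n"
  using periodic_int_shift[of h 1] h_shift1 by simp

lemma h_int: "h (of_int n) = h 0 + of_int n"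
  using h_shift[of 0 n] by simp

lemma h_le: "x \<le> y \<Longrightarrow> h x \<le> h y"
  using h_mono by (simp add: monoD)

lemma h_less_imp_less: "h x < h y \<Longrightarrow> x < y"
  using h_le by (meson not_le)

lemma iter_less: "x < y \<Longrightarrow> (G ^^ m) x < (G ^^ m) y"
  by (induction m) (auto intro: G_less)

lemma iter_le: "x \<le> y \<Longrightarrow> (G ^^ m) x \<le> (G ^^ m) y"
  using iter_less[of x y m] by (cases "x = y") auto

lemma iter_shift: "(G ^^ m) (x + of_int n) = (G ^^ m) x + of_int n"
  by (induction m) (auto simp: G_shift)

lemma h_iter: "h ((G ^^ m) x) = h x + real m * \<alpha>"
  by (induction m) (auto simp: h_conj algebra_simps)

lemma iter_cont: "continuous_on UNIV (G ^^ m)"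
proof (induction m)
  case 0
  then show ?case by (simp add: continuous_on_id')
next
  case (Suc m)
  then show ?case using continuous_on_compose[of UNIV "G ^^ m" G] G_cont by simp
qed

lemma iter_surj: obtains x where "(G ^^ m) x = y"
  using degree_one_surj[OF iter_cont] iter_shift[of m _ 1] by (metis of_int_1)

lemma h_surj: obtains x where "h x = y"
  using degree_one_surj[OF h_cont h_shift1] .

lemma rotation_separated:
  assumes "m < n" "m' < n" "m \<noteq> m'"
  shows "c / real n \<le> \<bar>(real m - real m') * \<alpha> + of_int p\<bar>"
proof -
  have main: "c / real n \<le> \<bar>(real m - real m') * \<alpha> + of_int p\<bar>" if "m < n" "m' < m" for m m' :: nat and p :: int
  proof -
    have "c / real n \<le> c / of_int (int m - int m')" using that c_bounds by (intro divide_left_mono) auto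
    also have "\<dots> \<le> \<bar>of_int (int m - int m') * \<alpha> - of_int (- p)\<bar>"
    proof -
      have "1 \<le> real_of_int (int m - int m')" using that by simp
      then show ?thesis using bad unfolding badly_approximable_def by blast
    qed
    finally show ?thesis by simp
  qed
  show ?thesis
  proof (cases "m' < m")
    case True
    then show ?thesis using main assms by blast
  next
    case False
    then have "c / real n \<le> \<bar>(real m' - real m) * \<alpha> + of_int (- p)\<bar>"
      using main[of m' m "- p"] assms by simp
    also have "(real m' - real m) * \<alpha> + of_int (- p) = - ((real m - real m') * \<alpha> + of_int p)"
      by (simp add: algebra_simps)
    finally show ?thesis by simp
  qed
qed

text \<open>Extends estimates that add up under subdivision from short intervals to intervals of
  \<open>h\<close>-length below P w: the intermediate value theorem for \<open>h\<close> cuts off a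
  last piece carrying an equal share of the \<open>h\<close>-length.\<close>

lemma interval_split_induct [consumes 2, case_names base step]:
  assumes "a \<le> d" "h d - h a < real P * w"
    and base: "\<And>a d. a \<le> d \<Longrightarrow> h d - h a < w \<Longrightarrow> Q 1 a d"
    and step: "\<And>P a b d. a \<le> b \<Longrightarrow> b \<le> d \<Longrightarrow> Q P a b \<Longrightarrow> Q 1 b d \<Longrightarrow> Q (Suc P) a d"
  shows "Q P a d"
  using assms(1,2)
proof (induction P arbitrary: a d)
  case 0
  then show ?case using h_le[of a d] by simp
next
  case (Suc P)
  show ?case
  proof (cases "P = 0")
    case True
    then show ?thesis using base Suc.prems by simp
  next
    case False
    define \<Delta> where "\<Delta> = h d - h a"
    have \<Delta>: "0 \<le> \<Delta>" "\<Delta> / real (Suc P) < w"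
      using h_le[OF Suc.prems(1)] Suc.prems(2) by (simp_all add: \<Delta>_def field_simps)
    have le: "h a \<le> h d - \<Delta> / real (Suc P)" "h d - \<Delta> / real (Suc P) \<le> h d"
    proof -
      have "\<Delta> / real (Suc P) \<le> \<Delta> / 1" using \<Delta> by (intro divide_left_mono) auto
      then show "h a \<le> h d - \<Delta> / real (Suc P)" by (simp add: \<Delta>_def)
      show "h d - \<Delta> / real (Suc P) \<le> h d" using \<Delta> by simp
    qed
    obtain b where b: "a \<le> b" "b \<le> d" "h b = h d - \<Delta> / real (Suc P)"
      using IVT'[OF le Suc.prems(1)] continuous_on_subset[OF h_cont] by (metis subset_UNIV)
    have "h b - h a = real P * (\<Delta> / real (Suc P))"
      using b(3) by (simp add: \<Delta>_def field_simps)
    also have "\<dots> < real P * w" using \<Delta> False by (intro mult_strict_left_mono) auto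
    finally show ?thesis
      using step[OF b(1,2) Suc.IH[OF b(1)] base[OF b(2)]] b(3) \<Delta> by simp
  qed
qed

text \<open>A common point of two translated images would place (m - m') \<alpha> within h d - h a
  of an integer, against the separation of the rotation orbit.\<close>

lemma translates_disjoint:
  assumes "h d - h a < c / real n" "m < n" "m' < n"
    and "(G ^^ m) a + of_int p \<le> x" "x \<le> (G ^^ m) d + of_int p"
    and "(G ^^ m') a + of_int p' \<le> x" "x \<le> (G ^^ m') d + of_int p'"
  shows "m = m' \<and> p = p'"
proof -
  have "h a + real m * \<alpha> + p \<le> h x" "h x \<le> h d + real m * \<alpha> + p"
    "h a + real m' * \<alpha> + p' \<le> h x" "h x \<le> h d + real m' * \<alpha> + p'"
    using assms(4-7)[THEN h_le] by (simp_all add: h_shift h_iter)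
  then have "\<bar>(real m * \<alpha> - real m' * \<alpha>) + (of_int p - of_int p')\<bar> \<le> h d - h a" by linarith
  then have le: "\<bar>(real m - real m') * \<alpha> + of_int (p - p')\<bar> < c / real n"
    using assms(1) by (simp add: algebra_simps)
  then have mm: "m = m'" using rotation_separated[OF assms(2,3)] by (meson not_le)
  moreover have "c / real n \<le> 1" using c_bounds assms(2) by (simp add: field_simps)
  ultimately have "\<bar>of_int (p - p')\<bar> < (1::real)" using le by simp
  then have "p = p'" by linarith
  with mm show ?thesis by simp
qed

text \<open>The images project to disjoint arcs of a circle of length 1.\<close>

lemma sum_iterates_le_1:
  assumes "a \<le> d" "h d - h a < c / real n"
  shows "(\<Sum>m<n. (G ^^ m) d - (G ^^ m) a) \<le> 1"
proof (cases "n = 0")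
  case False
  define fl where "fl m = - \<lfloor>(G ^^ m) a\<rfloor>" for m
  define lo where "lo m = (G ^^ m) a + of_int (fl m)" for m
  define hi where "hi m = (G ^^ m) d + of_int (fl m)" for m
  have lo: "0 \<le> lo m" "lo m < 1" for m unfolding lo_def fl_def by linarith+
  have lohi: "lo m \<le> hi m" for m unfolding lo_def hi_def using iter_le[OF assms(1)] by simp
  \<comment> \<open>The normalised interval starting furthest left begins at b, and its next
    translate at b + 1. No interval can reach beyond b + 1 without meeting that translate, so all of
    them fit into one unit interval.\<close>
  define b where "b = Min (lo ` {..<n})"
  have "b \<in> lo ` {..<n}" unfolding b_def using False by (intro Min_in) auto
  then obtain m0 where m0: "m0 < n" "b = lo m0" by auto
  have b_le: "b \<le> lo m" if "m < n" for m unfolding b_def using that by (intro Min_le) auto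
  have hi_le: "hi m \<le> b + 1" if m: "m < n" for m
  proof (rule ccontr)
    assume "\<not> hi m \<le> b + 1"
    then have "m0 = m \<and> fl m0 + 1 = fl m"
      using lo[of m] lo[of m0] lohi[of m0] m0
      by (intro translates_disjoint[OF assms(2) m0(1) m, of _ "b + 1"]) (auto simp: lo_def hi_def)
    then show False by auto
  qed
  have "disjoint_family_on (\<lambda>m. {lo m..hi m}) {..<n}"
    unfolding disjoint_family_on_def
  proof (intro ballI impI)
    fix m m' assume mm: "m \<in> {..<n}" "m' \<in> {..<n}" "m \<noteq> m'"
    have False if "x \<in> {lo m..hi m}" "x \<in> {lo m'..hi m'}" for x
      using translates_disjoint[OF assms(2), of m m' "fl m" x "fl m'"] mm that
      by (simp add: lo_def hi_def)
    then show "{lo m..hi m} \<inter> {lo m'..hi m'} = {}" by blast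
  qed
  then have "measure lborel (\<Union>m<n. {lo m..hi m}) = (\<Sum>m<n. measure lborel {lo m..hi m})"
    by (intro measure_finite_Union) (auto simp: emeasure_lborel_Icc[OF lohi])
  also have "\<dots> = (\<Sum>m<n. (G ^^ m) d - (G ^^ m) a)"
    using lohi by (intro sum.cong) (auto simp: lo_def hi_def)
  finally have eq: "measure lborel (\<Union>m<n. {lo m..hi m}) = (\<Sum>m<n. (G ^^ m) d - (G ^^ m) a)" .
  have "measure lborel (\<Union>m<n. {lo m..hi m}) \<le> measure lborel {b..b + 1}"
  proof (rule measure_mono_fmeasurable)
    show "(\<Union>m<n. {lo m..hi m}) \<subseteq> {b..b + 1}" using b_le hi_le by fastforce
  qed (auto intro: fmeasurableI)
  then show ?thesis using eq by simp
qed simp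

lemma sum_iterates_le:
  assumes "a \<le> d" "h d - h a < real P * (c / real n)"
  shows "(\<Sum>m<n. (G ^^ m) d - (G ^^ m) a) \<le> real P"
  using assms
proof (induction P a d rule: interval_split_induct)
  case (base a d)
  then show ?case using sum_iterates_le_1 by simp
next
  case (step P a b d)
  have "(\<Sum>m<n. (G ^^ m) d - (G ^^ m) a) =
      (\<Sum>m<n. (G ^^ m) b - (G ^^ m) a) + (\<Sum>m<n. (G ^^ m) d - (G ^^ m) b)"
    by (simp add: sum.distrib[symmetric])
  then show ?case using step by simp
qed

text \<open>Endpoints count, so that cutting an interval at a point that later hits an integer loses
  no time.\<close>

definition critical_times :: "nat \<Rightarrow> real \<Rightarrow> real \<Rightarrow> nat set" where
  "critical_times n a d = {m. m < n \<and> (\<exists>k. (G ^^ m) a \<le> of_int k \<and> of_int k \<le> (G ^^ m) d)}"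

lemma finite_critical_times [simp]: "finite (critical_times n a d)"
  by (simp add: critical_times_def)

lemma card_critical_times_le:
  assumes "a \<le> d" "h d - h a < real P * (c / real n)"
  shows "card (critical_times n a d) \<le> P"
  using assms
proof (induction P a d rule: interval_split_induct)
  case (base a d)
  have "m = m'" if "m \<in> critical_times n a d" "m' \<in> critical_times n a d" for m m'
  proof -
    from that obtain k k' where k: "m < n" "(G ^^ m) a \<le> of_int k" "of_int k \<le> (G ^^ m) d"
      "m' < n" "(G ^^ m') a \<le> of_int k'" "of_int k' \<le> (G ^^ m') d"
      by (auto simp: critical_times_def)
    then show ?thesis
      using translates_disjoint[OF base(2), of m m' "- k" 0 "- k'"] by simp
  qed
  then show ?case by (simp add: card_le_Suc0_iff_eq)
next
  case (step P a b d)
  have "critical_times n a d \<subseteq> critical_times n a b \<union> critical_times n b d"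
    unfolding critical_times_def by (auto, meson linear)
  then have "card (critical_times n a d) \<le> card (critical_times n a b) + card (critical_times n b d)"
    by (meson card_Un_le card_mono finite_UnI finite_critical_times order_trans)
  then show ?case using step by simp
qed

text \<open>The bound is propagated backwards from time n. At ordinary times the cross-ratio
  decreases by at most a factor exp(-T m), and the T m sum to at most P. At times when the image is
  long or meets the critical point a constant factor q may be lost, but the number of these times is
  bounded. Hence K is independent of n and of the quadruple.\<close>

lemma bounded_distortion:
  obtains K where "\<And>a u v d n. a < u \<Longrightarrow> u < v \<Longrightarrow> v < d \<Longrightarrow> d - a \<le> 1 \<Longrightarrow> h d - h a < 1 \<Longrightarrow>
      h d - h a < real P * (c / real n) \<Longrightarrow>
      cross_ratio ((G ^^ n) a) ((G ^^ n) u) ((G ^^ n) v) ((G ^^ n) d) \<le> 3 \<Longrightarrow>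
      cross_ratio a u v d \<le> K"
proof -
  obtain \<delta> where \<delta>: "0 < \<delta>" "\<And>a b c d. a < b \<Longrightarrow> b < c \<Longrightarrow> c < d \<Longrightarrow> d - a \<le> \<delta> \<Longrightarrow>
    (\<And>n. \<not> (a < of_int n \<and> of_int n < d)) \<Longrightarrow>
    (1 - 1 / 2 * (d - a)) * cross_ratio a b c d \<le> cross_ratio (G a) (G b) (G c) (G d)"
    using cross_ratio_almost_increasing[of "1 / 2"] by (metis half_gt_zero zero_less_one)
  obtain q where q: "0 < q" "q \<le> 1" "\<And>a b c' d. a < b \<Longrightarrow> b < c' \<Longrightarrow> c' < d \<Longrightarrow> d - a \<le> 1 \<Longrightarrow>
    3 < cross_ratio a b c' d \<Longrightarrow> q * cross_ratio a b c' d \<le> cross_ratio (G a) (G b) (G c') (G d)"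
    using cross_ratio_image_lower_bound by blast
  \<comment> \<open>At most P times are critical, and at most P/\<delta> images are longer than
    \<delta>, since their lengths sum to at most P.\<close>
  define Z where "Z = P + nat \<lceil>real P / \<delta>\<rceil>"
  show thesis
  proof (rule that)
    fix a u v d n
    assume auvd: "a < u" "u < v" "v < d" and ad1: "h d - h a < 1"
      and hP: "h d - h a < real P * (c / real n)"
      and end3: "cross_ratio ((G ^^ n) a) ((G ^^ n) u) ((G ^^ n) v) ((G ^^ n) d) \<le> 3"
    \<comment> \<open>Truncation at 3 is needed because the coarse estimate holds only for
      cross-ratios above 3.\<close>
    define B where "B m = max 3 (cross_ratio ((G ^^ m) a) ((G ^^ m) u) ((G ^^ m) v) ((G ^^ m) d))" for m
    define T where "T m = (G ^^ m) d - (G ^^ m) a" for m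
    have ad: "a \<le> d" using auvd by simp
    have T: "0 < T m" "T m \<le> 1" for m
    proof -
      show "0 < T m" using iter_less[of a d m] auvd by (simp add: T_def)
      have "h ((G ^^ m) d) < h ((G ^^ m) a + 1)" using ad1 by (simp add: h_iter h_shift1)
      then show "T m \<le> 1" using h_less_imp_less unfolding T_def by fastforce
    qed
    have sumT: "(\<Sum>m<n. T m) \<le> real P" unfolding T_def using ad hP by (rule sum_iterates_le)
    define long where "long = {m. m < n \<and> \<delta> < T m}"
    define exc where "exc = critical_times n a d \<union> long"
    define \<rho> where "\<rho> m = exp (T m) * (if m \<in> exc then 1 / q else 1)" for m
    have "real (card long) * \<delta> = (\<Sum>m\<in>long. \<delta>)" by simp
    also have "\<dots> \<le> (\<Sum>m\<in>long. T m)" by (intro sum_mono) (auto simp: long_def)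
    also have "\<dots> \<le> (\<Sum>m<n. T m)" using T(1) by (intro sum_mono2) (auto simp: long_def less_imp_le)
    finally have "real (card long) \<le> real P / \<delta>" using sumT \<delta>(1) by (simp add: field_simps)
    then have "card long \<le> nat \<lceil>real P / \<delta>\<rceil>" by linarith
    then have card_exc: "card exc \<le> Z"
      unfolding exc_def Z_def using card_Un_le[of "critical_times n a d" long] card_critical_times_le[OF ad hP]
      by linarith
    have "B 0 \<le> (\<Prod>m<n. \<rho> m) * B n"
    proof (rule chain_product_bound)
      fix m assume m: "m < n"
      show "0 \<le> \<rho> m" using q by (simp add: \<rho>_def)
      have less: "(G ^^ m) a < (G ^^ m) u" "(G ^^ m) u < (G ^^ m) v" "(G ^^ m) v < (G ^^ m) d"
        using auvd iter_less by auto
      let ?C = "cross_ratio ((G ^^ m) a) ((G ^^ m) u) ((G ^^ m) v) ((G ^^ m) d)"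
      let ?C' = "cross_ratio ((G ^^ Suc m) a) ((G ^^ Suc m) u) ((G ^^ Suc m) v) ((G ^^ Suc m) d)"
      have C': "?C' = cross_ratio (G ((G ^^ m) a)) (G ((G ^^ m) u)) (G ((G ^^ m) v)) (G ((G ^^ m) d))"
        by simp
      have exp1: "1 \<le> exp (T m)" using T(1)[of m] by simp
      have B3: "3 \<le> B (Suc m)" "?C' \<le> B (Suc m)" unfolding B_def by (rule max.cobounded1 max.cobounded2)+
      have large: "?C \<le> \<rho> m * B (Suc m)" if C3: "3 < ?C"
      proof (cases "m \<in> exc")
        case True
        have "q * ?C \<le> ?C'" unfolding C' using less T(2)[of m] C3 by (intro q(3)) (auto simp: T_def)
        then have "?C \<le> 1 / q * ?C'" using q(1) by (simp add: field_simps)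
        also have "\<dots> \<le> 1 / q * B (Suc m)" using B3 q(1) by (intro mult_left_mono) auto
        also have "\<dots> \<le> exp (T m) * (1 / q * B (Suc m))"
          using mult_right_mono[OF exp1, of "1 / q * B (Suc m)"] B3 q(1) by simp
        finally show ?thesis using True by (simp add: \<rho>_def)
      next
        case False
        have pos: "0 < ?C" using less by (rule cross_ratio_pos)
        have grow: "(1 - 1 / 2 * T m) * ?C \<le> ?C'" unfolding C' T_def
        proof (rule \<delta>(2)[OF less])
          show "(G ^^ m) d - (G ^^ m) a \<le> \<delta>" using False m by (auto simp: exc_def long_def T_def)
          show "\<not> ((G ^^ m) a < of_int k \<and> of_int k < (G ^^ m) d)" for k
            using False m by (auto simp: exc_def critical_times_def intro: less_imp_le)
        qed
        \<comment> \<open>(1 + T)(1 - T/2) = 1 + T(1 - T)/2, which is at least 1 because image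
          lengths are at most 1.\<close>
        have "1 \<le> exp (T m) * (1 - 1 / 2 * T m)"
        proof -
          have "0 \<le> T m * (1 - T m)" using T[of m] by simp
          then have "1 \<le> (1 + T m) * (1 - 1 / 2 * T m)" by (simp add: field_simps)
          also have "\<dots> \<le> exp (T m) * (1 - 1 / 2 * T m)"
            using T[of m] by (intro mult_right_mono) auto
          finally show ?thesis .
        qed
        then have "1 * ?C \<le> exp (T m) * (1 - 1 / 2 * T m) * ?C" using pos by (intro mult_right_mono) auto
        also have "\<dots> = exp (T m) * ((1 - 1 / 2 * T m) * ?C)" by simp
        also have "\<dots> \<le> exp (T m) * ?C'" using grow by (intro mult_left_mono) auto
        finally have "?C \<le> exp (T m) * ?C'" by simp
        also have "\<dots> \<le> exp (T m) * B (Suc m)" using B3 by simp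
        finally show ?thesis using False by (simp add: \<rho>_def)
      qed
      have "1 \<le> \<rho> m"
      proof -
        have "1 * 1 \<le> exp (T m) * (if m \<in> exc then 1 / q else 1)"
          using exp1 q by (intro mult_mono) auto
        then show ?thesis by (simp add: \<rho>_def)
      qed
      then have "3 \<le> \<rho> m * B (Suc m)" using B3 mult_mono[of 1 "\<rho> m" 3 "B (Suc m)"] by simp
      then show "B m \<le> \<rho> m * B (Suc m)"
        unfolding B_def[of m] using large by (cases "3 < ?C") (simp_all add: max_def)
    qed
    also have "B n = 3" using end3 by (simp add: B_def)
    also have "(\<Prod>m<n. \<rho> m) = exp (\<Sum>m<n. T m) * (1 / q) ^ card ({..<n} \<inter> exc)"
      unfolding \<rho>_def prod.distrib by (simp add: exp_sum prod.If_cases Int_def)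
    also have "({..<n} \<inter> exc) = exc" by (auto simp: exc_def critical_times_def long_def)
    finally have "B 0 \<le> exp (\<Sum>m<n. T m) * (1 / q) ^ card exc * 3" .
    also have "\<dots> \<le> exp (real P) * (1 / q) ^ Z * 3"
      using sumT card_exc q by (intro mult_right_mono mult_mono power_increasing) auto
    finally show "cross_ratio a u v d \<le> exp (real P) * (1 / q) ^ Z * 3" by (simp add: B_def)
  qed
qed

section \<open>Absence of plateaus: the semiconjugacy is a homeomorphism\<close>

lemma h_level_set:
  obtains u v where "u \<le> v" "\<And>x. h x = t \<longleftrightarrow> u \<le> x \<and> x \<le> v"
proof -
  define S where "S = {x. h x = t}"
  obtain x0 where x0: "h x0 = t" using h_surj .
  have "x0 - 1 \<le> x \<and> x \<le> x0 + 1" if "x \<in> S" for x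
    using that h_shift1[of x0] h_shift1[of "x0 - 1"] x0 h_le[of x "x0 - 1"] h_le[of "x0 + 1" x]
    unfolding S_def by fastforce
  then have "S \<subseteq> {x0 - 1..x0 + 1}" by auto
  moreover have "closed S" unfolding S_def
    using continuous_closed_preimage_constant[OF h_cont closed_UNIV] by simp
  ultimately have comp: "compact S" by (meson bounded_closed_interval bounded_subset compact_eq_bounded_closed)
  have ne: "S \<noteq> {}" using x0 by (auto simp: S_def)
  obtain u where u: "u \<in> S" "\<And>x. x \<in> S \<Longrightarrow> u \<le> x" using compact_attains_inf[OF comp ne] by blast
  obtain v where v: "v \<in> S" "\<And>x. x \<in> S \<Longrightarrow> x \<le> v" using compact_attains_sup[OF comp ne] by blast
  have between: "h x = t" if "u \<le> x" "x \<le> v" for x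
    using h_le[OF that(1)] h_le[OF that(2)] u(1) v(1) by (simp add: S_def)
  show thesis
  proof (rule that)
    show "u \<le> v" using u(2) v(1) .
    show "h x = t \<longleftrightarrow> u \<le> x \<and> x \<le> v" for x
      using u(2)[of x] v(2)[of x] between[of x] by (auto simp: S_def)
  qed
qed

text \<open>
  A nondegenerate fibre \<open>W\<close> of \<open>h\<close> has pairwise disjoint images on the circle, so their lengths
  tend to \<open>0\<close>.  At a time when the image is shorter than all earlier ones, the earlier images
  nearby give it space on both sides; by bounded distortion \<open>W\<close> itself has space of a definite
  size in arbitrarily small neighbourhoods of its level.
\<close>

lemma h_strict_mono: "strict_mono h"
proof (rule ccontr)
  assume "\<not> strict_mono h"
  then obtain x y where xy: "x < y" "\<not> h x < h y" by (auto simp: strict_mono_def)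
  then have "h x = h y" using h_le[of x y] by simp
  define t where "t = h x"
  obtain u v where uv: "\<And>z. h z = t \<longleftrightarrow> u \<le> z \<and> z \<le> v"
    using h_level_set[of t] by blast
  have "u \<le> x" "y \<le> v" using uv[of x] uv[of y] \<open>h x = h y\<close> by (auto simp: t_def)
  then have uv_less: "u < v" using xy by simp
  have hu: "h u = t" and hv: "h v = t" using uv[of u] uv[of v] uv_less by auto
  have left: "h z < t" if "z < u" for z
    using uv[of z] h_le[of z u] that hu by (simp add: order_less_le)
  define w where "w m = (G ^^ m) v - (G ^^ m) u" for m
  have w_pos: "0 < w m" for m using iter_less[OF uv_less] by (simp add: w_def)
  \<comment> \<open>The fibre has \<open>h\<close>-length 0, below c/n for every n, so the bound on
    the sum of image lengths is uniform in n.\<close>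
  have "(\<Sum>m<n. w m) \<le> 1" for n
  proof (cases "n = 0")
    case False
    then show ?thesis
      unfolding w_def using uv_less hu hv c_bounds by (intro sum_iterates_le_1) auto
  qed simp
  then have "summable w"
    using w_pos by (intro bounded_imp_summable[of w 1]) (auto intro: less_imp_le simp: lessThan_Suc_atMost[symmetric] simp del: lessThan_Suc sum.lessThan_Suc)
  then have w0: "w \<longlonglongrightarrow> 0" by (rule summable_LIMSEQ_zero)
  define C where "C = 1 + 1 / c"
  have C: "0 < C" using c_bounds by (simp add: C_def add_pos_pos)
  \<comment> \<open>The interval (a, d) chosen below has \<open>h\<close>-length 8 C/k; this P makes
    it less than P c/k for every k, so that K can be fixed before k.\<close>
  define P where "P = nat \<lceil>8 * C / c\<rceil> + 1"
  have P: "8 * C < real P * c"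
  proof -
    have "8 * C / c < real P" unfolding P_def by linarith
    then show ?thesis using c_bounds by (simp add: field_simps)
  qed
  obtain K where K: "\<And>a u v d n. a < u \<Longrightarrow> u < v \<Longrightarrow> v < d \<Longrightarrow> d - a \<le> 1 \<Longrightarrow> h d - h a < 1 \<Longrightarrow>
      h d - h a < real P * (c / real n) \<Longrightarrow>
      cross_ratio ((G ^^ n) a) ((G ^^ n) u) ((G ^^ n) v) ((G ^^ n) d) \<le> 3 \<Longrightarrow>
      cross_ratio a u v d \<le> K"
    using bounded_distortion[of P] by blast
  \<comment> \<open>If a lies between \<open>x1\<close> and u, then (v - u)/(u - a), and with it the
    cross-ratio, is at least |K| + 1.\<close>
  define x1 where "x1 = u - (v - u) / (\<bar>K\<bar> + 1)"
  have x1: "x1 < u" using uv_less by (simp add: x1_def add_nonneg_pos)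
  \<comment> \<open>\<sigma> < \<epsilon> puts a to the right of \<open>x1\<close>; the bound 1/2
    keeps the \<open>h\<close>-length 2 \<sigma> below 1.\<close>
  define \<epsilon> where "\<epsilon> = min (t - h x1) (1 / 2)"
  have \<epsilon>: "0 < \<epsilon>" using left[OF x1] by (simp add: \<epsilon>_def)
  obtain N :: nat where N: "4 * C / \<epsilon> < real N" using reals_Archimedean2 by blast
  obtain k where k: "N \<le> k" "\<And>m. m < k \<Longrightarrow> w k \<le> w m" using record_minima[OF w0 w_pos] by blast
  have "0 < 4 * C / \<epsilon>" using C \<epsilon> by simp
  then have k0: "0 < real k" "4 * C / \<epsilon> < real k" using N k(1) by linarith+
  \<comment> \<open>An earlier orbit level is found within C/k of the level shifted by 2 C/k to
    either side, hence at distance between C/k and 3 C/k. The value 4 C/k leaves room for the whole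
    earlier image between those of a and u, or of v and d.\<close>
  define \<sigma> where "\<sigma> = 4 * C / k"
  have \<sigma>: "0 < \<sigma>" "\<sigma> < \<epsilon>" using k0 C \<epsilon> by (simp_all add: \<sigma>_def field_simps)
  obtain a where a: "h a = t - \<sigma>" using h_surj .
  obtain d where d: "h d = t + \<sigma>" using h_surj .
  have au: "a < u" using h_less_imp_less[of a u] a hu \<sigma> by simp
  have vd: "v < d" using h_less_imp_less[of v d] d hv \<sigma> by simp
  have x1a: "x1 < a" using h_less_imp_less[of x1 a] a \<sigma> by (simp add: \<epsilon>_def)
  have had: "h d - h a = 2 * \<sigma>" using a d by simp
  have had1: "h d - h a < 1" using had \<sigma> by (simp add: \<epsilon>_def)
  have "h d < h (a + 1)" using had1 by (simp add: h_shift1)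
  then have ad1: "d - a \<le> 1" using h_less_imp_less[of d "a + 1"] by simp
  have small: "C / real k < \<sigma>" "3 * C / real k < \<sigma>" using C k0 by (simp_all add: \<sigma>_def field_simps)
  have neighbour: "\<exists>m n. m < k \<and> \<bar>real m * \<alpha> + of_int n - \<theta>\<bar> \<le> C / real k" for \<theta>
    using badly_approximable_covering[OF bad, of k \<theta>] k0 by (simp add: C_def)
  have "cross_ratio ((G ^^ k) a) ((G ^^ k) u) ((G ^^ k) v) ((G ^^ k) d) \<le> 3"
  proof (rule cross_ratio_le_3)
    show "(G ^^ k) a < (G ^^ k) u" "(G ^^ k) u < (G ^^ k) v" "(G ^^ k) v < (G ^^ k) d"
      using au uv_less vd iter_less by auto
    have pos: "0 < C / real k" using C k0 by simp
    obtain m n where mn: "m < k" "\<bar>real m * \<alpha> + of_int n - (real k * \<alpha> - 2 * (C / real k))\<bar> \<le> C / real k"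
      using neighbour by blast
    have "h ((G ^^ k) a) < h ((G ^^ m) u + of_int n)" "h ((G ^^ m) v + of_int n) < h ((G ^^ k) u)"
      using mn(2) small pos a hu hv unfolding h_shift h_iter by linarith+
    then have "(G ^^ k) a < (G ^^ m) u + of_int n" "(G ^^ m) v + of_int n < (G ^^ k) u"
      by (auto dest: h_less_imp_less)
    then have "w m \<le> (G ^^ k) u - (G ^^ k) a" by (simp add: w_def)
    then show "(G ^^ k) v - (G ^^ k) u \<le> (G ^^ k) u - (G ^^ k) a"
      using k(2)[OF mn(1)] by (simp add: w_def)
    obtain m n where mn: "m < k" "\<bar>real m * \<alpha> + of_int n - (real k * \<alpha> + 2 * (C / real k))\<bar> \<le> C / real k"
      using neighbour by blast
    have "h ((G ^^ k) v) < h ((G ^^ m) u + of_int n)" "h ((G ^^ m) v + of_int n) < h ((G ^^ k) d)"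
      using mn(2) small pos d hu hv unfolding h_shift h_iter by linarith+
    then have "(G ^^ k) v < (G ^^ m) u + of_int n" "(G ^^ m) v + of_int n < (G ^^ k) d"
      by (auto dest: h_less_imp_less)
    then have "w m \<le> (G ^^ k) d - (G ^^ k) v" by (simp add: w_def)
    then show "(G ^^ k) v - (G ^^ k) u \<le> (G ^^ k) d - (G ^^ k) v"
      using k(2)[OF mn(1)] by (simp add: w_def)
  qed
  moreover have "h d - h a < real P * (c / real k)"
    using P k0 unfolding had \<sigma>_def by (simp add: field_simps)
  ultimately have "cross_ratio a u v d \<le> K" using au uv_less vd ad1 had1 by (intro K)
  moreover have "\<bar>K\<bar> + 1 \<le> (v - u) / (u - a)"
  proof -
    have "u - a \<le> (v - u) / (\<bar>K\<bar> + 1)" using x1a by (simp add: x1_def)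
    then have "(\<bar>K\<bar> + 1) * (u - a) \<le> v - u" by (simp add: field_simps add_nonneg_pos)
    then show ?thesis using au by (simp add: field_simps)
  qed
  moreover have "(v - u) / (u - a) \<le> cross_ratio a u v d"
    by (rule cross_ratio_ge_left[OF au uv_less vd])
  ultimately show False by linarith
qed

lemma h_less_iff: "h x < h y \<longleftrightarrow> x < y"
  using h_strict_mono by (simp add: strict_mono_less)

text \<open>The inverse of \<open>h\<close> is uniformly continuous. As \<open>G\<close> preserves
  \<open>h\<close>-length, an interval of small \<open>h\<close>-length has short images at all
  times.\<close>

lemma h_uniform:
  assumes "0 < \<delta>"
  obtains \<sigma> where "0 < \<sigma>" "\<And>a d. h d - h a < \<sigma> \<Longrightarrow> d - a < \<delta>"
proof -
  have "continuous_on UNIV (\<lambda>x. h (x + \<delta>) - h x)"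
    by (intro continuous_intros continuous_on_compose2[OF h_cont]) auto
  moreover have "h (x + 1 + \<delta>) - h (x + 1) = h (x + \<delta>) - h x" for x
    using h_shift1[of x] h_shift1[of "x + \<delta>"] by (simp add: add_ac)
  moreover have "0 < h (x + \<delta>) - h x" for x using h_less_iff assms by simp
  ultimately obtain k where k: "0 < k" "\<And>x. k \<le> h (x + \<delta>) - h x"
    using periodic_positive_lower_bound[of "\<lambda>x. h (x + \<delta>) - h x"] by blast
  have "d - a < \<delta>" if "h d - h a < k" for a d
  proof -
    have "h d < h (a + \<delta>)" using k(2)[of a] that by linarith
    then show ?thesis using h_less_iff[of d "a + \<delta>"] by linarith
  qed
  then show thesis using that k(1) by blast
qed

end

lemma tendsto_at_right_0_iff:
  fixes f :: "real \<Rightarrow> real"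
  shows "(f \<longlongrightarrow> L) (at_right 0) \<longleftrightarrow>
    (\<forall>e>0. \<exists>d>0. \<forall>y. 0 < y \<and> y < d \<longrightarrow> \<bar>f y - L\<bar> < e)"
  unfolding tendsto_iff eventually_at_right_field dist_real_def by (meson)

section \<open>A positive one-sided derivative contradicts the gain at the critical point\<close>

context cubic_semiconjugacy
begin

text \<open>The product of the factors 1 - \<eta> T m is at least 1 - \<eta> times the sum of the T
  m, and the images, being disjoint on the circle, have total length at most 1.\<close>

lemma cross_ratio_iterates:
  assumes "0 < \<eta>"
  obtains \<delta> where "0 < \<delta>" "\<And>a b c' d n p q. a < b \<Longrightarrow> b < c' \<Longrightarrow> c' < d \<Longrightarrow> h d - h a < c / real n \<Longrightarrow>
    (\<And>m. (G ^^ m) d - (G ^^ m) a \<le> \<delta>) \<Longrightarrow> p \<le> q \<Longrightarrow> q \<le> n \<Longrightarrow>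
    (\<And>m k. p \<le> m \<Longrightarrow> m < q \<Longrightarrow> \<not> ((G ^^ m) a < of_int k \<and> of_int k < (G ^^ m) d)) \<Longrightarrow>
    (1 - \<eta>) * cross_ratio ((G ^^ p) a) ((G ^^ p) b) ((G ^^ p) c') ((G ^^ p) d)
    \<le> cross_ratio ((G ^^ q) a) ((G ^^ q) b) ((G ^^ q) c') ((G ^^ q) d)"
proof -
  obtain \<delta>0 where \<delta>0: "0 < \<delta>0" "\<And>a b c d. a < b \<Longrightarrow> b < c \<Longrightarrow> c < d \<Longrightarrow> d - a \<le> \<delta>0 \<Longrightarrow>
    (\<And>n. \<not> (a < of_int n \<and> of_int n < d)) \<Longrightarrow>
    (1 - \<eta> * (d - a)) * cross_ratio a b c d \<le> cross_ratio (G a) (G b) (G c) (G d)"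
    using cross_ratio_almost_increasing[OF assms] by metis
  \<comment> \<open>The entry 1/\<eta> keeps every factor 1 - \<eta> T m nonnegative.\<close>
  define \<delta> where "\<delta> = min \<delta>0 (1 / \<eta>)"
  show thesis
  proof (rule that)
    show "0 < \<delta>" using \<delta>0 assms by (simp add: \<delta>_def)
    fix a b c' d :: real and n p q :: nat
    assume abcd: "a < b" "b < c'" "c' < d" and had: "h d - h a < c / real n"
      and small: "\<And>m. (G ^^ m) d - (G ^^ m) a \<le> \<delta>" and pq: "p \<le> q" "q \<le> n"
      and crit: "\<And>m k. p \<le> m \<Longrightarrow> m < q \<Longrightarrow> \<not> ((G ^^ m) a < of_int k \<and> of_int k < (G ^^ m) d)"
    define B where "B m = cross_ratio ((G ^^ m) a) ((G ^^ m) b) ((G ^^ m) c') ((G ^^ m) d)" for m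
    define T where "T m = (G ^^ m) d - (G ^^ m) a" for m
    have ad: "a < d" using abcd by simp
    have less: "(G ^^ m) a < (G ^^ m) b" "(G ^^ m) b < (G ^^ m) c'" "(G ^^ m) c' < (G ^^ m) d" for m
      using abcd iter_less by auto
    have B: "0 < B m" for m unfolding B_def using less by (rule cross_ratio_pos)
    have T: "0 \<le> T m" for m using iter_less[OF ad, of m] by (simp add: T_def)
    have step: "(1 - \<eta> * T m) * B m \<le> B (Suc m)" if "p \<le> m" "m < q" for m
    proof -
      have "T m \<le> \<delta>0" using small[of m] by (simp add: T_def \<delta>_def)
      then show ?thesis
        using \<delta>0(2)[OF less] crit that unfolding B_def T_def by simp
    qed
    have "p + i \<le> q \<Longrightarrow> (1 - \<eta> * (\<Sum>m\<in>{p..<p + i}. T m)) * B p \<le> B (p + i)" for i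
    proof (induction i)
      case (Suc i)
      define s where "s = \<eta> * (\<Sum>m\<in>{p..<p + i}. T m)"
      have s: "0 \<le> s" using assms T by (simp add: s_def sum_nonneg)
      have t: "0 \<le> \<eta> * T (p + i)" using assms T by simp
      have "T (p + i) \<le> 1 / \<eta>" using small[of "p + i"] by (simp add: T_def \<delta>_def)
      then have t1: "0 \<le> 1 - \<eta> * T (p + i)" using assms by (simp add: field_simps)
      have "1 - (s + \<eta> * T (p + i)) \<le> (1 - \<eta> * T (p + i)) * (1 - s)"
        using mult_nonneg_nonneg[OF s t] by (simp add: algebra_simps)
      then have "(1 - (s + \<eta> * T (p + i))) * B p \<le> (1 - \<eta> * T (p + i)) * (1 - s) * B p"
        using B[of p] by (intro mult_right_mono) auto
      also have "\<dots> = (1 - \<eta> * T (p + i)) * ((1 - s) * B p)" by simp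
      also have "\<dots> \<le> (1 - \<eta> * T (p + i)) * B (p + i)"
        using Suc t1 unfolding s_def by (intro mult_left_mono) auto
      also have "\<dots> \<le> B (Suc (p + i))" using step[of "p + i"] Suc.prems by simp
      finally show ?case by (simp add: s_def distrib_left)
    qed simp
    from this[of "q - p"] pq have "(1 - \<eta> * (\<Sum>m\<in>{p..<q}. T m)) * B p \<le> B q" by simp
    moreover have "(\<Sum>m\<in>{p..<q}. T m) \<le> (\<Sum>m<n. T m)" using pq T by (intro sum_mono2) auto
    then have "(\<Sum>m\<in>{p..<q}. T m) \<le> 1"
      using sum_iterates_le_1[of a d n] ad had by (simp add: T_def)
    then have "1 - \<eta> \<le> 1 - \<eta> * (\<Sum>m\<in>{p..<q}. T m)" using assms by simp
    then have "(1 - \<eta>) * B p \<le> (1 - \<eta> * (\<Sum>m\<in>{p..<q}. T m)) * B p"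
      using B[of p] by (intro mult_right_mono) auto
    ultimately show "(1 - \<eta>) * cross_ratio ((G ^^ p) a) ((G ^^ p) b) ((G ^^ p) c') ((G ^^ p) d)
        \<le> cross_ratio ((G ^^ q) a) ((G ^^ q) b) ((G ^^ q) c') ((G ^^ q) d)"
      unfolding B_def by linarith
  qed
qed

text \<open>The multiple D is fixed before the scale t, so at small scales the error is a small
  fraction of t even for points D t away from x0.\<close>

lemma near_affine:
  assumes "0 < \<kappa>" "0 < \<zeta>" "0 < D"
    and deriv: "((\<lambda>y. (h (x0 + y) - h x0) / y) \<longlongrightarrow> \<kappa>) (at_right 0)"
  obtains \<sigma> where "0 < \<sigma>" "\<And>t y. t < \<sigma> \<Longrightarrow> h x0 < h y \<Longrightarrow> h y \<le> h x0 + D * t \<Longrightarrow>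
    \<bar>\<kappa> * (y - x0) - (h y - h x0)\<bar> \<le> \<zeta> * t"
proof -
  \<comment> \<open>The entry \<kappa>/2 gives y - x0 at most 2 D t/\<kappa>; the second entry then
    bounds the error by \<zeta> t.\<close>
  define e where "e = min (\<kappa> / 2) (\<zeta> * \<kappa> / (2 * D))"
  have e: "0 < e" "e \<le> \<kappa> / 2" "e \<le> \<zeta> * \<kappa> / (2 * D)" using assms by (auto simp: e_def)
  obtain d where d: "0 < d" "\<And>y. 0 < y \<Longrightarrow> y < d \<Longrightarrow> \<bar>(h (x0 + y) - h x0) / y - \<kappa>\<bar> < e"
    using deriv e(1) unfolding tendsto_at_right_0_iff by blast
  obtain \<tau> where \<tau>: "0 < \<tau>" "\<And>a d'. h d' - h a < \<tau> \<Longrightarrow> d' - a < d" using h_uniform[OF d(1)] by blast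
  show thesis
  proof (rule that[of "\<tau> / D"])
    show "0 < \<tau> / D" using \<tau> assms by simp
    fix t y assume t: "t < \<tau> / D" and y: "h x0 < h y" "h y \<le> h x0 + D * t"
    define Y where "Y = y - x0"
    have Y0: "0 < Y" using h_less_imp_less[OF y(1)] by (simp add: Y_def)
    have "D * t < \<tau>" using t assms(3) by (simp add: field_simps)
    then have Yd: "Y < d" using \<tau>(2)[of y x0] y by (simp add: Y_def)
    have "\<bar>(h y - h x0) / Y - \<kappa>\<bar> < e" using d(2)[OF Y0 Yd] by (simp add: Y_def)
    moreover have "(h y - h x0) / Y - \<kappa> = ((h y - h x0) - \<kappa> * Y) / Y" using Y0 by (simp add: field_simps)
    ultimately have err: "\<bar>(h y - h x0) - \<kappa> * Y\<bar> \<le> e * Y" using Y0 by (simp add: field_simps)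
    have "\<kappa> / 2 * Y \<le> (\<kappa> - e) * Y" using e Y0 by (intro mult_right_mono) auto
    also have "\<dots> \<le> h y - h x0" using err by (simp add: algebra_simps abs_le_iff)
    also have "\<dots> \<le> D * t" using y by simp
    finally have "Y \<le> 2 * D * t / \<kappa>" using assms(1) by (simp add: field_simps)
    then have "e * Y \<le> (\<zeta> * \<kappa> / (2 * D)) * (2 * D * t / \<kappa>)"
      using e Y0 by (intro mult_mono) auto
    also have "\<dots> = \<zeta> * t" using assms by simp
    finally show "\<bar>\<kappa> * (y - x0) - (h y - h x0)\<bar> \<le> \<zeta> * t" using err by (simp add: Y_def abs_minus_commute)
  qed
qed

text \<open>
  If \<open>h\<close> had a positive one-sided derivative at \<open>x0\<close>, then small quadruples near \<open>x0\<close> that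
  are equidistant in the \<open>h\<close>-coordinate would have cross-ratio close to \<open>3\<close>.  Constant type provides an
  orbit segment that starts and ends near \<open>x0\<close> and meets the critical point exactly once, at
  the second of five \<open>h\<close>-equidistant points \<open>a < s < b < c' < d\<close>.  Cross-ratios are almost nondecreasing along the
  segment: for \<open>(a, s, b, c')\<close> after the passage this forces the images of \<open>b\<close> and \<open>c'\<close> apart at a definite relative
  distance from the critical value, and then \<open>(s, b, c', d)\<close> gains a definite factor.
\<close>

lemma no_positive_right_derivative:
  assumes "0 < \<kappa>"
    and deriv: "((\<lambda>y. (h (x0 + y) - h x0) / y) \<longlongrightarrow> \<kappa>) (at_right 0)"
  shows False
proof -
  obtain \<delta>0 where \<delta>0: "0 < \<delta>0" "\<And>a b c' d n p q. a < b \<Longrightarrow> b < c' \<Longrightarrow> c' < d \<Longrightarrow> h d - h a < c / real n \<Longrightarrow>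
    (\<And>m. (G ^^ m) d - (G ^^ m) a \<le> \<delta>0) \<Longrightarrow> p \<le> q \<Longrightarrow> q \<le> n \<Longrightarrow>
    (\<And>m k. p \<le> m \<Longrightarrow> m < q \<Longrightarrow> \<not> ((G ^^ m) a < of_int k \<and> of_int k < (G ^^ m) d)) \<Longrightarrow>
    (1 - 1 / 100) * cross_ratio ((G ^^ p) a) ((G ^^ p) b) ((G ^^ p) c') ((G ^^ p) d)
    \<le> cross_ratio ((G ^^ q) a) ((G ^^ q) b) ((G ^^ q) c') ((G ^^ q) d)"
    using cross_ratio_iterates[of "1 / 100"] by (metis zero_less_divide_1_iff zero_less_numeral)
  define \<delta> where "\<delta> = min \<delta>0 (r / 2)"
  have \<delta>: "0 < \<delta>" "\<delta> \<le> \<delta>0" "\<delta> < r" using \<delta>0 r by (auto simp: \<delta>_def)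
  obtain \<tau> where \<tau>: "0 < \<tau>" "\<And>a d. h d - h a < \<tau> \<Longrightarrow> d - a < \<delta>" using h_uniform[OF \<delta>(1)] by blast
  define C where "C = 1 + 1 / c"
  have C: "1 \<le> C" using c_bounds by (simp add: C_def)
  \<comment> \<open>With l and g below, D l = 7 g. All points compared lie within 6 g + 3 l of x0 in
    the \<open>h\<close>-coordinate, and 10 l is at most g.\<close>
  define D where "D = 70 * C / c"
  have D: "0 < D" using C c_bounds by (simp add: D_def)
  obtain \<sigma> where \<sigma>: "0 < \<sigma>" "\<And>t y. t < \<sigma> \<Longrightarrow> h x0 < h y \<Longrightarrow> h y \<le> h x0 + D * t \<Longrightarrow>
    \<bar>\<kappa> * (y - x0) - (h y - h x0)\<bar> \<le> 1 / 1000 * t"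
    using near_affine[OF assms(1) _ D deriv, of "1 / 1000"] by (metis zero_less_divide_1_iff zero_less_numeral)
  define \<mu> where "\<mu> = min \<sigma> (\<tau> / 4)"
  have \<mu>: "0 < \<mu>" using \<sigma> \<tau> by (simp add: \<mu>_def)
  obtain N :: nat where N: "c / (10 * \<mu>) < real N" using reals_Archimedean2 by blast
  have "0 < c / (10 * \<mu>)" using c_bounds \<mu> by simp
  then have N0: "0 < real N" using N by linarith
  then have N0': "0 < N" by simp
  \<comment> \<open>Five points at \<open>h\<close>-spacing l span 4 c/(10 N), which is less than
    c/(2 N), so the first 2 N images are disjoint.\<close>
  define l where "l = c / (10 * real N)"
  have l: "0 < l" "l < \<mu>" using N N0 c_bounds \<mu> by (simp_all add: l_def field_simps)
  define g where "g = C / real N"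
  have g0: "0 < g" using C N0 by (simp add: g_def)
  have lg: "10 * l \<le> g" using C c_bounds N0 by (simp add: l_def g_def divide_right_mono)
  have Dl: "D * l = 7 * g" using c_bounds N0 by (simp add: D_def l_def g_def)
  have l4: "4 * l < c / real (2 * N)" using c_bounds N0 by (simp add: l_def field_simps)
  have cover: "\<exists>k n. k < N \<and> \<bar>real k * \<alpha> + of_int n - \<theta>\<bar> \<le> g" for \<theta>
    using badly_approximable_covering[OF bad N0', of \<theta>] by (simp add: C_def g_def)
  \<comment> \<open>Time i takes a point at about x0 + 4 g in the \<open>h\<close>-coordinate to the
    critical point. The offset leaves room for errors of g here and at the return, so that every
    point used stays to the right of x0, where the derivative is known.\<close>
  obtain i n where i: "i < N" "\<bar>real i * \<alpha> + of_int n - (h 0 - (h x0 + 4 * g))\<bar> \<le> g"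
    using cover by blast
  obtain k p where k: "k < N" "\<bar>real k * \<alpha> + of_int p - (- (real N * \<alpha>))\<bar> \<le> g"
    using cover by blast
  \<comment> \<open>Since N + k is at least N and i < N, the return comes after the critical
    passage.\<close>
  define j where "j = N + k"
  have j: "Suc i \<le> j" "j \<le> 2 * N" "\<bar>real j * \<alpha> + of_int p\<bar> \<le> g"
    using i(1) k by (simp_all add: j_def algebra_simps)
  obtain s where s: "(G ^^ i) s = of_int (- n)" using iter_surj .
  have hs: "h s = h 0 - real i * \<alpha> - of_int n"
    using h_iter[of i s] h_int[of "- n"] s by simp
  then have hs_range: "h x0 + 3 * g \<le> h s" "h s \<le> h x0 + 5 * g" using i(2) by linarith+
  obtain a where a: "h a = h s - l" using h_surj .
  obtain b where b: "h b = h s + l" using h_surj .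
  obtain c' where c': "h c' = h s + 2 * l" using h_surj .
  obtain d where d: "h d = h s + 3 * l" using h_surj .
  have ord: "a < s" "s < b" "b < c'" "c' < d"
    using a b c' d l h_less_imp_less by auto
  have short: "(G ^^ m) y - (G ^^ m) x \<le> \<delta>" if "a \<le> x" "y \<le> d" for m x y
  proof -
    have "h ((G ^^ m) y) - h ((G ^^ m) x) < \<tau>"
      using h_le[OF that(1)] h_le[OF that(2)] a d l unfolding h_iter by (simp add: \<mu>_def)
    then show ?thesis using \<tau>(2) less_imp_le by blast
  qed
  have had: "h d - h a < c / real (2 * N)" using a d l4 by simp
  have crit: "\<not> ((G ^^ m) x < of_int q \<and> of_int q < (G ^^ m) y)"
    if "a \<le> x" "y \<le> d" "m < 2 * N" "m \<noteq> i" for m q x y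
  proof
    assume "(G ^^ m) x < of_int q \<and> of_int q < (G ^^ m) y"
    then have "(G ^^ m) a \<le> of_int q" "of_int q \<le> (G ^^ m) d"
      using iter_le[OF that(1), of m] iter_le[OF that(2), of m] by linarith+
    moreover have "(G ^^ i) a \<le> of_int (- n)" "of_int (- n) \<le> (G ^^ i) d"
      using iter_le[of a s i] iter_le[of s d i] ord s by simp_all
    ultimately have "m = i"
      using translates_disjoint[OF had that(3), of i "- q" 0 n] i(1) by simp
    then show False using that by simp
  qed
  define cr where "cr m x y z w = cross_ratio ((G ^^ m) x) ((G ^^ m) y) ((G ^^ m) z) ((G ^^ m) w)" for m x y z w
  have monotone: "99 / 100 * cr m x y z w \<le> cr m' x y z w"
    if "a \<le> x" "x < y" "y < z" "z < w" "w \<le> d" "m \<le> m'" "m' \<le> 2 * N"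
      and "\<And>m''. m \<le> m'' \<Longrightarrow> m'' < m' \<Longrightarrow> m'' \<noteq> i" for m m' x y z w
  proof -
    have "(1 - 1 / 100) * cr m x y z w \<le> cr m' x y z w"
      unfolding cr_def
    proof (rule \<delta>0(2)[OF that(2-4) _ _ that(6,7)])
      show "h w - h x < c / real (2 * N)" using h_le[OF that(1)] h_le[OF that(5)] had by linarith
      show "(G ^^ m) w - (G ^^ m) x \<le> \<delta>0" for m using short[OF that(1,5), of m] \<delta> by simp
      show "\<not> ((G ^^ m'') x < of_int q \<and> of_int q < (G ^^ m'') w)" if "m \<le> m''" "m'' < m'" for m'' q
        using crit[of x w m'' q] that \<open>a \<le> x\<close> \<open>w \<le> d\<close> \<open>m' \<le> 2 * N\<close>
          \<open>\<And>m''. m \<le> m'' \<Longrightarrow> m'' < m' \<Longrightarrow> m'' \<noteq> i\<close>[of m''] by simp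
    qed
    then show ?thesis by simp
  qed
  have affine: "297 / 100 \<le> cr m x y z w \<and> cr m x y z w \<le> 303 / 100"
    if eqd: "h y = h x + l" "h z = h x + 2 * l" "h w = h x + 3 * l" and x: "h s - l \<le> h x" "h x \<le> h s"
      and m: "\<bar>real m * \<alpha> + of_int q\<bar> \<le> g" for m q x y z w
  proof -
    \<comment> \<open>An affine change of coordinate, under which cross-ratios are invariant; the
      values are within l/1000 of the \<open>h\<close>-coordinates.\<close>
    define pos where "pos x = \<kappa> * ((G ^^ m) x + of_int q - x0)" for x
    have pos: "\<bar>pos y - (h y + real m * \<alpha> + of_int q - h x0)\<bar> \<le> 1 / 1000 * l"
      if y: "h s - l \<le> h y" "h y \<le> h s + 3 * l" for y
    proof -
      have eq: "h ((G ^^ m) y + of_int q) = h y + real m * \<alpha> + of_int q" by (simp add: h_shift h_iter)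
      have "\<bar>\<kappa> * ((G ^^ m) y + of_int q - x0) - (h ((G ^^ m) y + of_int q) - h x0)\<bar> \<le> 1 / 1000 * l"
      proof (rule \<sigma>(2))
        show "l < \<sigma>" using l by (simp add: \<mu>_def)
        show "h x0 < h ((G ^^ m) y + of_int q)" unfolding eq using y m hs_range g0 lg l by linarith
        show "h ((G ^^ m) y + of_int q) \<le> h x0 + D * l" unfolding eq Dl using y m hs_range g0 lg l by linarith
      qed
      then show ?thesis unfolding eq pos_def .
    qed
    have px: "\<bar>pos x - (h x + real m * \<alpha> + of_int q - h x0)\<bar> \<le> 1 / 1000 * l"
      and py: "\<bar>pos y - (h x + l + real m * \<alpha> + of_int q - h x0)\<bar> \<le> 1 / 1000 * l"
      and pz: "\<bar>pos z - (h x + 2 * l + real m * \<alpha> + of_int q - h x0)\<bar> \<le> 1 / 1000 * l"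
      and pw: "\<bar>pos w - (h x + 3 * l + real m * \<alpha> + of_int q - h x0)\<bar> \<le> 1 / 1000 * l"
      using pos[of x] pos[of y] pos[of z] pos[of w] eqd x l by simp_all
    have "297 / 100 \<le> cross_ratio (pos x) (pos y) (pos z) (pos w)"
      "cross_ratio (pos x) (pos y) (pos z) (pos w) \<le> 303 / 100"
      using px py pz pw by (intro cross_ratio_equidistant[OF l(1)]; linarith)+
    moreover have "cross_ratio (pos x) (pos y) (pos z) (pos w) = cr m x y z w"
    proof -
      have "pos y - pos x = \<kappa> * ((G ^^ m) y - (G ^^ m) x)" for x y
        by (simp add: pos_def algebra_simps)
      then show ?thesis unfolding cross_ratio_def cr_def using assms(1) by (simp add: mult_ac)
    qed
    ultimately show ?thesis by simp
  qed
  define U V W where "U = (G ^^ i) b + n" and "V = (G ^^ i) c' + n" and "W = (G ^^ i) d + n"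
  have UVW: "0 < U" "U < V" "V < W"
    using iter_less[OF ord(2), of i] iter_less[OF ord(3), of i] iter_less[OF ord(4), of i] s
    by (simp_all add: U_def V_def W_def)
  have "W < r" using short[of s d i] s ord \<delta>(3) by (simp add: W_def)
  then have GU: "G ((G ^^ i) s) = e - n" "G ((G ^^ i) b) = U ^ 3 + e - n" "G ((G ^^ i) c') = V ^ 3 + e - n"
    "G ((G ^^ i) d) = W ^ 3 + e - n"
    using UVW G_cubic[of "(G ^^ i) b" "- n"] G_cubic[of "(G ^^ i) c'" "- n"] G_cubic[of "(G ^^ i) d" "- n"]
      G_cubic[of "(G ^^ i) s" "- n"] s r by (simp_all add: U_def V_def W_def)
  have "V ^ 3 - U ^ 3 > 0" using UVW by (simp add: power_strict_mono)
  \<comment> \<open>After the passage s sits at the critical value, and b and c' at distances U^3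
    and V^3 from it. The ratio of the middle to the right interval of (a, s, b, c') is a lower bound
    for its cross-ratio, which is controlled at the return.\<close>
  have "U ^ 3 / (V ^ 3 - U ^ 3) = (G ((G ^^ i) b) - G ((G ^^ i) s)) / (G ((G ^^ i) c') - G ((G ^^ i) b))"
    by (simp add: GU)
  also have "\<dots> \<le> cr (Suc i) a s b c'"
    using cross_ratio_ge_right[of "G ((G ^^ i) a)" "G ((G ^^ i) s)" "G ((G ^^ i) b)" "G ((G ^^ i) c')"]
      ord iter_less G_less by (simp add: cr_def)
  finally have 1: "U ^ 3 / (V ^ 3 - U ^ 3) \<le> cr (Suc i) a s b c'" .
  have "99 / 100 * cr (Suc i) a s b c' \<le> cr j a s b c'" using ord j by (intro monotone) auto
  also have "\<dots> \<le> 303 / 100" using affine[of s a b c' j p] j(3) a b c' l by simp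
  finally have "U ^ 3 / (V ^ 3 - U ^ 3) \<le> 31 / 10" using 1 by simp
  \<comment> \<open>The bound 303/99 was rounded up to 31/10; the resulting factor 41/31 exceeds the
    cube of 21/20.\<close>
  then have "41 / 31 * U ^ 3 \<le> V ^ 3" using \<open>V ^ 3 - U ^ 3 > 0\<close> by (simp add: pos_divide_le_eq)
  moreover have "(21 / 20 * U) ^ 3 = 9261 / 8000 * U ^ 3" by (simp add: power_mult_distrib power_divide)
  moreover have "0 < U ^ 3" using UVW by simp
  ultimately have "(21 / 20 * U) ^ 3 \<le> V ^ 3" by linarith
  then have UV: "21 / 20 * U \<le> V" using UVW by (simp add: power_mono_iff)
  have "21 / 20 * cross_ratio 0 U V W \<le> cross_ratio 0 (U ^ 3) (V ^ 3) (W ^ 3)"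
    by (rule cross_ratio_cube_gain[OF UVW(1) UV UVW(3)])
  also have "\<dots> = cr (Suc i) s b c' d" by (simp add: cr_def cross_ratio_def GU)
  also have "cross_ratio 0 U V W = cr i s b c' d" by (simp add: cr_def cross_ratio_def U_def V_def W_def s)
  finally have gain: "21 / 20 * cr i s b c' d \<le> cr (Suc i) s b c' d" .
  \<comment> \<open>Together these would require 297/100 * (99/100)^2 * 21/20, which is about 3.056,
    to be at most 303/100.\<close>
  have "99 / 100 * cr 0 s b c' d \<le> cr i s b c' d" using ord i by (intro monotone) auto
  moreover have "99 / 100 * cr (Suc i) s b c' d \<le> cr j s b c' d" using ord j by (intro monotone) auto
  moreover have "297 / 100 \<le> cr 0 s b c' d" using affine[of b s c' d 0 0] b c' d l g0 by simp
  moreover have "cr j s b c' d \<le> 303 / 100" using affine[of b s c' d j p] j(3) b c' d l by simp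
  ultimately show False using gain by simp
qed

end

section \<open>Absolutely continuous invariant measures\<close>

text \<open>Exhaustion: the union of sets whose measures approach the supremum attains it.\<close>

lemma (in finite_measure) obtain_maximal_set:
  assumes sub: "S \<subseteq> sets M" and empty: "{} \<in> S"
    and union: "\<And>A :: nat \<Rightarrow> 'a set. range A \<subseteq> S \<Longrightarrow> (\<Union>n. A n) \<in> S"
  obtains N where "N \<in> S" "\<And>A. A \<in> S \<Longrightarrow> measure M A \<le> measure M N"
proof -
  define s where "s = (SUP A\<in>S. measure M A)"
  have bdd: "bdd_above (measure M ` S)" by (intro bdd_aboveI[of _ "measure M (space M)"]) (auto intro: bounded_measure)
  have "\<exists>A\<in>S. s - 1 / real (Suc n) < measure M A" for n
  proof -
    have "s - 1 / real (Suc n) < s" by simp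
    then show ?thesis
      unfolding s_def using less_cSUP_iff[OF _ bdd, of "s - 1 / real (Suc n)"] empty
      by (auto simp: s_def)
  qed
  then obtain A where A: "\<And>n. A n \<in> S" "\<And>n. s - 1 / real (Suc n) < measure M (A n)" by metis
  have UA: "(\<Union>n. A n) \<in> S" using A(1) by (intro union) auto
  have le: "s - 1 / real (Suc n) \<le> measure M (\<Union>n. A n)" for n
  proof -
    have "measure M (A n) \<le> measure M (\<Union>n. A n)"
      using UA sub by (intro finite_measure_mono) auto
    then show ?thesis using A(2)[of n] by linarith
  qed
  have "s \<le> measure M (\<Union>n. A n)"
  proof (rule field_le_epsilon)
    fix e :: real assume "0 < e"
    then obtain n where "1 / real (Suc n) < e" using reals_Archimedean[of e] by (auto simp: inverse_eq_divide)
    then show "s \<le> measure M (\<Union>n. A n) + e" using le[of n] by linarith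
  qed
  moreover have "measure M B \<le> s" if "B \<in> S" for B
    unfolding s_def using bdd that by (rule cSUP_upper2[OF _ _ order_refl])
  ultimately show thesis using that[OF UA] by force
qed

text \<open>
  Remove from \<open>\<mu>\<close> a Lebesgue null set \<open>N\<close> of maximal \<open>\<mu>\<close>-measure.  The preimage of \<open>N\<close> is also
  null and has the same \<open>\<mu>\<close>-measure, so by maximality it agrees with \<open>N\<close> up to a \<open>\<mu>\<close>-null set;
  hence the remaining absolutely continuous measure is invariant.
\<close>

lemma absolutely_continuous_invariant_part:
  assumes \<mu>: "circle_prob_measure \<mu>" and inv: "invariant_measure T \<mu>"
    and nonsing: "\<And>A. A \<in> null_sets lborel \<Longrightarrow> A \<subseteq> {0..<1} \<Longrightarrow> negligible {x \<in> {0..<1}. T x \<in> A}"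
    and not_singular: "\<not> mutually_singular \<mu> circle_lebesgue"
  obtains M :: "real measure" where "finite_borel_measure M" "absolutely_continuous lborel M"
    "0 < measure M {0..<1}" "emeasure M (- {0..<1}) = 0"
    "\<And>A. A \<in> sets borel \<Longrightarrow> A \<subseteq> {0..<1} \<Longrightarrow> measure M {x \<in> {0..<1}. T x \<in> A} = measure M A"
proof -
  interpret prob_space \<mu> using \<mu> by (simp add: circle_prob_measure_def)
  have sets_\<mu>: "sets \<mu> = sets (restrict_space borel {0..<1})"
    using \<mu> by (simp add: circle_prob_measure_def)
  have space_\<mu>: "space \<mu> = {0..<1}"
    using sets_eq_imp_space_eq[OF sets_\<mu>] by (simp add: space_restrict_space)
  have in_sets: "A \<in> sets \<mu> \<longleftrightarrow> A \<in> sets borel \<and> A \<subseteq> {0..<1}" for A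
    unfolding sets_\<mu> by (subst sets_restrict_space_iff) auto
  have T: "T \<in> measurable \<mu> \<mu>" and dist: "distr \<mu> \<mu> T = \<mu>"
    using inv by (auto simp: invariant_measure_def)
  define pre where "pre A = {x \<in> {0..<1}. T x \<in> A}" for A
  have pre_eq: "pre A = T -` A \<inter> space \<mu>" for A by (auto simp: pre_def space_\<mu>)
  have pre_sets: "pre A \<in> sets \<mu>" if "A \<in> sets \<mu>" for A
    unfolding pre_eq using T that by (rule measurable_sets)
  have pre_measure: "measure \<mu> (pre A) = measure \<mu> A" if "A \<in> sets \<mu>" for A
    using measure_distr[OF T that] dist by (simp add: pre_eq)
  define S where "S = {A \<in> sets \<mu>. A \<in> null_sets lborel}"
  have "S \<subseteq> sets \<mu>" "{} \<in> S" by (auto simp: S_def)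
  moreover have "(\<Union>n. A n) \<in> S" if "range A \<subseteq> S" for A :: "nat \<Rightarrow> real set"
    using that unfolding S_def by (auto intro!: sets.countable_UN null_sets_UN)
  ultimately obtain N where N: "N \<in> S" and max: "\<And>A. A \<in> S \<Longrightarrow> measure \<mu> A \<le> measure \<mu> N"
    by (rule obtain_maximal_set) blast+
  have Ns: "N \<in> sets \<mu>" "N \<in> null_sets lborel" using N by (auto simp: S_def)
  have N': "pre N \<in> S"
  proof -
    have "negligible (pre N)" using nonsing[OF Ns(2)] Ns(1) in_sets by (simp add: pre_def)
    then have "pre N \<in> null_sets lborel"
      using pre_sets[OF Ns(1)] in_sets by (simp add: negligible_iff_null_sets null_sets_completion_iff)
    then show ?thesis using pre_sets[OF Ns(1)] by (simp add: S_def)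
  qed
  have "N \<union> pre N \<in> S" using N N' by (auto simp: S_def)
  then have union_le: "measure \<mu> (N \<union> pre N) \<le> measure \<mu> N" by (rule max)
  have pre_diff: "measure \<mu> (pre N - N) = 0"
  proof -
    have "measure \<mu> (N \<union> (pre N - N)) = measure \<mu> N + measure \<mu> (pre N - N)"
      using Ns pre_sets[OF Ns(1)] by (intro finite_measure_Union) auto
    moreover have eq: "N \<union> (pre N - N) = N \<union> pre N" by auto
    ultimately show ?thesis using union_le measure_nonneg[of \<mu> "pre N - N"] unfolding eq by linarith
  qed
  have diff_pre: "measure \<mu> (N - pre N) = 0"
  proof -
    have "measure \<mu> (pre N \<union> (N - pre N)) = measure \<mu> (pre N) + measure \<mu> (N - pre N)"
      using Ns pre_sets[OF Ns(1)] by (intro finite_measure_Union) auto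
    moreover have eq: "pre N \<union> (N - pre N) = N \<union> pre N" by auto
    ultimately show ?thesis
      using union_le pre_measure[OF Ns(1)] measure_nonneg[of \<mu> "N - pre N"] unfolding eq by linarith
  qed
  define \<nu> where "\<nu> = restrict_space \<mu> ({0..<1} - N)"
  \<comment> \<open>Pushing forward to the Borel sets of the whole line makes distribution functions
    and densities available; the total mass is left unnormalised.\<close>
  define M where "M = distr \<nu> borel (\<lambda>x. x)"
  have id: "(\<lambda>x. x) \<in> borel_measurable \<nu>"
    unfolding \<nu>_def
  proof (rule measurable_restrict_space1)
    have "(\<lambda>x::real. x) \<in> borel_measurable (restrict_space borel {0..<1})"
      by (rule measurable_restrict_space1) simp
    then show "(\<lambda>x. x) \<in> borel_measurable \<mu>"
      using measurable_cong_sets[OF sets_\<mu> refl] by blast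
  qed
  have emeasure_M: "emeasure M A = emeasure \<mu> (A \<inter> {0..<1} - N)" if "A \<in> sets borel" for A
  proof -
    have sp: "space \<nu> = {0..<1} - N" by (auto simp: \<nu>_def space_restrict_space space_\<mu>)
    have "emeasure M A = emeasure \<nu> (A \<inter> ({0..<1} - N))"
      unfolding M_def using emeasure_distr[OF id, of A] that sp by simp
    also have "\<dots> = emeasure \<mu> (A \<inter> ({0..<1} - N))"
    proof -
      have "{0..<1} - N \<in> sets \<mu>" using sets.compl_sets[OF Ns(1)] by (simp add: space_\<mu>)
      then show ?thesis
        unfolding \<nu>_def by (intro emeasure_restrict_space) (auto simp: space_\<mu> Int_absorb2 intro: sets.Int)
    qed
    also have "A \<inter> ({0..<1} - N) = A \<inter> {0..<1} - N" by auto
    finally show ?thesis .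
  qed
  have measure_M: "measure M A = measure \<mu> (A - N)" if "A \<in> sets \<mu>" for A
    using emeasure_M[of A] that in_sets[of A] by (simp add: measure_def Int_absorb2)
  have fin: "finite_borel_measure M"
  proof (intro finite_borel_measure.intro finite_borel_measure_axioms.intro finite_measureI)
    have "space M = UNIV" by (simp add: M_def)
    then have "emeasure M (space M) = emeasure \<mu> (UNIV \<inter> {0..<1} - N)" using emeasure_M[of UNIV] by simp
    then show "emeasure M (space M) \<noteq> \<infinity>" by simp
    show "sets M = sets borel" by (simp add: M_def)
  qed
  show thesis
  proof (rule that[OF fin])
    show "absolutely_continuous lborel M"
      unfolding absolutely_continuous_def
    proof
      fix A :: "real set" assume A: "A \<in> null_sets lborel"
      then have Ab: "A \<in> sets borel" by auto
      have "A \<inter> {0..<1} \<in> null_sets lborel" using A by (intro null_set_Int2) auto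
      then have "A \<inter> {0..<1} \<union> N \<in> null_sets lborel" using Ns by (intro null_sets.Un)
      then have "A \<inter> {0..<1} \<union> N \<in> S"
        unfolding S_def using Ns in_sets Ab by auto
      then have le: "measure \<mu> (A \<inter> {0..<1} \<union> N) \<le> measure \<mu> N" by (rule max)
      have As: "A \<inter> {0..<1} \<in> sets \<mu>" using Ab by (simp add: in_sets)
      have "measure \<mu> (N \<union> (A \<inter> {0..<1} - N)) = measure \<mu> N + measure \<mu> (A \<inter> {0..<1} - N)"
        using Ns As by (intro finite_measure_Union) auto
      moreover have eq: "N \<union> (A \<inter> {0..<1} - N) = A \<inter> {0..<1} \<union> N" by auto
      ultimately have "measure \<mu> (A \<inter> {0..<1} - N) = 0"
        using le measure_nonneg[of \<mu> "A \<inter> {0..<1} - N"] unfolding eq by linarith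
      then have "emeasure M A = 0" using emeasure_M[OF Ab] by (simp add: emeasure_eq_measure)
      then show "A \<in> null_sets M" using Ab by (simp add: null_sets_def M_def)
    qed
    show "0 < measure M {0..<1}"
    proof (rule ccontr)
      \<comment> \<open>If nothing remains after the removal, \<mu> is carried by the Lebesgue null
        set N, which is singularity.\<close>
      assume "\<not> 0 < measure M {0..<1}"
      then have "measure M {0..<1} = 0" using measure_nonneg[of M "{0..<1}"] by linarith
      then have "measure \<mu> ({0..<1} - N) = 0" using measure_M[of "{0..<1}"] in_sets[of "{0..<1}"] by simp
      then have 0: "emeasure \<mu> ({0..<1} - N) = 0" by (simp add: emeasure_eq_measure)
      have "mutually_singular \<mu> circle_lebesgue"
        unfolding mutually_singular_def
      proof (intro conjI bexI)
        show "sets \<mu> = sets circle_lebesgue"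
          unfolding sets_\<mu> circle_lebesgue_def by (rule sets_restrict_space_cong) simp
        show "{0..<1} - N \<in> sets \<mu>" using sets.compl_sets[OF Ns(1)] by (simp add: space_\<mu>)
        show "emeasure \<mu> ({0..<1} - N) = 0" by (rule 0)
        have "space circle_lebesgue - ({0..<1} - N) = N"
          using Ns(1) in_sets[of N] by (auto simp: circle_lebesgue_def space_restrict_space)
        then show "emeasure circle_lebesgue (space circle_lebesgue - ({0..<1} - N)) = 0"
          using Ns in_sets[of N] by (simp add: circle_lebesgue_def emeasure_restrict_space null_setsD1)
      qed
      then show False using not_singular by simp
    qed
    show "emeasure M (- {0..<1}) = 0" using emeasure_M[of "- {0..<1}"] by simp
    fix A :: "real set" assume A: "A \<in> sets borel" "A \<subseteq> {0..<1}"
    then have As: "A \<in> sets \<mu>" by (simp add: in_sets)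
    \<comment> \<open>The two sets differ only within the symmetric difference of N and
      \<open>pre N\<close>, and \<open>pre A - pre N\<close> is itself a preimage, so invariance of
      \<mu> applies to it.\<close>
    have "measure \<mu> (pre A - N) = measure \<mu> (pre A - pre N)"
    proof (rule antisym)
      have ps: "pre A \<in> sets \<mu>" "pre N \<in> sets \<mu>" using pre_sets As Ns by auto
      have "measure \<mu> (pre A - N) \<le> measure \<mu> ((pre A - pre N) \<union> (pre N - N))"
        using ps Ns by (intro finite_measure_mono) auto
      also have "\<dots> \<le> measure \<mu> (pre A - pre N) + measure \<mu> (pre N - N)"
        using ps Ns by (intro measure_Un_le) auto
      finally show "measure \<mu> (pre A - N) \<le> measure \<mu> (pre A - pre N)" using pre_diff by simp
      have "measure \<mu> (pre A - pre N) \<le> measure \<mu> ((pre A - N) \<union> (N - pre N))"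
        using ps Ns by (intro finite_measure_mono) auto
      also have "\<dots> \<le> measure \<mu> (pre A - N) + measure \<mu> (N - pre N)"
        using ps Ns by (intro measure_Un_le) auto
      finally show "measure \<mu> (pre A - pre N) \<le> measure \<mu> (pre A - N)" using diff_pre by simp
    qed
    also have "pre A - pre N = pre (A - N)" by (auto simp: pre_def)
    also have "measure \<mu> (pre (A - N)) = measure \<mu> (A - N)" using As Ns by (intro pre_measure) auto
    finally have "measure M (pre A) = measure M A" using measure_M[OF As] measure_M[OF pre_sets[OF As]] by simp
    then show "measure M {x \<in> {0..<1}. T x \<in> A} = measure M A" by (simp add: pre_def)
  qed
qed

section \<open>From an absolutely continuous invariant measure to a semiconjugacy\<close>

lemma floor_plus_frac_continuous:
  fixes H :: "real \<Rightarrow> real"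
  assumes cont: "continuous_on {0..1} H" and "H 1 = H 0 + 1"
  shows "continuous_on UNIV (\<lambda>x. of_int \<lfloor>x\<rfloor> + H (frac x))"
proof -
  let ?h = "\<lambda>x. of_int \<lfloor>x\<rfloor> + H (frac x)"
  have unit: "continuous_on {of_int n..of_int n + 1} ?h" for n
  proof -
    have "continuous_on {of_int n..of_int n + 1} (\<lambda>x. of_int n + H (x - of_int n))"
      by (intro continuous_intros continuous_on_compose2[OF cont]) auto
    then show ?thesis
    proof (rule continuous_on_eq)
      fix x :: real assume that: "x \<in> {of_int n..of_int n + 1}"
      show "of_int n + H (x - of_int n) = ?h x"
      proof (cases "x = of_int n + 1")
        case True
        then have "\<lfloor>x\<rfloor> = n + 1" by simp
        then show ?thesis using True assms(2) by (simp add: frac_def)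
      next
        case False
        then have "\<lfloor>x\<rfloor> = n" using that by (simp add: floor_eq_iff)
        then show ?thesis by (simp add: frac_def)
      qed
    qed
  qed
  have "isCont ?h x" for x
  proof -
    define n where "n = \<lceil>x\<rceil> - 1"
    have x: "of_int n < x" "x \<le> of_int n + 1" unfolding n_def by linarith+
    have "continuous_on ({of_int n..of_int n + 1} \<union> {of_int (n + 1)..of_int (n + 1) + 1}) ?h"
      by (intro continuous_on_closed_Un unit) auto
    moreover have "{of_int n<..<of_int n + 2} \<subseteq> {of_int n..of_int n + 1} \<union> {of_int (n + 1)..of_int (n + 1) + (1::real)}"
      by auto
    ultimately have "continuous_on {of_int n<..<of_int n + 2} ?h" by (rule continuous_on_subset)
    then show ?thesis using x by (simp add: continuous_on_eq_continuous_at)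
  qed
  then show ?thesis by (simp add: continuous_at_imp_continuous_on)
qed

lemma frac_image_Ioc:
  fixes p q :: real
  assumes "p \<le> q" "q \<le> p + 1"
  shows "(\<lfloor>q\<rfloor> = \<lfloor>p\<rfloor> \<and> frac p \<le> frac q \<and> frac ` {p<..q} = {frac p<..frac q}) \<or>
    (\<lfloor>q\<rfloor> = \<lfloor>p\<rfloor> + 1 \<and> frac ` {p<..q} = {frac p<..<1} \<union> {0..frac q})"
proof -
  have frac_floor: "frac x = x - of_int n" if "of_int n \<le> x" "x < of_int n + 1" for x :: real and n
    using that by (simp add: frac_def floor_eq_iff)
  define n where "n = \<lfloor>p\<rfloor>"
  have p: "of_int n \<le> p" "p < of_int n + 1" unfolding n_def by linarith+
  have fp: "frac p = p - of_int n" by (simp add: frac_def n_def)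
  consider "q < of_int n + 1" | "of_int n + 1 \<le> q" by linarith
  then show ?thesis
  proof cases
    case 1
    then have fl: "\<lfloor>q\<rfloor> = n" using p assms by (simp add: floor_eq_iff)
    then have fq: "frac q = q - of_int n" by (simp add: frac_def)
    have "frac ` {p<..q} = (\<lambda>x. x - of_int n) ` {p<..q}"
      using p 1 by (intro image_cong frac_floor) auto
    also have "\<dots> = {p - of_int n<..q - of_int n}" by (auto simp: image_iff intro!: bexI[of _ "_ + of_int n"])
    finally show ?thesis using fl fp fq assms by (simp add: n_def)
  next
    case 2
    then have fl: "\<lfloor>q\<rfloor> = n + 1" using p assms by (simp add: floor_eq_iff)
    then have fq: "frac q = q - of_int (n + 1)" by (simp add: frac_def)
    have "{p<..q} = {p<..<of_int n + 1} \<union> {of_int n + 1..q}" using p 2 by auto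
    then have "frac ` {p<..q} = frac ` {p<..<of_int n + 1} \<union> frac ` {of_int n + 1..q}" by (simp add: image_Un)
    also have "frac ` {p<..<of_int n + 1} = (\<lambda>x. x - of_int n) ` {p<..<of_int n + 1}"
      using p by (intro image_cong frac_floor) auto
    also have "\<dots> = {p - of_int n<..<1}" by (auto simp: image_iff intro!: bexI[of _ "_ + of_int n"])
    also have "frac ` {of_int n + 1..q} = (\<lambda>x. x - of_int (n + 1)) ` {of_int n + 1..q}"
      using p assms by (intro image_cong frac_floor) auto
    also have "\<dots> = {0..q - of_int (n + 1)}" by (auto simp: image_iff intro!: bexI[of _ "_ + of_int (n + 1)"])
    finally show ?thesis using fl fp fq by (simp add: n_def)
  qed
qed

lemma circle_map_vimage_Ioc:
  assumes F: "circle_homeo_lift F" and pq: "p \<le> q" "q \<le> p + 1"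
  shows "{x \<in> {0..<1}. circle_map F x \<in> frac ` {F p<..F q}} = frac ` {p<..q}"
proof -
  have mono: "strict_mono F" and shift: "F (x + of_int n) = F x + of_int n" for x n
    using F periodic_int_shift[of F 1] by (auto simp: circle_homeo_lift_def)
  have frac_iff: "frac x \<in> frac ` A \<longleftrightarrow> (\<exists>n. x + of_int n \<in> A)" for x :: real and A
  proof
    assume "frac x \<in> frac ` A"
    then obtain y where "y \<in> A" "frac x = frac y" by auto
    then have "x + of_int (\<lfloor>y\<rfloor> - \<lfloor>x\<rfloor>) = y" by (simp add: frac_def)
    then show "\<exists>n. x + of_int n \<in> A" using \<open>y \<in> A\<close> by metis
  next
    assume "\<exists>n. x + of_int n \<in> A"
    then obtain n where "x + of_int n \<in> A" ..
    moreover have "frac x = frac (x + of_int n)" by (simp add: frac_def)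
    ultimately show "frac x \<in> frac ` A" by blast
  qed
  have "circle_map F x \<in> frac ` {F p<..F q} \<longleftrightarrow> frac x \<in> frac ` {p<..q}" for x
  proof -
    have "F x + of_int n \<in> {F p<..F q} \<longleftrightarrow> x + of_int n \<in> {p<..q}" for n
      using strict_mono_less[OF mono, of p "x + of_int n"] strict_mono_less_eq[OF mono, of "x + of_int n" q]
      by (simp add: shift)
    then show ?thesis unfolding circle_map_def frac_iff by simp
  qed
  moreover have "frac x = x" if "x \<in> {0..<1}" for x :: real using that by (simp add: frac_eq)
  moreover have "frac x \<in> {0..<1}" for x :: real by (simp add: frac_lt_1)
  ultimately show ?thesis by (auto simp: frac_lt_1)
qed

text \<open>\<open>h\<close> is the normalised distribution function of M, lifted to the line.
  Invariance on arcs gives the semiconjugacy; the derivative comes from the density of M at a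
  Lebesgue point where it is positive, and M has positive mass, so such a point exists.\<close>

lemma absolutely_continuous_semiconjugacy:
  assumes F: "circle_homeo_lift F"
    and M: "finite_borel_measure M" and ac: "absolutely_continuous lborel M"
    and pos: "0 < measure M {0..<1}" and out: "emeasure M (- {0..<1}) = 0"
    and inv: "\<And>A. A \<in> sets borel \<Longrightarrow> A \<subseteq> {0..<1} \<Longrightarrow> measure M {x \<in> {0..<1}. circle_map F x \<in> A} = measure M A"
  obtains h \<tau> \<kappa> x0 where "continuous_on UNIV h" "mono h" "\<And>x. h (x + 1) = h x + 1"
    "\<And>x. h (F x) = h x + \<tau>" "0 < \<kappa>"
    "((\<lambda>y. (h (x0 + y) - h x0) / y) \<longlongrightarrow> \<kappa>) (at_right 0)"
proof -
  interpret M: finite_borel_measure M by (rule M)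
  have [simp]: "sets M = sets borel" by (rule M.M_is_borel)
  have mono_F: "strict_mono F" and shift_F1: "F (x + 1) = F x + 1" for x
    using F by (auto simp: circle_homeo_lift_def)
  have shift_F: "F (x + of_int n) = F x + of_int n" for x n
    using periodic_int_shift[of F 1] shift_F1 by simp
  have null: "measure M A = 0" if "A \<in> null_sets lborel" for A
    using ac that by (auto simp: absolutely_continuous_def measure_def dest!: subsetD)
  have null_singleton: "measure M {x} = 0" for x
    by (rule null) (simp add: countable_imp_null_set_lborel)
  have out': "measure M A = 0" if "A \<in> sets borel" "A \<inter> {0..<1} = {}" for A
  proof -
    have "emeasure M A \<le> emeasure M (- {0..<1})" using that by (intro emeasure_mono) auto
    then show ?thesis using out by (simp add: measure_def)
  qed
  define m where "m = measure M {0..<1}"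
  have m: "0 < m" using pos by (simp add: m_def)
  have cdf_cont: "continuous_on A (cdf M)" for A
    by (intro continuous_at_imp_continuous_on ballI) (simp add: M.isCont_cdf null_singleton)
  have cdf_0: "cdf M 0 = 0"
  proof -
    have "measure M {..0} \<le> measure M ({..<0} \<union> {0})" by (intro M.finite_measure_mono) auto
    also have "\<dots> \<le> measure M {..<0} + measure M {0}" by (intro measure_Un_le) auto
    also have "\<dots> = 0" using out'[of "{..<0}"] null_singleton[of 0] by fastforce
    finally show ?thesis unfolding cdf_def by (simp add: measure_le_0_iff)
  qed
  have cdf_1: "cdf M 1 = m"
  proof -
    have "cdf M 1 - cdf M 0 = measure M {0<..1}" by (rule M.cdf_diff_eq) simp
    also have "\<dots> = m"
    proof (rule antisym)
      have "measure M {0<..1} \<le> measure M ({0..<1} \<union> {1})" by (intro M.finite_measure_mono) auto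
      also have "\<dots> \<le> measure M {0..<1} + measure M {1}" by (intro measure_Un_le) auto
      finally show "measure M {0<..1} \<le> m" using null_singleton[of 1] by (simp add: m_def)
      have "measure M {0..<1} \<le> measure M ({0<..1} \<union> {0})" by (intro M.finite_measure_mono) auto
      also have "\<dots> \<le> measure M {0<..1} + measure M {0}" by (intro measure_Un_le) auto
      finally show "m \<le> measure M {0<..1}" using null_singleton[of 0] by (simp add: m_def)
    qed
    finally show ?thesis using cdf_0 by simp
  qed
  have Ioc: "measure M {x<..y} = cdf M y - cdf M x" if "x \<le> y" for x y
    using M.cdf_diff_eq[of x y] that by (cases "x = y") auto
  define h where "h x = of_int \<lfloor>x\<rfloor> + cdf M (frac x) / m" for x
  have h_cont: "continuous_on UNIV h"
    unfolding h_def[abs_def]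
    by (rule floor_plus_frac_continuous[of "\<lambda>x. cdf M x / m"])
       (use m cdf_0 cdf_1 in \<open>auto intro!: continuous_intros cdf_cont\<close>)
  have h_shift: "h (x + 1) = h x + 1" for x by (simp add: h_def frac_def)
  \<comment> \<open>Crossing an integer adds 1 through the floor, which compensates the drop of the
    distribution function by its total mass m; so increments of \<open>h\<close> are normalised
    masses of arcs in both cases.\<close>
  have h_diff: "h q - h p = measure M (frac ` {p<..q}) / m" and Ioc_borel: "frac ` {p<..q} \<in> sets borel"
    if pq: "p \<le> q" "q \<le> p + 1" for p q
  proof -
    show "frac ` {p<..q} \<in> sets borel" using frac_image_Ioc[OF pq] by auto
    consider (same) "\<lfloor>q\<rfloor> = \<lfloor>p\<rfloor>" "frac p \<le> frac q" "frac ` {p<..q} = {frac p<..frac q}"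
      | (next_unit) "\<lfloor>q\<rfloor> = \<lfloor>p\<rfloor> + 1" "frac ` {p<..q} = {frac p<..<1} \<union> {0..frac q}"
      using frac_image_Ioc[OF pq] by blast
    then show "h q - h p = measure M (frac ` {p<..q}) / m"
    proof cases
      case same
      then show ?thesis using Ioc[of "frac p" "frac q"] by (simp add: h_def diff_divide_distrib)
    next
      case next_unit
      have lt: "frac q \<le> frac p" using next_unit(1) pq by (simp add: frac_def)
      have 1: "measure M {frac p<..<1} = m - cdf M (frac p)"
      proof -
        have "measure M ({frac p<..<1} \<union> {1}) = measure M {frac p<..<1} + measure M {1}"
          by (intro M.finite_measure_Union) auto
        moreover have "{frac p<..<1} \<union> {1} = {frac p<..1}" using frac_lt_1[of p] by auto
        ultimately show ?thesis
          using Ioc[of "frac p" 1] frac_lt_1[of p] null_singleton[of 1] cdf_1 by simp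
      qed
      have 2: "measure M {0..frac q} = cdf M (frac q)"
      proof -
        have "measure M ({0} \<union> {0<..frac q}) = measure M {0} + measure M {0<..frac q}"
          by (intro M.finite_measure_Union) auto
        moreover have "{0} \<union> {0<..frac q} = {0..frac q}" by auto
        ultimately show ?thesis using Ioc[of 0 "frac q"] null_singleton[of 0] cdf_0 by simp
      qed
      have "measure M ({frac p<..<1} \<union> {0..frac q}) = measure M {frac p<..<1} + measure M {0..frac q}"
        using lt by (intro M.finite_measure_Union) auto
      then have "measure M (frac ` {p<..q}) = m - cdf M (frac p) + cdf M (frac q)"
        unfolding next_unit 1 2 .
      then show ?thesis using m next_unit(1) by (simp add: h_def add_divide_distrib diff_divide_distrib)
    qed
  qed
  have h_conj: "h (F q) - h (F p) = h q - h p" if pq: "p \<le> q" "q \<le> p + 1" for p q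
  proof -
    have Fpq: "F p \<le> F q" "F q \<le> F p + 1"
      using strict_mono_less_eq[OF mono_F, of p q] strict_mono_less_eq[OF mono_F, of q "p + 1"] shift_F1 pq
      by auto
    have "frac ` {F p<..F q} \<subseteq> {0..<1}" by (auto simp: frac_lt_1)
    then show ?thesis
      using h_diff[OF Fpq] h_diff[OF pq] inv[OF Ioc_borel[OF Fpq]] circle_map_vimage_Ioc[OF F pq] by simp
  qed
  have h_shift': "h (x + of_int n) = h x + of_int n" for x n
    using periodic_int_shift[of h 1] h_shift by simp
  define \<tau> where "\<tau> = h (F 0) - h 0"
  have conj: "h (F x) = h x + \<tau>" for x
  proof -
    have "h (F (frac x)) - h (F 0) = h (frac x) - h 0" by (intro h_conj) (auto simp: frac_lt_1 less_imp_le)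
    moreover have "h (F x) = h (F (frac x)) + of_int \<lfloor>x\<rfloor>"
      using shift_F[of "frac x" "\<lfloor>x\<rfloor>"] h_shift'[of "F (frac x)" "\<lfloor>x\<rfloor>"] by (simp add: frac_def)
    moreover have "h x = h (frac x) + of_int \<lfloor>x\<rfloor>"
      using h_shift'[of "frac x" "\<lfloor>x\<rfloor>"] by (simp add: frac_def)
    ultimately show ?thesis by (simp add: \<tau>_def)
  qed
  have mono_unit: "h p \<le> h q" if "p \<le> q" "q \<le> p + 1" for p q
    using h_diff[OF that] m by (simp add: measure_nonneg divide_nonneg_pos) (smt (verit) divide_nonneg_pos measure_nonneg)
  have mono: "mono h"
  proof
    fix p q :: real assume pq: "p \<le> q"
    define n where "n = \<lfloor>q - p\<rfloor>"
    have n: "0 \<le> n" "p + of_int n \<le> q" "q \<le> p + of_int n + 1" using pq unfolding n_def by auto linarith+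
    then have "h (p + of_int n) \<le> h q" by (intro mono_unit)
    then show "h p \<le> h q" using n(1) by (simp add: h_shift')
  qed
  obtain D where D: "D \<in> borel_measurable lborel" "AE x in lborel. RN_deriv lborel M x = ennreal (D x)"
    "AE x in M. 0 < D x" "\<And>x. 0 \<le> D x"
    using sigma_finite_measure.real_RN_deriv[OF sigma_finite_lborel M.finite_measure_axioms ac] by (metis M.M_is_borel sets_lborel)
  have dens: "density lborel (\<lambda>x. ennreal (D x)) = M"
  proof -
    have "density lborel (RN_deriv lborel M) = M"
      using sigma_finite_measure.density_RN_deriv[OF sigma_finite_lborel ac] by simp
    moreover have "density lborel (RN_deriv lborel M) = density lborel (\<lambda>x. ennreal (D x))"
      using D by (intro density_cong) auto
    ultimately show ?thesis by simp
  qed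
  have D_int: "integrable lborel D"
  proof (rule integrableI_nonneg)
    have "(\<integral>\<^sup>+ x. ennreal (D x) \<partial>lborel) = emeasure M UNIV"
      using D(1) by (subst dens[symmetric]) (simp add: emeasure_density)
    then show "(\<integral>\<^sup>+ x. ennreal (D x) \<partial>lborel) < \<infinity>"
      using M.emeasure_finite[of UNIV] by (simp add: less_top[symmetric])
  qed (use D in auto)
  have D_set: "set_integrable lborel {x..y} D" for x y
    using D_int unfolding set_integrable_def by (intro integrable_mult_indicator) auto
  have cdf_integral: "cdf M y - cdf M x = integral {x..y} D" if xy: "x \<le> y" for x y
  proof -
    have "measure M {x..y} = measure M {x<..y}"
    proof -
      have "measure M ({x} \<union> {x<..y}) = measure M {x} + measure M {x<..y}"
        by (intro M.finite_measure_Union) auto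
      moreover have "{x} \<union> {x<..y} = {x..y}" using xy by auto
      ultimately show ?thesis using null_singleton[of x] by simp
    qed
    moreover have "measure M {x..y} = (LINT z:{x..y}|lborel. D z)"
    proof -
      have "emeasure M {x..y} = (\<integral>\<^sup>+ z. ennreal (D z) * indicator {x..y} z \<partial>lborel)"
        using D(1) by (subst dens[symmetric]) (simp add: emeasure_density)
      also have "\<dots> = (\<integral>\<^sup>+ z. ennreal (indicator {x..y} z *\<^sub>R D z) \<partial>lborel)"
        by (intro nn_integral_cong) (auto simp: indicator_def)
      also have "\<dots> = ennreal (LINT z:{x..y}|lborel. D z)"
        using D_set[of x y] D(4) unfolding set_integrable_def set_lebesgue_integral_def
        by (intro nn_integral_eq_integral) auto
      finally show ?thesis
        using D(4) by (simp add: measure_def set_lebesgue_integral_def integral_nonneg_AE)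
    qed
    ultimately show ?thesis
      using Ioc[OF xy] set_borel_integral_eq_integral(2)[OF D_set] by simp
  qed
  have "D integrable_on cbox x y" for x y :: real
    using set_borel_integral_eq_integral(1)[OF D_set] by (simp add: cbox_interval)
  \<comment> \<open>Lebesgue differentiation over cubes with lower corner x. In dimension one these
    are the intervals to the right of x, hence the one-sided derivative.\<close>
  then obtain N where N: "negligible N" "\<And>x e. x \<notin> N \<Longrightarrow> 0 < e \<Longrightarrow> \<exists>d>0. \<forall>y. 0 < y \<and> y < d \<longrightarrow>
      norm (integral (cbox x (x + y *\<^sub>R One)) D /\<^sub>R y ^ DIM(real) - D x) < e"
    using integrable_ccontinuous_explicit[of D] by blast
  have "AE x in lborel. x \<notin> N"
  proof -
    have "N \<in> null_sets lebesgue" using N(1) by (simp add: negligible_iff_null_sets)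
    then have "AE x in lebesgue. x \<notin> N" by (rule AE_not_in)
    then show ?thesis by (simp add: AE_completion_iff)
  qed
  then have "AE x in M. x \<notin> N"
    using absolutely_continuous_AE[OF _ ac] by simp
  moreover have "AE x in M. x \<in> {0..<1}"
  proof -
    have "- {0..<1} \<in> null_sets M" using out by (auto simp: null_sets_def)
    then have "AE x in M. x \<notin> - {0..<1}" by (rule AE_not_in)
    then show ?thesis by simp
  qed
  ultimately have ae: "AE x in M. x \<notin> N \<and> x \<in> {0..<1} \<and> 0 < D x" using D(3) by eventually_elim simp
  have "\<exists>x. x \<notin> N \<and> x \<in> {0..<1} \<and> 0 < D x"
  proof (rule ccontr)
    assume none: "\<nexists>x. x \<notin> N \<and> x \<in> {0..<1} \<and> 0 < D x"
    have "AE x in M. False" using ae by eventually_elim (use none in blast)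
    then obtain Z where Z: "Z \<in> null_sets M" "UNIV \<subseteq> Z"
      by (auto simp: eventually_ae_filter M.borel_UNIV)
    then have "emeasure M {0..<1} \<le> emeasure M Z" by (intro emeasure_mono) auto
    then show False using pos Z(1) by (simp add: measure_def null_sets_def)
  qed
  then obtain x0 where x0: "x0 \<notin> N" "0 \<le> x0" "x0 < 1" "0 < D x0" by auto
  show thesis
  proof (rule that[OF h_cont mono h_shift conj])
    show "0 < D x0 / m" using x0 m by simp
    show "((\<lambda>y. (h (x0 + y) - h x0) / y) \<longlongrightarrow> D x0 / m) (at_right 0)"
      unfolding tendsto_at_right_0_iff
    proof (intro allI impI)
      fix e :: real assume e: "0 < e"
      have "0 < e * m" using e m by simp
      from N(2)[OF x0(1) this] obtain d where d: "0 < d"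
        "\<And>y. 0 < y \<Longrightarrow> y < d \<Longrightarrow> \<bar>integral {x0..x0 + y} D / y - D x0\<bar> < e * m"
        by (auto simp: cbox_interval divide_inverse mult.commute)
      show "\<exists>d>0. \<forall>y. 0 < y \<and> y < d \<longrightarrow> \<bar>(h (x0 + y) - h x0) / y - D x0 / m\<bar> < e"
      \<comment> \<open>The entry 1 - x0 keeps x0 + y in the unit interval, where \<open>h\<close>
        is \<open>cdf M\<close> divided by m.\<close>
      proof (intro exI[of _ "min d (1 - x0)"] conjI allI impI)
        show "0 < min d (1 - x0)" using d x0 by simp
        fix y assume y: "0 < y \<and> y < min d (1 - x0)"
        have "h (x0 + y) - h x0 = (cdf M (x0 + y) - cdf M x0) / m"
        proof -
          have "\<lfloor>x0 + y\<rfloor> = 0" "\<lfloor>x0\<rfloor> = 0" using x0 y by (auto simp: floor_eq_iff)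
          then show ?thesis by (simp add: h_def frac_def diff_divide_distrib)
        qed
        also have "\<dots> = integral {x0..x0 + y} D / m" using cdf_integral[of x0 "x0 + y"] y by simp
        finally have "(h (x0 + y) - h x0) / y - D x0 / m = (integral {x0..x0 + y} D / y - D x0) / m"
          by (simp add: diff_divide_distrib mult.commute)
        then show "\<bar>(h (x0 + y) - h x0) / y - D x0 / m\<bar> < e"
          using d(2)[of y] y m by (simp add: pos_divide_less_eq)
      qed
    qed
  qed
qed

section \<open>Singularity of the invariant measure\<close>

lemma C_class_2D:
  assumes "C_class k f" "2 \<le> k"
  shows "(f has_real_derivative deriv f x) (at x)"
    and "(deriv f has_real_derivative deriv (deriv f) x) (at x)"
    and "continuous_on UNIV (deriv (deriv f))"
proof -
  have diff: "(deriv ^^ i) f field_differentiable at x" if "i < k" for i x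
    using assms(1) that by (simp add: C_class_def)
  show "(f has_real_derivative deriv f x) (at x)"
    using diff[of 0 x] assms(2) by (simp add: field_differentiable_derivI)
  show "(deriv f has_real_derivative deriv (deriv f) x) (at x)"
    using diff[of 1 x] assms(2) by (simp add: field_differentiable_derivI)
  have eq: "(deriv ^^ 2) f = deriv (deriv f)" by (simp add: numeral_2_eq_2)
  show "continuous_on UNIV (deriv (deriv f))"
  proof (cases "k = 2")
    case True
    then show ?thesis using assms(1) eq by (simp add: C_class_def)
  next
    case False
    then have "(deriv ^^ 2) f field_differentiable at x" for x using assms(2) by (intro diff) auto
    then show ?thesis
      unfolding eq by (intro continuous_at_imp_continuous_on ballI field_differentiable_imp_continuous_at)
  qed
qed

lemma circle_homeo_liftD:
  assumes "circle_homeo_lift F"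
  shows "continuous_on UNIV F" "strict_mono F" "F (x + 1) = F x + 1" "F (x + of_int n) = F x + of_int n"
    "bij F"
proof -
  have *: "continuous_on UNIV F" "strict_mono F" "\<And>x. F (x + 1) = F x + 1"
    using assms unfolding circle_homeo_lift_def by blast+
  then show "continuous_on UNIV F" "strict_mono F" "F (x + 1) = F x + 1" by blast+
  show "F (x + of_int n) = F x + of_int n"
    using periodic_int_shift[of F 1 x n, OF *(3)] by simp
  have "\<exists>x. F x = y" for y by (rule degree_one_surj[OF *(1,3), of y]) blast
  then have "surj F" by (metis surj_def)
  then show "bij F" using *(2) by (simp add: bij_def strict_mono_imp_inj_on)
qed

lemma inv_circle_homeo_lift:
  assumes "circle_homeo_lift F"
  shows "F (inv F y) = y" "inv F (F x) = x" "strict_mono (inv F)" "inv F (y + 1) = inv F y + 1"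
    "isCont (inv F) y"
proof -
  note F = circle_homeo_liftD[OF assms]
  have FK: "F (inv F y) = y" for y using F(5) by (simp add: bij_def surj_f_inv_f)
  have KF: "inv F (F x) = x" for x using F(5) by (simp add: bij_def)
  show "F (inv F y) = y" "inv F (F x) = x" by (rule FK, rule KF)
  show "strict_mono (inv F)"
    using FK F(2) by (metis strict_mono_less strict_monoI)
  show "inv F (y + 1) = inv F y + 1" using F(3)[of "inv F y"] FK KF by metis
  have "isCont (inv F) (F (inv F y))"
  proof (rule isCont_inverse_function2[where a = "inv F y - 1" and b = "inv F y + 1" and f = F and x = "inv F y"])
    show "isCont F z" for z using F(1) by (simp add: continuous_on_eq_continuous_at)
  qed (auto simp: KF)
  then show "isCont (inv F) y" by (simp add: FK)
qed

lemma deriv_nonneg_lift: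
  assumes "circle_homeo_lift F" "(F has_real_derivative D) (at x)"
  shows "0 \<le> D"
proof -
  have "mono_on UNIV F" using circle_homeo_liftD(2)[OF assms(1)] by (simp add: strict_mono_mono)
  then show ?thesis using mono_on_imp_deriv_nonneg[OF _ assms(2)] by simp
qed

text \<open>\<open>h\<close> stays within bounded distance of the identity by periodicity, so orbits
  of F and of the translation by \<tau> have the same mean displacement.\<close>

lemma rotation_number_semiconjugacy:
  assumes "mono h" "\<And>x. h (x + 1) = h x + 1" "\<And>x. h (F x) = h x + \<tau>"
  shows "rotation_number F = frac \<tau>"
proof -
  have iter: "h ((F ^^ n) 0) = h 0 + real n * \<tau>" for n
    by (induction n) (auto simp: assms(3) algebra_simps)
  have near: "\<bar>h x - x - h 0\<bar> \<le> 1" for x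
  proof -
    have shift: "h (of_int n) = h 0 + of_int n" for n
      using periodic_int_shift[of h 1 0 n] assms(2) by simp
    have "h (of_int \<lfloor>x\<rfloor>) \<le> h x" "h x \<le> h (of_int (\<lfloor>x\<rfloor> + 1))"
      using assms(1) by (auto intro!: monoD[of h] simp del: of_int_add) linarith
    then show ?thesis unfolding shift by simp linarith
  qed
  have "(\<lambda>n. (F ^^ n) 0 / real n) \<longlonglongrightarrow> \<tau>"
  proof (rule LIM_zero_cancel, rule Lim_null_comparison)
    show "\<forall>\<^sub>F n in sequentially. norm ((F ^^ n) 0 / real n - \<tau>) \<le> 1 / real n"
    proof (rule eventually_sequentiallyI[of 1])
      fix n :: nat assume n: "1 \<le> n"
      have "\<bar>(F ^^ n) 0 - real n * \<tau>\<bar> \<le> 1" using near[of "(F ^^ n) 0"] iter[of n] by linarith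
      moreover have "(F ^^ n) 0 / real n - \<tau> = ((F ^^ n) 0 - real n * \<tau>) / real n"
        using n by (simp add: field_simps)
      ultimately show "norm ((F ^^ n) 0 / real n - \<tau>) \<le> 1 / real n"
        using n by (simp add: divide_right_mono)
    qed
    show "(\<lambda>n. 1 / real n) \<longlonglongrightarrow> 0" by (rule lim_1_over_n)
  qed
  then show ?thesis unfolding rotation_number_def by (simp add: limI)
qed

lemma badly_approximable_frac:
  assumes "badly_approximable c (frac \<tau>)"
  shows "badly_approximable c \<tau>"
  unfolding badly_approximable_def
proof (intro conjI allI impI)
  show "0 < c" "c \<le> 1" using assms by (auto simp: badly_approximable_def)
  fix m p :: int assume m: "1 \<le> real_of_int m"
  have "c / m \<le> \<bar>m * frac \<tau> - of_int (p - m * \<lfloor>\<tau>\<rfloor>)\<bar>"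
    using assms m unfolding badly_approximable_def by blast
  also have "m * frac \<tau> - of_int (p - m * \<lfloor>\<tau>\<rfloor>) = m * \<tau> - p" by (simp add: frac_def algebra_simps)
  finally show "c / m \<le> \<bar>m * \<tau> - p\<bar>" .
qed

text \<open>The inverse lift is differentiable away from the critical values, hence takes null sets
  to null sets there; the points over the critical values are integers and form a null set.\<close>

lemma circle_map_vimage_negligible:
  assumes F: "circle_homeo_lift F" and deriv: "\<And>x. (F has_real_derivative F' x) (at x)"
    and crit: "\<And>x. F' x = 0 \<Longrightarrow> x \<in> \<int>" and A: "A \<in> null_sets lborel"
  shows "negligible {x \<in> {0..<1}. circle_map F x \<in> A}"
proof -
  note inv_F = inv_circle_homeo_lift[OF F]
  \<comment> \<open>The set of all real points that project into A, so that the lift can be used in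
    place of the circle map.\<close>
  define U where "U = (\<Union>n::int. (\<lambda>x. of_int n + x) ` A)"
  have "A \<in> null_sets lebesgue" using A by (rule null_sets_completionI)
  then have "negligible A" by (simp add: negligible_iff_null_sets)
  then have "negligible U"
    unfolding U_def by (intro negligible_countable_Union) (auto intro: negligible_translation)
  then have neg: "negligible (U - F ` \<int>)" by (rule negligible_subset) auto
  have "inv F differentiable_on (U - F ` \<int>)"
    unfolding differentiable_on_def
  proof
    fix y assume "y \<in> U - F ` \<int>"
    then have "y \<notin> F ` \<int>" by blast
    have "inv F y \<notin> \<int>"
    proof
      assume "inv F y \<in> \<int>"
      then have "F (inv F y) \<in> F ` \<int>" by (rule imageI)
      then show False using \<open>y \<notin> F ` \<int>\<close> unfolding inv_F(1) by blast
    qed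
    then have "F' (inv F y) \<noteq> 0" using crit by blast
    have "(inv F has_real_derivative inverse (F' (inv F y))) (at y)"
    proof (rule DERIV_inverse_function)
      show "(F has_real_derivative F' (inv F y)) (at (inv F y))" by (rule deriv)
      show "F' (inv F y) \<noteq> 0" by fact
      show "y - 1 < y" "y < y + 1" by simp_all
      show "F (inv F z) = z" for z by (rule inv_F(1))
      show "isCont (inv F) y" by (rule inv_F(5))
    qed
    then have "inv F differentiable (at y)" unfolding real_differentiable_def by blast
    then show "inv F differentiable (at y within U - F ` \<int>)" by (rule differentiable_at_withinI)
  qed
  then have "negligible (inv F ` (U - F ` \<int>))"
    by (intro negligible_differentiable_image_negligible neg) auto
  moreover have "negligible (\<int> :: real set)"
    unfolding negligible_iff_null_sets
    by (intro null_sets_completionI countable_imp_null_set_lborel) (simp add: Ints_def)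
  ultimately have "negligible (inv F ` (U - F ` \<int>) \<union> \<int>)" by (rule negligible_Un)
  then show ?thesis
  proof (rule negligible_subset)
    show "{x \<in> {0..<1}. circle_map F x \<in> A} \<subseteq> inv F ` (U - F ` \<int>) \<union> \<int>"
    proof
      fix x assume "x \<in> {x \<in> {0..<1}. circle_map F x \<in> A}"
      then have "frac (F x) \<in> A" by (simp add: circle_map_def)
      then have "F x \<in> U" unfolding U_def by (intro UN_I[of "\<lfloor>F x\<rfloor>"]) (auto simp: frac_def image_iff intro!: bexI[of _ "frac (F x)"])
      show "x \<in> inv F ` (U - F ` \<int>) \<union> \<int>"
      proof (cases "x \<in> \<int>")
        case False
        then have "F x \<notin> F ` \<int>" by (metis imageE inv_F(2))
        then show ?thesis using \<open>F x \<in> U\<close> inv_F(2)[of x] by (metis DiffI UnI1 imageI)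
      qed simp
    qed
  qed
qed

text \<open>\<open>H 0 = 0\<close> makes H preserve the integers, so the critical set of the
  conjugated lift is contained in them. Its derivatives \<open>G1\<close> and \<open>G2\<close> are
  written out by the chain rule.\<close>

lemma class_F_conjugate_cubic_map:
  assumes "class_F F"
  obtains H r e G1 G2 where "C2_circle_coordinate H"
    "cubic_map (\<lambda>x. H (F (inv H x))) G1 G2 r e"
proof -
  have F: "circle_homeo_lift F" and F3: "C_class 3 F" and crit: "\<And>x. deriv F x = 0 \<longleftrightarrow> x \<in> \<int>"
    and "cubic_near_zero F"
    using assms by (auto simp: class_F_def)
  then obtain H e where coord: "C2_circle_coordinate H" and H0: "H 0 = 0"
    and near: "\<forall>\<^sub>F x in nhds 0. H (F (inv H x)) = x ^ 3 + e"
    by (auto simp: cubic_near_zero_def)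
  define K where "K = inv H"
  have H: "circle_homeo_lift H" and H2: "C_class 2 H" and K2: "C_class 2 K"
    using coord by (auto simp: C2_circle_coordinate_def K_def)
  note lift_F = circle_homeo_liftD[OF F] and lift_H = circle_homeo_liftD[OF H]
  note K = inv_circle_homeo_lift[OF H, folded K_def]
  note dF = C_class_2D[OF F3, simplified] and dH = C_class_2D[OF H2, simplified]
    and dK = C_class_2D[OF K2, simplified]
  define G where "G x = H (F (K x))" for x
  define G1 where "G1 x = deriv H (F (K x)) * (deriv F (K x) * deriv K x)" for x
  define G2 where "G2 x = deriv (deriv H) (F (K x)) * (deriv F (K x) * deriv K x) * (deriv F (K x) * deriv K x)
      + deriv H (F (K x)) * (deriv (deriv F) (K x) * deriv K x * deriv K x + deriv F (K x) * deriv (deriv K) x)" for x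
  have dFK: "((\<lambda>x. F (K x)) has_real_derivative deriv F (K x) * deriv K x) (at x)" for x
    by (rule DERIV_chain2[OF dF(1) dK(1)])
  have dG: "(G has_real_derivative G1 x) (at x)" for x
    unfolding G_def[abs_def] G1_def by (rule DERIV_chain2[OF dH(1) dFK])
  have dG1: "(G1 has_real_derivative G2 x) (at x)" for x
    unfolding G1_def[abs_def] G2_def
    by (rule derivative_eq_intros DERIV_chain2[OF dH(2) dFK] DERIV_chain2[OF dF(2) dK(1)] dK(2) refl)+
       (simp add: algebra_simps)
  have cont: "continuous_on UNIV f" if "\<And>x. (f has_real_derivative f' x) (at x)" for f f' :: "real \<Rightarrow> real"
    using that by (intro continuous_at_imp_continuous_on ballI DERIV_isCont)
  have cont_G2: "continuous_on UNIV G2"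
    unfolding G2_def[abs_def]
    by (intro continuous_intros continuous_on_compose2[OF dH(3) cont[OF dFK]] continuous_on_compose2[OF cont[OF dH(2)] cont[OF dFK]]
        continuous_on_compose2[OF cont[OF dF(2)] cont[OF dK(1)]] continuous_on_compose2[OF dF(3) cont[OF dK(1)]]
        cont[OF dK(2)] dK(3)) auto
  \<comment> \<open>A monotone diffeomorphism has nonnegative derivative; this identity excludes the
    value 0 for H and its inverse.\<close>
  have H'K': "deriv K (H y) * deriv H y = 1" for y
  proof -
    have "((\<lambda>y. K (H y)) has_real_derivative deriv K (H y) * deriv H y) (at y)"
      by (rule DERIV_chain2[OF dK(1) dH(1)])
    moreover have "((\<lambda>y. K (H y)) has_real_derivative 1) (at y)" by (simp add: K)
    ultimately show ?thesis by (rule DERIV_unique)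
  qed
  have H'_pos: "0 < deriv H y" for y
    using H'K'[of y] deriv_nonneg_lift[OF H dH(1), of y] by (cases "deriv H y = 0") auto
  have K'_pos: "0 < deriv K x" for x
    using H'K'[of "K x"] H'_pos[of "K x"] by (simp add: K) (metis zero_less_mult_pos2 zero_less_one)
  have G1_pos: "0 < G1 x" if "x \<notin> \<int>" for x
  proof -
    have "K x \<notin> \<int>"
    proof
      assume "K x \<in> \<int>"
      then obtain n where "K x = of_int n" by (auto elim: Ints_cases)
      then have "x = H (0 + of_int n)" using K(1)[of x] by simp
      then have "x = of_int n" using lift_H(4)[of 0 n] H0 by simp
      then show False using that by simp
    qed
    then have "0 < deriv F (K x)" using crit deriv_nonneg_lift[OF F dF(1), of "K x"] by (simp add: order_less_le)
    then show ?thesis using H'_pos K'_pos by (simp add: G1_def)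
  qed
  from near obtain d where d: "0 < d" "\<And>x. dist x 0 < d \<Longrightarrow> G x = x ^ 3 + e"
    unfolding eventually_nhds_metric G_def K_def by blast
  have "cubic_map G G1 G2 (min d (1 / 4)) e"
  proof
    show "G (x + 1) = G x + 1" for x unfolding G_def by (simp only: K(4) lift_F(3) lift_H(3))
    show "strict_mono G"
      unfolding G_def using K(3) lift_F(2) lift_H(2) by (simp add: strict_mono_def)
    show "G x = x ^ 3 + e" if "\<bar>x\<bar> < min d (1 / 4)" for x using d(2)[of x] that by (simp add: dist_real_def)
  qed (use dG dG1 cont_G2 G1_pos d in auto)
  then show thesis using that[OF coord] by (simp add: G_def[abs_def] K_def)
qed

theorem proposition1:
  fixes F :: "real \<Rightarrow> real" and \<mu> :: "real measure"
  assumes "class_F F"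
    and "circle_prob_measure \<mu>"
    and "invariant_measure (circle_map F) \<mu>"
  shows "mutually_singular \<mu> circle_lebesgue"
proof (rule ccontr)
  assume not_singular: "\<not> mutually_singular \<mu> circle_lebesgue"
  have F: "circle_homeo_lift F" and F3: "C_class 3 F" and crit: "\<And>x. deriv F x = 0 \<longleftrightarrow> x \<in> \<int>"
    and ct: "constant_type (rotation_number F)"
    using assms(1) by (auto simp: class_F_def)
  have nonsing: "negligible {x \<in> {0..<1}. circle_map F x \<in> A}" if "A \<in> null_sets lborel" for A
    by (rule circle_map_vimage_negligible[OF F _ _ that, of "deriv F"])
       (use C_class_2D(1)[OF F3] crit in auto)
  obtain M where M: "finite_borel_measure M" "absolutely_continuous lborel M"
    "0 < measure M {0..<1}" "emeasure M (- {0..<1}) = 0"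
    "\<And>A. A \<in> sets borel \<Longrightarrow> A \<subseteq> {0..<1} \<Longrightarrow> measure M {x \<in> {0..<1}. circle_map F x \<in> A} = measure M A"
    using absolutely_continuous_invariant_part[OF assms(2,3) nonsing not_singular] by blast
  obtain h \<tau> \<kappa> x0 where h: "continuous_on UNIV h" "mono h" "\<And>x. h (x + 1) = h x + 1"
    "\<And>x. h (F x) = h x + \<tau>" "0 < \<kappa>"
    "((\<lambda>y. (h (x0 + y) - h x0) / y) \<longlongrightarrow> \<kappa>) (at_right 0)"
    using absolutely_continuous_semiconjugacy[OF F M] by blast
  have "constant_type (frac \<tau>)" using ct rotation_number_semiconjugacy[OF h(2,3,4)] by simp
  then obtain c where "badly_approximable c (frac \<tau>)"
    by (rule constant_type_badly_approximable) (auto simp: frac_lt_1)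
  then have bad: "badly_approximable c \<tau>" by (rule badly_approximable_frac)
  obtain H r e G1 G2 where coord: "C2_circle_coordinate H"
    and cubic: "cubic_map (\<lambda>x. H (F (inv H x))) G1 G2 r e"
    by (rule class_F_conjugate_cubic_map[OF assms(1)])
  define K where "K = inv H"
  have H: "circle_homeo_lift H" and K2: "C_class 2 K" and H2: "C_class 2 H"
    using coord by (auto simp: C2_circle_coordinate_def K_def)
  note K = inv_circle_homeo_lift[OF H, folded K_def]
  note dK = C_class_2D(1)[OF K2, simplified]
  \<comment> \<open>Conjugating F by H replaces h by h composed with K and leaves the translation
    \<tau> unchanged.\<close>
  interpret cubic_semiconjugacy "\<lambda>x. H (F (K x))" G1 G2 r e "\<lambda>x. h (K x)" \<tau> c
  proof (intro cubic_semiconjugacy.intro cubic_semiconjugacy_axioms.intro)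
    show "cubic_map (\<lambda>x. H (F (K x))) G1 G2 r e" using cubic by (simp add: K_def)
    have "continuous_on UNIV K" using K(5) by (simp add: continuous_at_imp_continuous_on)
    then show "continuous_on UNIV (\<lambda>x. h (K x))" using continuous_on_compose2[OF h(1)] by auto
    show "mono (\<lambda>x. h (K x))" using h(2) strict_mono_mono[OF K(3)] by (simp add: mono_def)
  qed (use K h bad in auto)
  define y0 where "y0 = H x0"
  have Ky0: "K y0 = x0" by (simp add: y0_def K)
  \<comment> \<open>The derivative of h at x0 is known from the right only. As K is increasing, u is
    positive for positive arguments, so the one-sided limit can be composed with it; the quotient
    then splits into that of h and that of K.\<close>
  define u where "u y = K (y0 + y) - x0" for y
  have u_pos: "0 < u y" if "0 < y" for y
    using strict_mono_less[OF K(3), of y0 "y0 + y"] that by (simp add: u_def Ky0)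
  have quot: "((\<lambda>y. u y / y) \<longlongrightarrow> deriv K y0) (at_right 0)"
    using dK[of y0] unfolding DERIV_def u_def Ky0[symmetric] by (rule filterlim_mono) (auto simp: at_within_le_at)
  have lim_u: "filterlim u (at_right 0) (at_right 0)"
    unfolding filterlim_at
  proof
    show "\<forall>\<^sub>F y in at_right 0. u y \<in> {0<..} \<and> u y \<noteq> 0"
      using eventually_at_right_less[of 0] by eventually_elim (use u_pos in force)
    have "isCont (\<lambda>y. K (y0 + y) - x0) 0"
      using K(5)[of y0] by (intro continuous_intros isCont_o2[of _ "\<lambda>y. y0 + y" K]) auto
    then have "(u \<longlongrightarrow> u 0) (at 0)" by (simp add: isCont_def u_def[abs_def])
    then show "(u \<longlongrightarrow> 0) (at_right 0)"
      using tendsto_mono[OF at_within_le_at] by (simp add: u_def Ky0)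
  qed
  have "((\<lambda>y. (h (x0 + u y) - h x0) / u y * (u y / y)) \<longlongrightarrow> \<kappa> * deriv K y0) (at_right 0)"
    by (intro tendsto_mult quot filterlim_compose[OF h(6) lim_u])
  moreover have "\<forall>\<^sub>F y in at_right 0. (h (x0 + u y) - h x0) / u y * (u y / y) = (h (K (y0 + y)) - h (K y0)) / y"
    using eventually_at_right_less[of 0]
    by eventually_elim (use u_pos in \<open>force simp: u_def Ky0\<close>)
  ultimately have "((\<lambda>y. (h (K (y0 + y)) - h (K y0)) / y) \<longlongrightarrow> \<kappa> * deriv K y0) (at_right 0)"
    by (rule Lim_transform_eventually)
  moreover have "0 < \<kappa> * deriv K y0"
  proof -
    have "((\<lambda>y. K (H y)) has_real_derivative deriv K (H x0) * deriv H x0) (at x0)"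
      by (rule DERIV_chain2[OF dK C_class_2D(1)[OF H2]]) simp
    moreover have "((\<lambda>y. K (H y)) has_real_derivative 1) (at x0)" by (simp add: K)
    ultimately have "deriv K y0 * deriv H x0 = 1" unfolding y0_def by (rule DERIV_unique)
    then have "deriv K y0 \<noteq> 0" by auto
    moreover have "mono_on UNIV K" using K(3) by (simp add: strict_mono_mono)
    then have "0 \<le> deriv K y0" using mono_on_imp_deriv_nonneg[OF _ dK[of y0]] by simp
    ultimately show ?thesis using h(5) by simp
  qed
  ultimately show False using no_positive_right_derivative by blast
qed

end
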